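(* Let $X=V(f)\subset\mathbb P^N$, $N\geq4$, be an irreducible cubic hypersurface. Suppose that there exists a linear space $S=V(x_{\tau+1},\dots,x_N)=\mathbb P^\tau$ contained in the singular locus of $X$. Then, up to projective transformations, $$f=\sum_{i=0}^{\tau}x_iC^i(x_{\tau+1},\dots,x_N)+D(x_{\tau+1},\dots,x_N),$$ with $C^i(x_{\tau+1},\dots,x_N)$ a quadratic form for every $i=0,\dots,\tau$ and $D(x_{\tau+1},\dots,x_N)$ a cubic form. Moreover: (i) if $\tau>\frac{N-1}{2}$, then $X$ has vanishing hessian; (ii) if $\tau>\frac{(N-\tau)(N-\tau+1)}{2}-1$, then $X$ is a cone. In particular, for $N>4$ every non-normal irreducible cubic hypersurface in $\mathbb P^N$ is a cone.
   Context: The ground field $\mathbb K$ is algebraically closed of characteristic zero. $X=V(f)$ has vanishing hessian if $\det\left[\frac{\partial^2f}{\partial x_i\partial x_j}\right]_{0\le i,j\le N}\equiv0$. $X$ is a cone if there is $p\in X$ with $\langle p,q\rangle\subset X$ for all $q\in X$, $q\ne p$. *)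

theory Defs
  imports
    "HOL-Library.Poly_Mapping"
    "HOL-Computational_Algebra.Fraction_Field"
    "HOL-Computational_Algebra.Polynomial"
    "HOL-Algebra.QuotRing"
    "Jordan_Normal_Form.Determinant"
begin

text \<open>
  Polynomials in the variables \<open>x\<^sub>0, x\<^sub>1, \<dots>\<close>: finitely supported maps from exponent
  vectors to coefficients, with the convolution product of \<^theory>\<open>HOL-Library.Poly_Mapping\<close>.
  The polynomial ring of \<open>\<P>\<^sup>N\<close> consists of those involving only \<open>x\<^sub>0, \<dots>, x\<^sub>N\<close>. A factor of a
  nonzero such polynomial again involves only \<open>x\<^sub>0, \<dots>, x\<^sub>N\<close>, so divisibility by it and its
  irreducibility may be read in the full ring.
\<close>

type_synonym 'k mpoly = "(nat \<Rightarrow>\<^sub>0 nat) \<Rightarrow>\<^sub>0 'k"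

definition const :: "'k \<Rightarrow> 'k::comm_ring_1 mpoly" where
  "const c = Poly_Mapping.single 0 c"

definition xvar :: "nat \<Rightarrow> 'k::comm_ring_1 mpoly" where
  "xvar i = Poly_Mapping.single (Poly_Mapping.single i 1) 1"

definition forms :: "nat set \<Rightarrow> nat \<Rightarrow> 'k::comm_ring_1 mpoly set" where
  "forms V d = {p. \<forall>m \<in> Poly_Mapping.keys p. Poly_Mapping.keys m \<subseteq> V \<and>
      (\<Sum>i \<in> Poly_Mapping.keys m. Poly_Mapping.lookup m i) = d}"

definition pdiff :: "nat \<Rightarrow> 'k::comm_ring_1 mpoly \<Rightarrow> 'k mpoly" where
  "pdiff i p = (\<Sum>m \<in> Poly_Mapping.keys p.
      Poly_Mapping.single (m - Poly_Mapping.single i 1)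
        (of_nat (Poly_Mapping.lookup m i) * Poly_Mapping.lookup p m))"

definition peval :: "'k::comm_ring_1 mpoly \<Rightarrow> 'k vec \<Rightarrow> 'k" where
  "peval p v = (\<Sum>m \<in> Poly_Mapping.keys p. Poly_Mapping.lookup p m *
      (\<Prod>i \<in> Poly_Mapping.keys m. v $ i ^ Poly_Mapping.lookup m i))"

text \<open>The polynomial \<open>p(A x)\<close>, for a square matrix \<open>A\<close> acting on \<open>x = (x\<^sub>0, \<dots>, x\<^sub>N)\<close>.\<close>

definition lin_subst :: "'k::comm_ring_1 mat \<Rightarrow> 'k mpoly \<Rightarrow> 'k mpoly" where
  "lin_subst A p = (\<Sum>m \<in> Poly_Mapping.keys p. const (Poly_Mapping.lookup p m) *
      (\<Prod>i \<in> Poly_Mapping.keys m.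
        (\<Sum>j < dim_col A. const (A $$ (i, j)) * xvar j) ^ Poly_Mapping.lookup m i))"

text \<open>
  Points of projective space are represented by all their homogeneous coordinate vectors, so a
  subset of \<open>\<P>\<^sup>N\<close> is a set of nonzero vectors that is closed under nonzero scaling.
\<close>

definition proj_space :: "nat \<Rightarrow> 'k::field vec set" where
  "proj_space N = carrier_vec (N + 1) - {0\<^sub>v (N + 1)}"

definition hypersurface :: "nat \<Rightarrow> 'k::field mpoly \<Rightarrow> 'k vec set" where
  "hypersurface N f = {p \<in> proj_space N. peval f p = 0}"

definition sing_locus :: "nat \<Rightarrow> 'k::field mpoly \<Rightarrow> 'k vec set" where
  "sing_locus N f = {p \<in> hypersurface N f. \<forall>i \<le> N. peval (pdiff i f) p = 0}"

text \<open>The linear space \<open>V(x\<^sub>t\<^sub>+\<^sub>1, \<dots>, x\<^sub>N)\<close>.\<close>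

definition coord_space :: "nat \<Rightarrow> nat \<Rightarrow> 'k::field vec set" where
  "coord_space N t = {p \<in> proj_space N. \<forall>i. t < i \<and> i \<le> N \<longrightarrow> p $ i = 0}"

text \<open>The \<open>t\<close>-dimensional linear subspaces of \<open>\<P>\<^sup>N\<close>: images of \<open>\<P>\<^sup>t\<close> under injective linear maps.\<close>

definition linear_space :: "nat \<Rightarrow> nat \<Rightarrow> 'k::field vec set \<Rightarrow> bool" where
  "linear_space N t S \<longleftrightarrow> (\<exists>B \<in> carrier_mat (N + 1) (t + 1).
      inj_on ((*\<^sub>v) B) (carrier_vec (t + 1)) \<and> S = (*\<^sub>v) B ` proj_space t)"

definition proj_transformation :: "nat \<Rightarrow> 'k::field mat \<Rightarrow> bool" where
  "proj_transformation N A \<longleftrightarrow> A \<in> carrier_mat (N + 1) (N + 1) \<and> invertible_mat A"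

definition hessian :: "nat \<Rightarrow> 'k::comm_ring_1 mpoly \<Rightarrow> 'k mpoly" where
  "hessian N f = det (mat (N + 1) (N + 1) (\<lambda>(i, j). pdiff i (pdiff j f)))"

definition is_cone :: "'k::field vec set \<Rightarrow> bool" where
  "is_cone X \<longleftrightarrow> (\<exists>p \<in> X. \<forall>q \<in> X. (\<nexists>c. q = c \<cdot>\<^sub>v p) \<longrightarrow>
      (\<forall>s t. s \<noteq> 0 \<or> t \<noteq> 0 \<longrightarrow> s \<cdot>\<^sub>v p + t \<cdot>\<^sub>v q \<in> X))"

text \<open>
  Normality of \<open>X = V(f)\<close> for an irreducible form \<open>f\<close>. The local ring of \<open>\<P>\<^sup>N\<close> at the generic
  point of \<open>X\<close> consists of the quotients \<open>a / b\<close> of forms of equal degree with \<open>b\<close> not in \<open>(f)\<close>;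
  the function field of \<open>X\<close> is its residue field, i.e. the degree-zero part of the
  localisation of the homogeneous coordinate ring \<open>K[x\<^sub>0, \<dots>, x\<^sub>N] / (f)\<close> at its nonzero
  homogeneous elements. The local ring of \<open>X\<close> at \<open>p\<close> is the subring of the function field
  given by the fractions whose denominator does not vanish at \<open>p\<close>.
\<close>

definition generic_local_ring :: "nat \<Rightarrow> 'k::field mpoly \<Rightarrow> 'k mpoly fract ring" where
  "generic_local_ring N f =
     \<lparr>carrier = {Fract a b |a b d. a \<in> forms {..N} d \<and> b \<in> forms {..N} d \<and> \<not> f dvd b},
      monoid.mult = (*), one = 1, zero = 0, add = (+)\<rparr>"

definition generic_ideal :: "nat \<Rightarrow> 'k::field mpoly \<Rightarrow> 'k mpoly fract set" where
  "generic_ideal N f =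
     {Fract a b |a b d. a \<in> forms {..N} d \<and> b \<in> forms {..N} d \<and> f dvd a \<and> \<not> f dvd b}"

definition function_field :: "nat \<Rightarrow> 'k::field mpoly \<Rightarrow> 'k mpoly fract set ring" where
  "function_field N f = generic_local_ring N f Quot generic_ideal N f"

definition local_ring_at :: "nat \<Rightarrow> 'k::field mpoly \<Rightarrow> 'k vec \<Rightarrow> 'k mpoly fract set set" where
  "local_ring_at N f p =
     {generic_ideal N f +>\<^bsub>generic_local_ring N f\<^esub> Fract a b |a b d.
        a \<in> forms {..N} d \<and> b \<in> forms {..N} d \<and> peval b p \<noteq> 0}"

definition integral_over :: "('a, 'b) ring_scheme \<Rightarrow> 'a set \<Rightarrow> 'a \<Rightarrow> bool" where
  "integral_over R A z \<longleftrightarrow> (\<exists>n c. c \<in> {..<n} \<rightarrow> A \<and>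
      z [^]\<^bsub>R\<^esub> (n::nat) \<oplus>\<^bsub>R\<^esub> (\<Oplus>\<^bsub>R\<^esub>k \<in> {..<n}. c k \<otimes>\<^bsub>R\<^esub> z [^]\<^bsub>R\<^esub> k) = \<zero>\<^bsub>R\<^esub>)"

definition normal_hypersurface :: "nat \<Rightarrow> 'k::field mpoly \<Rightarrow> bool" where
  "normal_hypersurface N f \<longleftrightarrow> (\<forall>p \<in> hypersurface N f. \<forall>z \<in> carrier (function_field N f).
      integral_over (function_field N f) (local_ring_at N f p) z \<longrightarrow> z \<in> local_ring_at N f p)"

end

theory Submission
  imports Defs "HOL-Algebra.Algebraic_Closure_Type" "HOL-Computational_Algebra.Polynomial_Factorial" "Jordan_Normal_Form.Char_Poly"
begin

text \<open>
  A cubic singular along \<open>V(x\<^sub>\<tau>\<^sub>+\<^sub>1, \<dots>, x\<^sub>N)\<close> has no monomial of degree at least 2 in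
  \<open>x\<^sub>0, \<dots>, x\<^sub>\<tau>\<close>. Its Hessian matrix then has a zero block of size \<open>\<tau> + 1\<close>, whence (i); and the
  \<open>\<tau> + 1\<close> quadratic forms \<open>C\<^sup>i\<close> in \<open>N - \<tau>\<close> variables are linearly dependent in case (ii), which
  gives a direction in which \<open>f\<close> is constant. For non-normal \<open>X\<close> it remains to find a linear space
  of dimension \<open>N - 2\<close> in the singular locus.

  Choose \<open>e\<close> with \<open>f(e) = 1\<close>, so that \<open>f(x + S e)\<close> is a monic cubic in \<open>S\<close>. A function that is
  integral but not regular yields a quotient \<open>h / d\<close> integral over the coordinate ring, with \<open>d\<close>
  free of \<open>S\<close> and not dividing \<open>h\<close>. Restrict to the plane section \<open>f(x + T v + S e)\<close> through a generic point \<open>x\<close>, for a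
  suitable \<open>v\<close>: over a root \<open>T = \<beta>\<close> of the reduced denominator, the plane cubic has a singular point
  \<open>(\<alpha>, \<beta>)\<close>. It has no other one, since the line through two singular points would be a component,
  and then \<open>f\<close> would not be irreducible. Being unique, \<open>\<alpha>\<close> and \<open>\<beta>\<close> are rational functions of
  \<open>x\<close>; being integral and homogeneous of degree 1, they are linear forms. So the singular points
  \<open>x + \<beta>(x) v + \<alpha>(x) e\<close> form a linear space, of codimension 2.
\<close>

hide_const (open) Module.smult Polynomials.degree Polynomials.lead_coeff up_ring.coeff up_ring.monom UnivPoly.deg Divisibility.irreducible
no_notation fps_nth (infixl \<open>$\<close> 75)

section \<open>Evaluation and homogeneous parts\<close>

text \<open>The obstacle is a change of field. Roots of the denominator, and so the singular points
  of the plane section, exist at first only over the algebraic closure of the fraction field K(x),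
  whereas irreducibility of f is given over K. A line component over that closure is excluded by the
  choice of v: the slope m of a line S = \<kappa> + m T satisfies f(v + m e) = 0, so it is a
  constant; if the discriminant of f(v + S e) in S is nonzero, m is a simple root, the intercept
  \<kappa> solves a linear equation over K(x), and f(x + S e) would have the root \<kappa> there.
  The same discriminant, restricted to the line x + T v, has \<beta> among its roots and the nonzero
  constant disc(v) as leading coefficient; this is what makes \<beta> integral. Rationality of
  \<beta> is read off a coefficient: a polynomial c (T - \<beta>)^m has second coefficient -m c
  \<beta>, and the characteristic is 0. Finally, codimension 2 leaves two variables and hence three
  quadratic monomials, so the N - 1 quadratic forms are dependent as soon as N > 4 (indeed N - 1 >
  3).\<close>

lemma mpoly_sum_single: "p = (\<Sum>m\<in>Poly_Mapping.keys p. Poly_Mapping.single m (Poly_Mapping.lookup p m))"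
proof (rule poly_mapping_eqI)
  fix k
  show "Poly_Mapping.lookup p k = Poly_Mapping.lookup (\<Sum>m\<in>Poly_Mapping.keys p. Poly_Mapping.single m (Poly_Mapping.lookup p m)) k"
    by (auto simp: lookup_sum lookup_single when_def in_keys_iff)
qed

lemma mpoly_single_induct [case_names single add]:
  assumes "\<And>m c. P (Poly_Mapping.single m c)" "\<And>p q. P p \<Longrightarrow> P q \<Longrightarrow> P (p + q)"
  shows "P (p :: 'k::comm_ring_1 mpoly)"
proof -
  have "P (\<Sum>m\<in>A. Poly_Mapping.single m (Poly_Mapping.lookup p m))" if "finite A" for A
    using that
  proof (induction A rule: finite_induct)
    case empty
    show ?case using assms(1)[of 0 0] by simp
  next
    case (insert x F)
    then show ?case by (simp add: assms)
  qed
  then show ?thesis using mpoly_sum_single[of p] by (metis finite_keys)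
qed

definition mono_eval :: "(nat \<Rightarrow> 'b::comm_ring_1) \<Rightarrow> (nat \<Rightarrow>\<^sub>0 nat) \<Rightarrow> 'b" where
  "mono_eval \<sigma> m = (\<Prod>i\<in>Poly_Mapping.keys m. \<sigma> i ^ Poly_Mapping.lookup m i)"

text \<open>Coefficients and variables are sent separately, so that one notion covers values at
  points (\<open>peval\<close>), linear substitution (\<open>lin_subst\<close>) and the expansions
  \<open>hscale\<close>, \<open>uni\<close> and \<open>shift\<close>, whose values lie in a
  polynomial ring.\<close>

definition meval :: "('k::comm_ring_1 \<Rightarrow> 'b::comm_ring_1) \<Rightarrow> (nat \<Rightarrow> 'b) \<Rightarrow> 'k mpoly \<Rightarrow> 'b" where
  "meval \<phi> \<sigma> p = (\<Sum>m\<in>Poly_Mapping.keys p. \<phi> (Poly_Mapping.lookup p m) * mono_eval \<sigma> m)"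

lemma mono_eval_superset:
  assumes "finite A" "Poly_Mapping.keys m \<subseteq> A"
  shows "mono_eval \<sigma> m = (\<Prod>i\<in>A. \<sigma> i ^ Poly_Mapping.lookup m i)"
  unfolding mono_eval_def
  by (rule prod.mono_neutral_left) (use assms in \<open>auto simp: in_keys_iff\<close>)

lemma mono_eval_0 [simp]: "mono_eval \<sigma> 0 = 1"
  by (simp add: mono_eval_def)

lemma mono_eval_single [simp]: "mono_eval \<sigma> (Poly_Mapping.single i n) = \<sigma> i ^ n"
  by (simp add: mono_eval_def)

lemma mono_eval_add: "mono_eval \<sigma> (m + n) = mono_eval \<sigma> m * mono_eval \<sigma> n"
proof -
  let ?A = "Poly_Mapping.keys m \<union> Poly_Mapping.keys n"
  have "mono_eval \<sigma> (m + n) = (\<Prod>i\<in>?A. \<sigma> i ^ Poly_Mapping.lookup (m + n) i)"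
    by (rule mono_eval_superset) (use Poly_Mapping.keys_add[of m n] in auto)
  also have "\<dots> = (\<Prod>i\<in>?A. \<sigma> i ^ Poly_Mapping.lookup m i) * (\<Prod>i\<in>?A. \<sigma> i ^ Poly_Mapping.lookup n i)"
    by (simp add: lookup_add power_add prod.distrib)
  also have "\<dots> = mono_eval \<sigma> m * mono_eval \<sigma> n"
    by (simp add: mono_eval_superset[of ?A m] mono_eval_superset[of ?A n])
  finally show ?thesis .
qed

lemma meval_superset:
  assumes "finite A" "Poly_Mapping.keys p \<subseteq> A" "\<phi> 0 = 0"
  shows "meval \<phi> \<sigma> p = (\<Sum>m\<in>A. \<phi> (Poly_Mapping.lookup p m) * mono_eval \<sigma> m)"
  unfolding meval_def
  by (rule sum.mono_neutral_left) (use assms in \<open>auto simp: in_keys_iff\<close>)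

context
  fixes \<phi> :: "'k::comm_ring_1 \<Rightarrow> 'b::comm_ring_1"
  assumes \<phi>: "comm_ring_hom \<phi>"
begin

interpretation comm_ring_hom \<phi> by (fact \<phi>)

lemma meval_single [simp]: "meval \<phi> \<sigma> (Poly_Mapping.single m c) = \<phi> c * mono_eval \<sigma> m"
  by (cases "c = 0") (simp_all add: meval_def)

lemma meval_const [simp]: "meval \<phi> \<sigma> (const c) = \<phi> c"
  by (simp add: const_def)

lemma meval_xvar [simp]: "meval \<phi> \<sigma> (xvar i) = \<sigma> i"
  by (simp add: xvar_def)

lemma meval_add: "meval \<phi> \<sigma> (p + q) = meval \<phi> \<sigma> p + meval \<phi> \<sigma> q"
proof -
  let ?A = "Poly_Mapping.keys p \<union> Poly_Mapping.keys q"
  have "meval \<phi> \<sigma> (p + q) = (\<Sum>m\<in>?A. \<phi> (Poly_Mapping.lookup (p + q) m) * mono_eval \<sigma> m)"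
    by (rule meval_superset) (use Poly_Mapping.keys_add[of p q] in auto)
  also have "\<dots> = (\<Sum>m\<in>?A. \<phi> (Poly_Mapping.lookup p m) * mono_eval \<sigma> m)
      + (\<Sum>m\<in>?A. \<phi> (Poly_Mapping.lookup q m) * mono_eval \<sigma> m)"
    by (simp add: lookup_add hom_add distrib_right sum.distrib)
  also have "\<dots> = meval \<phi> \<sigma> p + meval \<phi> \<sigma> q"
    by (simp add: meval_superset[of ?A p] meval_superset[of ?A q])
  finally show ?thesis .
qed

lemma meval_mult: "meval \<phi> \<sigma> (p * q) = meval \<phi> \<sigma> p * meval \<phi> \<sigma> q"
proof (induction p rule: mpoly_single_induct)
  case (single m c)
  show ?case
  proof (induction q rule: mpoly_single_induct)
    case (single n d)
    then show ?case by (simp add: mult_single hom_mult mono_eval_add)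
  next
    case (add p q)
    then show ?case by (simp add: distrib_left meval_add)
  qed
next
  case (add p q)
  then show ?case by (simp add: distrib_right meval_add)
qed

lemma comm_ring_hom_meval: "comm_ring_hom (meval \<phi> \<sigma>)"
proof
  show "meval \<phi> \<sigma> 0 = 0" by (simp add: meval_def)
  have "meval \<phi> \<sigma> (const 1) = 1" by simp
  then show "meval \<phi> \<sigma> 1 = 1" by (simp add: const_def)
qed (simp_all add: meval_add meval_mult)

end

lemma comm_ring_hom_const: "comm_ring_hom (const :: 'k::comm_ring_1 \<Rightarrow> 'k mpoly)"
  by unfold_locales (simp_all add: const_def single_add mult_single)

lemma comm_ring_hom_id: "comm_ring_hom (\<lambda>x::'k::comm_ring_1. x)"
  by unfold_locales simp_all

lemma comm_ring_hom_comp: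
  assumes "comm_ring_hom f" "comm_ring_hom g"
  shows "comm_ring_hom (\<lambda>x. f (g x))"
proof -
  interpret f: comm_ring_hom f by fact
  interpret g: comm_ring_hom g by fact
  show ?thesis by unfold_locales (simp_all add: f.hom_add f.hom_mult g.hom_add g.hom_mult)
qed

lemma comm_ring_hom_pCons: "comm_ring_hom (\<lambda>c::'k::comm_ring_1. [:c:])"
  by unfold_locales (simp_all add: pCons_one)

lemma comm_ring_hom_map_poly:
  assumes "comm_ring_hom f"
  shows "comm_ring_hom (map_poly f)"
proof -
  interpret f: comm_ring_hom f by fact
  interpret map_poly_comm_ring_hom f ..
  show ?thesis ..
qed

lemma comm_ring_hom_poly: "comm_ring_hom (\<lambda>p. poly p (a::'k::comm_ring_1))"
  by unfold_locales simp_all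

interpretation const_hom: comm_ring_hom const by (fact comm_ring_hom_const)

lemma const_eq_0_iff [simp]: "const c = 0 \<longleftrightarrow> c = 0"
  by (metis const_def lookup_single_eq lookup_zero single_zero)

lemma hom_meval:
  assumes "comm_ring_hom h"
  shows "h (meval \<phi> \<sigma> p) = meval (\<lambda>c. h (\<phi> c)) (\<lambda>i. h (\<sigma> i)) p"
proof -
  interpret comm_ring_hom h by fact
  show ?thesis by (simp add: meval_def mono_eval_def hom_distribs)
qed

lemma xvar_power: "xvar i ^ n = Poly_Mapping.single (Poly_Mapping.single i n) (1::'k::comm_ring_1)"
proof (induction n)
  case (Suc n)
  have "xvar i ^ Suc n = xvar i * xvar i ^ n" by simp
  also have "\<dots> = Poly_Mapping.single (Poly_Mapping.single i (Suc n)) (1::'k)"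
    by (simp only: Suc) (simp add: xvar_def mult_single single_add[symmetric] del: single_add)
  finally show ?case .
qed simp

lemma mono_eval_xvar: "mono_eval xvar m = Poly_Mapping.single m (1::'k::comm_ring_1)"
proof (induction m rule: update_induct)
  case const
  then show ?case by simp
next
  case (update f a b)
  have eq: "Poly_Mapping.update a b f = f + Poly_Mapping.single a b"
    using update by (intro poly_mapping_eqI) (auto simp: lookup_update lookup_add lookup_single when_def in_keys_iff)
  show ?case unfolding eq mono_eval_add update(3) by (simp add: xvar_power mult_single)
qed

lemma meval_const_xvar [simp]: "meval const xvar p = p"
  by (subst (2) mpoly_sum_single) (simp add: meval_def mono_eval_xvar const_def mult_single)

lemma peval_eq_meval: "peval p v = meval (\<lambda>c. c) (\<lambda>i. v $ i) p"
  by (simp add: peval_def meval_def mono_eval_def)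

lemma lin_subst_eq_meval:
  "lin_subst A p = meval const (\<lambda>i. \<Sum>j<dim_col A. const (A $$ (i, j)) * xvar j) p"
  by (simp add: lin_subst_def meval_def mono_eval_def)

definition mdeg :: "(nat \<Rightarrow>\<^sub>0 nat) \<Rightarrow> nat" where
  "mdeg m = (\<Sum>i\<in>Poly_Mapping.keys m. Poly_Mapping.lookup m i)"

definition polys :: "nat set \<Rightarrow> 'k::comm_ring_1 mpoly set" where
  "polys V = {p. \<forall>m\<in>Poly_Mapping.keys p. Poly_Mapping.keys m \<subseteq> V}"

text \<open>Membership in \<open>polys V\<close> is a condition on exponents. Read as an induction
  over the subring generated by the constants and the variables in \<open>V\<close>, it serves for
  identities between ring homomorphisms and derivations.\<close>

lemma polys_induct [consumes 1, case_names const xvar add mult]: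
  assumes "p \<in> polys V"
    "\<And>c. P (const c)" "\<And>i. i \<in> V \<Longrightarrow> P (xvar i)"
    "\<And>p q. P p \<Longrightarrow> P q \<Longrightarrow> P (p + q)" "\<And>p q. P p \<Longrightarrow> P q \<Longrightarrow> P (p * q)"
  shows "P (p :: 'k::comm_ring_1 mpoly)"
proof -
  have one: "P 1" using assms(2)[of 1] by simp
  have zero: "P 0" using assms(2)[of 0] by simp
  have pw: "P (x ^ n)" if "P x" for x n
    using that one assms(5) by (induction n) auto
  have mono: "P (mono_eval xvar m)" if "Poly_Mapping.keys m \<subseteq> V" for m
  proof -
    have "P (\<Prod>i\<in>A. xvar i ^ Poly_Mapping.lookup m i)" if "finite A" "A \<subseteq> V" for A
      using that
    proof (induction A rule: finite_induct)
      case (insert i A)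
      then show ?case using assms(5)[of "xvar i ^ Poly_Mapping.lookup m i"] pw assms(3)[of i] by simp
    qed (simp add: one)
    then show ?thesis unfolding mono_eval_def using that by simp
  qed
  have "P (\<Sum>m\<in>Poly_Mapping.keys p. const (Poly_Mapping.lookup p m) * mono_eval xvar m)"
  proof -
    have "P (\<Sum>m\<in>A. const (Poly_Mapping.lookup p m) * mono_eval xvar m)" if "finite A" "A \<subseteq> Poly_Mapping.keys p" for A
      using that
    proof (induction A rule: finite_induct)
      case (insert m A)
      then have "P (mono_eval xvar m)" using assms(1) by (intro mono) (auto simp: polys_def)
      with insert show ?case by (simp add: assms)
    qed (simp add: zero)
    then show ?thesis by simp
  qed
  then show ?thesis using meval_const_xvar[of p] by (simp add: meval_def)
qed

lemma mdeg_superset: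
  assumes "finite A" "Poly_Mapping.keys m \<subseteq> A"
  shows "mdeg m = (\<Sum>i\<in>A. Poly_Mapping.lookup m i)"
  unfolding mdeg_def
  by (rule sum.mono_neutral_left) (use assms in \<open>auto simp: in_keys_iff\<close>)

lemma mdeg_0 [simp]: "mdeg 0 = 0"
  by (simp add: mdeg_def)

lemma mdeg_single [simp]: "mdeg (Poly_Mapping.single i n) = n"
  by (simp add: mdeg_def)

lemma keys_add_nat: "Poly_Mapping.keys (m + n :: nat \<Rightarrow>\<^sub>0 nat) = Poly_Mapping.keys m \<union> Poly_Mapping.keys n"
  by (auto simp: in_keys_iff lookup_add)

lemma mdeg_add: "mdeg (m + n) = mdeg m + mdeg n"
proof -
  let ?A = "Poly_Mapping.keys m \<union> Poly_Mapping.keys n"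
  have "mdeg (m + n) = (\<Sum>i\<in>?A. Poly_Mapping.lookup (m + n) i)"
    by (rule mdeg_superset) (auto simp: keys_add_nat)
  then show ?thesis
    by (simp add: mdeg_superset[of ?A m] mdeg_superset[of ?A n] lookup_add sum.distrib)
qed

lemma forms_iff: "p \<in> forms V d \<longleftrightarrow> p \<in> polys V \<and> (\<forall>m\<in>Poly_Mapping.keys p. mdeg m = d)"
  by (auto simp: forms_def polys_def mdeg_def)

lemma forms_subset_polys: "forms V d \<subseteq> polys V"
  by (auto simp: forms_iff)

lemma polys_UNIV [simp]: "polys UNIV = UNIV"
  by (auto simp: polys_def)

lemma polys_mono: "V \<subseteq> W \<Longrightarrow> polys V \<subseteq> polys W"
  unfolding polys_def by blast

lemma forms_mono: "V \<subseteq> W \<Longrightarrow> forms V d \<subseteq> forms W d"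
  using polys_mono[of V W] by (auto simp: forms_iff)

lemma polys_0 [simp]: "0 \<in> polys V" and forms_0 [simp]: "0 \<in> forms V d"
  by (simp_all add: polys_def forms_def)

lemma polys_const [simp]: "const c \<in> polys V"
  by (simp add: polys_def const_def)

lemma polys_xvar [simp]: "xvar i \<in> polys V \<longleftrightarrow> i \<in> V" for i :: nat
  by (simp add: polys_def xvar_def)

lemma polys_add: "p \<in> polys V \<Longrightarrow> q \<in> polys V \<Longrightarrow> p + q \<in> polys V"
  unfolding polys_def using Poly_Mapping.keys_add[of p q] by blast

lemma polys_mult:
  assumes "p \<in> polys V" "q \<in> polys V"
  shows "p * q \<in> polys V"
proof -
  { fix m assume "m \<in> Poly_Mapping.keys (p * q)"
    then obtain a b where "m = a + b" "a \<in> Poly_Mapping.keys p" "b \<in> Poly_Mapping.keys q"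
      using keys_mult[of p q] by blast
    then have "Poly_Mapping.keys m \<subseteq> V"
      using assms by (auto simp: polys_def keys_add_nat) }
  then show ?thesis by (auto simp: polys_def)
qed

lemma polys_sum: "(\<And>i. i \<in> I \<Longrightarrow> p i \<in> polys V) \<Longrightarrow> sum p I \<in> polys V"
  by (induction I rule: infinite_finite_induct) (auto intro: polys_add)

lemma forms_const [simp]: "const c \<in> forms V 0"
  by (simp add: forms_def const_def)

lemma forms_xvar: "i \<in> V \<Longrightarrow> xvar i \<in> forms V 1"
  by (simp add: forms_def xvar_def)

lemma forms_single: "Poly_Mapping.keys m \<subseteq> V \<Longrightarrow> Poly_Mapping.single m c \<in> forms V (mdeg m)"
  by (auto simp: forms_def mdeg_def)

lemma forms_1 [simp]: "1 \<in> forms V 0"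
  using forms_const[of 1] by simp

lemma forms_add: "p \<in> forms V d \<Longrightarrow> q \<in> forms V d \<Longrightarrow> p + q \<in> forms V d"
  unfolding forms_def using Poly_Mapping.keys_add[of p q] by blast

lemma forms_mult:
  assumes "p \<in> forms V d" "q \<in> forms V e"
  shows "p * q \<in> forms V (d + e)"
proof -
  { fix m assume "m \<in> Poly_Mapping.keys (p * q)"
    then obtain a b where "m = a + b" "a \<in> Poly_Mapping.keys p" "b \<in> Poly_Mapping.keys q"
      using keys_mult[of p q] by blast
    then have "Poly_Mapping.keys m \<subseteq> V \<and> mdeg m = d + e"
      using assms by (auto simp: forms_iff polys_def keys_add_nat mdeg_add) }
  then show ?thesis by (auto simp: forms_iff polys_def)
qed

lemma forms_const_mult: "p \<in> forms V d \<Longrightarrow> const c * p \<in> forms V d"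
  using forms_mult[of "const c" V 0 p d] by simp

lemma forms_uminus: "p \<in> forms V d \<Longrightarrow> - p \<in> forms V d"
  by (simp add: forms_def)

lemma forms_diff: "p \<in> forms V d \<Longrightarrow> q \<in> forms V d \<Longrightarrow> p - q \<in> forms V d"
  using forms_add[of p V d "- q"] forms_uminus[of q] by simp

lemma forms_sum: "(\<And>i. i \<in> I \<Longrightarrow> p i \<in> forms V d) \<Longrightarrow> sum p I \<in> forms V d"
  by (induction I rule: infinite_finite_induct) (auto intro: forms_add)

lemma forms_power: "p \<in> forms V d \<Longrightarrow> p ^ n \<in> forms V (n * d)"
  by (induction n) (auto dest: forms_mult)

lemma forms_prod: "(\<And>i. i \<in> I \<Longrightarrow> p i \<in> forms V (d i)) \<Longrightarrow> prod p I \<in> forms V (sum d I)"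
  by (induction I rule: infinite_finite_induct) (auto intro: forms_mult)

lemma meval_forms:
  assumes "p \<in> forms U d" "\<And>i. i \<in> U \<Longrightarrow> \<sigma> i \<in> forms V 1"
  shows "meval const \<sigma> p \<in> forms V d"
  unfolding meval_def
proof (rule forms_sum)
  fix m assume m: "m \<in> Poly_Mapping.keys p"
  have "mono_eval \<sigma> m \<in> forms V (\<Sum>i\<in>Poly_Mapping.keys m. Poly_Mapping.lookup m i)"
    unfolding mono_eval_def
  proof (rule forms_prod)
    fix i assume "i \<in> Poly_Mapping.keys m"
    then have "i \<in> U" using assms(1) m by (auto simp: forms_def)
    then have "\<sigma> i \<in> forms V 1" by (rule assms(2))
    then show "\<sigma> i ^ Poly_Mapping.lookup m i \<in> forms V (Poly_Mapping.lookup m i)"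
      using forms_power[of "\<sigma> i" V 1] by simp
  qed
  also have "(\<Sum>i\<in>Poly_Mapping.keys m. Poly_Mapping.lookup m i) = d"
    using assms(1) m by (simp add: forms_def)
  finally show "const (Poly_Mapping.lookup p m) * mono_eval \<sigma> m \<in> forms V d"
    by (rule forms_const_mult)
qed

lemma meval_cong:
  assumes "p \<in> polys V" "\<And>i. i \<in> V \<Longrightarrow> \<sigma> i = \<tau> i"
  shows "meval \<phi> \<sigma> p = meval \<phi> \<tau> p"
proof -
  have "\<sigma> i = \<tau> i" if "m \<in> Poly_Mapping.keys p" "i \<in> Poly_Mapping.keys m" for m i
    using that assms by (auto simp: polys_def)
  then show ?thesis by (simp add: meval_def mono_eval_def)
qed

text \<open>The substitution \<open>x\<^sub>i \<mapsto> x\<^sub>i t\<close>, whose coefficient at \<open>t\<^sup>d\<close> is the homogeneous part of degree \<open>d\<close>.\<close>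

definition hscale :: "'k::comm_ring_1 mpoly \<Rightarrow> 'k mpoly poly" where
  "hscale = meval (\<lambda>c. [:const c:]) (\<lambda>i. monom (xvar i) 1)"

lemma comm_ring_hom_const_poly: "comm_ring_hom (\<lambda>c::'k::comm_ring_1. [:const c:])"
  by (rule comm_ring_hom_comp[OF comm_ring_hom_pCons comm_ring_hom_const])

interpretation hscale: comm_ring_hom hscale
  unfolding hscale_def by (rule comm_ring_hom_meval[OF comm_ring_hom_const_poly])

lemma mono_eval_monom: "mono_eval (\<lambda>i. monom (s i) 1) m = monom (mono_eval s m) (mdeg m)"
proof -
  have "(\<Prod>i\<in>A. monom (f i) (g i)) = monom (\<Prod>i\<in>A. f i) (\<Sum>i\<in>A. g i)"
    if "finite A" for A and f :: "nat \<Rightarrow> 'a" and g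
    using that by (induction A rule: finite_induct) (auto simp: mult_monom)
  then show ?thesis by (simp add: mono_eval_def mdeg_def monom_power)
qed

lemma hscale_single: "hscale (Poly_Mapping.single m c) = monom (Poly_Mapping.single m c) (mdeg m)"
proof -
  have "mono_eval (\<lambda>i. monom (xvar i :: 'a mpoly) 1) m = monom (mono_eval xvar m) (mdeg m)"
    by (rule mono_eval_monom)
  then show ?thesis
    unfolding hscale_def meval_single[OF comm_ring_hom_const_poly]
    by (simp add: mono_eval_xvar smult_monom const_def mult_single)
qed

lemma hscale_forms:
  assumes "p \<in> forms V d"
  shows "hscale p = monom p d"
proof -
  have "hscale p = (\<Sum>m\<in>Poly_Mapping.keys p. hscale (Poly_Mapping.single m (Poly_Mapping.lookup p m)))"
    by (subst mpoly_sum_single[of p]) (simp add: hscale.hom_sum)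
  also have "\<dots> = (\<Sum>m\<in>Poly_Mapping.keys p. monom (Poly_Mapping.single m (Poly_Mapping.lookup p m)) d)"
    by (rule sum.cong) (use assms in \<open>auto simp: hscale_single forms_iff\<close>)
  also have "\<dots> = monom p d"
    by (subst (3) mpoly_sum_single[of p]) (simp add: monom_sum)
  finally show ?thesis .
qed

lemma coeff_hscale_forms:
  assumes "p \<in> polys V"
  shows "poly.coeff (hscale p) d \<in> forms V d"
proof -
  have "hscale p = (\<Sum>m\<in>Poly_Mapping.keys p. hscale (Poly_Mapping.single m (Poly_Mapping.lookup p m)))"
    by (subst mpoly_sum_single[of p]) (simp add: hscale.hom_sum)
  also have "\<dots> = (\<Sum>m\<in>Poly_Mapping.keys p. monom (Poly_Mapping.single m (Poly_Mapping.lookup p m)) (mdeg m))"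
    by (simp add: hscale_single)
  finally have *: "hscale p = (\<Sum>m\<in>Poly_Mapping.keys p. monom (Poly_Mapping.single m (Poly_Mapping.lookup p m)) (mdeg m))" .
  show ?thesis unfolding * coeff_sum
  proof (rule forms_sum)
    fix m assume "m \<in> Poly_Mapping.keys p"
    then show "poly.coeff (monom (Poly_Mapping.single m (Poly_Mapping.lookup p m)) (mdeg m)) d \<in> forms V d"
      using assms forms_single[of m V "Poly_Mapping.lookup p m"] by (auto simp: polys_def)
  qed
qed

lemma poly_hscale_1 [simp]: "poly (hscale p) 1 = p"
proof -
  have "poly (hscale p) 1 = meval (\<lambda>c. poly [:const c:] 1) (\<lambda>i. poly (monom (xvar i) 1) 1) p"
    unfolding hscale_def by (rule hom_meval[OF comm_ring_hom_poly])
  then show ?thesis by (simp add: poly_monom)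
qed

lemma hscale_eq_0_iff [simp]: "hscale p = 0 \<longleftrightarrow> p = 0"
  by (metis hscale.hom_zero poly_0 poly_hscale_1)

text \<open>\<open>hscale\<close> turns a unit into a unit of a polynomial ring over a domain, which
  has degree 0, and turns \<open>p\<close> into \<open>monom p d\<close>.\<close>

lemma forms_not_unit:
  assumes "p \<in> forms V d" "d > 0"
  shows "\<not> (p :: 'k::idom mpoly) dvd 1"
proof
  assume "p dvd 1"
  then have "hscale p dvd 1" using hscale.hom_dvd by fastforce
  moreover have "p \<noteq> 0" using \<open>p dvd 1\<close> by auto
  ultimately have "degree (monom p d) = 0"
    using hscale_forms[OF assms(1)] by (metis poly_dvd_1)
  then show False using \<open>p \<noteq> 0\<close> assms(2) by (simp add: degree_monom_eq)
qed

section \<open>Partial derivatives and translations\<close>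

lemma meval_ext:
  assumes "\<And>c. \<phi> c = \<phi>' c" "\<And>i. \<sigma> i = \<tau> i"
  shows "meval \<phi> \<sigma> p = meval \<phi>' \<tau> p"
  by (simp add: meval_def mono_eval_def assms)

lemma pdiff_single:
  "pdiff i (Poly_Mapping.single m c) =
    Poly_Mapping.single (m - Poly_Mapping.single i 1) (of_nat (Poly_Mapping.lookup m i) * c)"
  by (cases "c = 0") (simp_all add: pdiff_def)

lemma pdiff_superset:
  assumes "finite A" "Poly_Mapping.keys p \<subseteq> A"
  shows "pdiff i p = (\<Sum>m\<in>A. Poly_Mapping.single (m - Poly_Mapping.single i 1)
        (of_nat (Poly_Mapping.lookup m i) * Poly_Mapping.lookup p m))"
  unfolding pdiff_def
  by (rule sum.mono_neutral_left) (use assms in \<open>auto simp: in_keys_iff\<close>)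

lemma pdiff_add: "pdiff i (p + q) = pdiff i p + pdiff i q"
proof -
  let ?A = "Poly_Mapping.keys p \<union> Poly_Mapping.keys q"
  have "pdiff i (p + q) = (\<Sum>m\<in>?A. Poly_Mapping.single (m - Poly_Mapping.single i 1)
        (of_nat (Poly_Mapping.lookup m i) * Poly_Mapping.lookup (p + q) m))"
    by (rule pdiff_superset) (use Poly_Mapping.keys_add[of p q] in auto)
  also have "\<dots> = pdiff i p + pdiff i q"
    by (simp add: pdiff_superset[of ?A p] pdiff_superset[of ?A q] lookup_add distrib_left single_add sum.distrib)
  finally show ?thesis .
qed

lemma pdiff_mult: "pdiff i (p * q) = pdiff i p * q + p * pdiff i q"
proof (induction p rule: mpoly_single_induct)
  case (single m c)
  show ?case
  proof (induction q rule: mpoly_single_induct)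
    case (single n d)
    let ?e = "Poly_Mapping.single i (1::nat)"
    \<comment> \<open>Subtraction of exponents is truncated. Where the exponent of \<open>i\<close>
      is 0 this identity may fail, but there the coefficient of the derivative vanishes.\<close>
    have e: "a - ?e + b = a + b - ?e" if "Poly_Mapping.lookup a i \<noteq> 0" for a b :: "nat \<Rightarrow>\<^sub>0 nat"
      using that by (intro poly_mapping_eqI) (auto simp: lookup_add lookup_minus lookup_single when_def)
    have "Poly_Mapping.single (m - ?e + n) (of_nat (Poly_Mapping.lookup m i) * c * d) =
        Poly_Mapping.single (m + n - ?e) (of_nat (Poly_Mapping.lookup m i) * c * d)"
      using e[of m n] by (cases "Poly_Mapping.lookup m i = 0") auto
    moreover have "Poly_Mapping.single (n - ?e + m) (of_nat (Poly_Mapping.lookup n i) * c * d) =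
        Poly_Mapping.single (m + n - ?e) (of_nat (Poly_Mapping.lookup n i) * c * d)"
      using e[of n m] by (cases "Poly_Mapping.lookup n i = 0") (auto simp: add.commute)
    ultimately show ?case
      by (simp add: pdiff_single mult_single single_add[symmetric] lookup_add algebra_simps del: single_add)
  next
    case (add p q)
    then show ?case by (simp add: distrib_left distrib_right pdiff_add algebra_simps)
  qed
next
  case (add p q)
  then show ?case by (simp add: distrib_left distrib_right pdiff_add algebra_simps)
qed

lemma pdiff_const [simp]: "pdiff i (const c) = 0"
  by (simp add: const_def pdiff_single)

lemma pdiff_0 [simp]: "pdiff i 0 = 0"
  by (simp add: pdiff_def)

lemma pdiff_xvar: "pdiff i (xvar j) = (if i = j then 1 else 0)"
  by (simp add: xvar_def pdiff_single lookup_single when_def)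

lemma pdiff_sum: "pdiff i (sum f A) = (\<Sum>a\<in>A. pdiff i (f a))"
  by (induction A rule: infinite_finite_induct) (simp_all add: pdiff_add)

lemma pdiff_const_mult: "pdiff i (const c * p) = const c * pdiff i p"
  by (simp add: pdiff_mult)

text \<open>The chain rule; later it leads from two directional derivatives to all partial
  derivatives.\<close>

lemma pdiff_meval:
  assumes "finite V" "p \<in> polys V"
  shows "pdiff j (meval const \<sigma> p) = (\<Sum>i\<in>V. meval const \<sigma> (pdiff i p) * pdiff j (\<sigma> i))"
proof -
  interpret m: comm_ring_hom "meval const \<sigma>" by (rule comm_ring_hom_meval[OF comm_ring_hom_const])
  show ?thesis using assms(2)
  proof (induction p rule: polys_induct)
    case (const c)
    then show ?case by (simp add: meval_const[OF comm_ring_hom_const])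
  next
    case (xvar i)
    have "(\<Sum>k\<in>V. meval const \<sigma> (pdiff k (xvar i)) * pdiff j (\<sigma> k)) = (\<Sum>k\<in>V. if k = i then pdiff j (\<sigma> k) else 0)"
      by (rule sum.cong) (simp_all add: pdiff_xvar)
    then show ?case using xvar assms(1) by (simp add: meval_xvar[OF comm_ring_hom_const])
  next
    case (add p q)
    then show ?case by (simp add: pdiff_add m.hom_add distrib_right sum.distrib)
  next
    case (mult p q)
    have "pdiff j (meval const \<sigma> (p * q)) =
        (\<Sum>i\<in>V. meval const \<sigma> (pdiff i p) * pdiff j (\<sigma> i)) * meval const \<sigma> q
        + meval const \<sigma> p * (\<Sum>i\<in>V. meval const \<sigma> (pdiff i q) * pdiff j (\<sigma> i))"
      by (simp add: m.hom_mult pdiff_mult mult)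
    also have "\<dots> = (\<Sum>i\<in>V. meval const \<sigma> (pdiff i (p * q)) * pdiff j (\<sigma> i))"
      by (simp add: pdiff_mult m.hom_add m.hom_mult sum_distrib_left sum_distrib_right sum.distrib[symmetric] algebra_simps)
    finally show ?case .
  qed
qed

lemma forms_pdiff:
  assumes "p \<in> forms V (Suc d)"
  shows "pdiff i p \<in> forms V d"
  unfolding pdiff_def
proof (rule forms_sum)
  fix m assume m: "m \<in> Poly_Mapping.keys p"
  let ?e = "Poly_Mapping.single i (1::nat)"
  show "Poly_Mapping.single (m - ?e) (of_nat (Poly_Mapping.lookup m i) * Poly_Mapping.lookup p m) \<in> forms V d"
  proof (cases "Poly_Mapping.lookup m i = 0")
    case False
    have eq: "m = (m - ?e) + ?e"
      using False by (intro poly_mapping_eqI) (auto simp: lookup_add lookup_minus lookup_single when_def)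
    have "mdeg m = mdeg (m - ?e) + 1" by (subst eq) (simp only: mdeg_add mdeg_single)
    then have "mdeg (m - ?e) = d" using assms m by (simp add: forms_iff)
    moreover have "Poly_Mapping.keys (m - ?e) \<subseteq> V"
    proof -
      have "Poly_Mapping.keys (m - ?e) \<subseteq> Poly_Mapping.keys m"
        by (auto simp: in_keys_iff lookup_minus)
      then show ?thesis using assms m by (auto simp: forms_iff polys_def)
    qed
    ultimately show ?thesis using forms_single by blast
  qed simp
qed

section \<open>Points at which a polynomial does not vanish\<close>

definition uni :: "nat \<Rightarrow> 'k::comm_ring_1 mpoly \<Rightarrow> 'k mpoly poly" where
  "uni x = meval (\<lambda>c. [:const c:]) (\<lambda>i. if i = x then [:0, 1:] else [:xvar i:])"

interpretation uni: comm_ring_hom "uni x" for x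
  unfolding uni_def by (rule comm_ring_hom_meval[OF comm_ring_hom_const_poly])

lemma uni_const [simp]: "uni x (const c) = [:const c:]"
  by (simp add: uni_def meval_const[OF comm_ring_hom_const_poly])

lemma uni_xvar: "uni x (xvar i) = (if i = x then [:0, 1:] else [:xvar i:])"
  by (simp add: uni_def meval_xvar[OF comm_ring_hom_const_poly])

lemma poly_uni [simp]: "poly (uni x p) (xvar x) = p"
proof -
  have "poly (uni x p) (xvar x) = meval (\<lambda>c. poly [:const c:] (xvar x)) (\<lambda>i. poly (if i = x then [:0, 1:] else [:xvar i:]) (xvar x)) p"
    unfolding uni_def by (rule hom_meval[OF comm_ring_hom_poly])
  also have "\<dots> = meval const xvar p" by (rule meval_ext) auto
  finally show ?thesis by simp
qed

lemma coeff_uni_polys: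
  assumes "p \<in> polys (insert x V)"
  shows "poly.coeff (uni x p) k \<in> polys V"
  using assms
proof (induction p arbitrary: k rule: polys_induct)
  case (mult p q)
  then show ?case by (simp add: uni.hom_mult coeff_mult polys_sum polys_mult)
qed (auto simp: uni_xvar uni.hom_add polys_add coeff_pCons split: nat.splits intro: forms_subset_polys[THEN subsetD, OF forms_1])

text \<open>Induction on the set of variables: some coefficient with respect to powers of
  \<open>x\<close> is nonzero, and by induction stays so at a suitable point; the univariate
  polynomial obtained there has finitely many roots in an infinite field. All generic choices below
  rest on this.\<close>

lemma mpoly_nonroot_exists:
  fixes p :: "'k::field_char_0 mpoly"
  assumes "p \<noteq> 0"
  shows "\<exists>\<sigma>. meval (\<lambda>c. c) \<sigma> p \<noteq> 0"
proof -
  have "finite V \<Longrightarrow> p \<in> polys V \<Longrightarrow> p \<noteq> 0 \<Longrightarrow> \<exists>\<sigma>. meval (\<lambda>c. c) \<sigma> p \<noteq> 0" for V and p :: "'k mpoly"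
  proof (induction V arbitrary: p rule: finite_induct)
    case empty
    have "p = const (meval (\<lambda>c. c) \<sigma> p)" for \<sigma>
      using empty(1)
      by (induction p rule: polys_induct)
        (auto simp: meval_const[OF comm_ring_hom_id] meval_add[OF comm_ring_hom_id]
           meval_mult[OF comm_ring_hom_id] const_hom.hom_add const_hom.hom_mult)
    then show ?case using empty(2) by (metis const_eq_0_iff)
  next
    case (insert x V)
    have "uni x p \<noteq> 0" using insert(5) by (metis poly_0 poly_uni)
    then obtain k where "poly.coeff (uni x p) k \<noteq> 0" by (metis leading_coeff_0_iff)
    with insert.IH[OF coeff_uni_polys[OF insert(4)]] obtain \<sigma> where
      \<sigma>: "meval (\<lambda>c. c) \<sigma> (poly.coeff (uni x p) k) \<noteq> 0" by blast
    interpret m: comm_ring_hom "meval (\<lambda>c. c) \<sigma>" by (rule comm_ring_hom_meval[OF comm_ring_hom_id])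
    interpret mm: map_poly_comm_ring_hom "meval (\<lambda>c. c) \<sigma>" ..
    let ?q = "map_poly (meval (\<lambda>c. c) \<sigma>) (uni x p)"
    have "?q \<noteq> 0" using \<sigma> by (metis coeff_0 m.coeff_map_poly_hom)
    then have "finite {t. poly ?q t = 0}" by (rule poly_roots_finite)
    then obtain t where t: "poly ?q t \<noteq> 0" using infinite_UNIV_char_0[where 'a = 'k] ex_new_if_finite by force
    have hom: "comm_ring_hom (\<lambda>q. poly (map_poly (meval (\<lambda>c. c) \<sigma>) q) t)"
      by (rule comm_ring_hom_comp[OF comm_ring_hom_poly mm.comm_ring_hom_axioms])
    have "poly ?q t = meval (\<lambda>c. c) (\<sigma>(x := t)) p"
      unfolding uni_def
      by (subst hom_meval[OF hom], rule meval_ext)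
         (auto simp: meval_const[OF comm_ring_hom_id] meval_xvar[OF comm_ring_hom_id] hom_distribs)
    with t show ?case by auto
  qed
  moreover have "finite (\<Union>m\<in>Poly_Mapping.keys p. Poly_Mapping.keys m)" by simp
  moreover have "p \<in> polys (\<Union>m\<in>Poly_Mapping.keys p. Poly_Mapping.keys m)" by (auto simp: polys_def)
  ultimately show ?thesis using assms by blast
qed

section \<open>Restriction to the line x + T v through a generic point x, expanded in powers of
  T\<close>

definition shift :: "(nat \<Rightarrow> 'k) \<Rightarrow> 'k::comm_ring_1 mpoly \<Rightarrow> 'k mpoly poly" where
  "shift v = meval (\<lambda>c. [:const c:]) (\<lambda>i. [:xvar i, const (v i):])"

interpretation shift: comm_ring_hom "shift v" for v
  unfolding shift_def by (rule comm_ring_hom_meval[OF comm_ring_hom_const_poly])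

lemma comm_ring_hom_shift: "comm_ring_hom (shift v)" ..

lemma shift_const [simp]: "shift v (const c) = [:const c:]"
  by (simp add: shift_def meval_const[OF comm_ring_hom_const_poly])

lemma shift_xvar: "shift v (xvar i) = [:xvar i, const (v i):]"
  by (simp add: shift_def meval_xvar[OF comm_ring_hom_const_poly])

lemma poly_shift: "poly (shift v p) r = meval const (\<lambda>i. xvar i + r * const (v i)) p"
  unfolding shift_def by (subst hom_meval[OF comm_ring_hom_poly], rule meval_ext) auto

lemma poly_shift_0 [simp]: "poly (shift v p) 0 = p"
  by (simp add: poly_shift)

text \<open>Polynomials in an extra variable \<open>t\<close> that are homogeneous of degree \<open>d\<close> in \<open>t\<close> and
  the \<open>x\<^sub>i\<close> jointly.\<close>

definition hpoly :: "nat set \<Rightarrow> nat \<Rightarrow> 'k::comm_ring_1 mpoly poly set" where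
  "hpoly V d = {q. \<forall>j. if j \<le> d then poly.coeff q j \<in> forms V (d - j) else poly.coeff q j = 0}"

lemma hpoly_coeff: "q \<in> hpoly V d \<Longrightarrow> j \<le> d \<Longrightarrow> poly.coeff q j \<in> forms V (d - j)"
  unfolding hpoly_def by (auto split: if_splits)

lemma hpoly_degree: "q \<in> hpoly V d \<Longrightarrow> degree q \<le> d"
  unfolding hpoly_def by (rule degree_le) (metis (mono_tags, lifting) leD mem_Collect_eq)

lemma hpoly_0 [simp]: "0 \<in> hpoly V d"
  by (simp add: hpoly_def)

lemma hpoly_add: "p \<in> hpoly V d \<Longrightarrow> q \<in> hpoly V d \<Longrightarrow> p + q \<in> hpoly V d"
  unfolding hpoly_def by (auto simp: forms_add)

lemma hpoly_sum: "(\<And>i. i \<in> I \<Longrightarrow> p i \<in> hpoly V d) \<Longrightarrow> sum p I \<in> hpoly V d"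
  by (induction I rule: infinite_finite_induct) (auto intro: hpoly_add)

lemma hpoly_mult:
  assumes "p \<in> hpoly V d" "q \<in> hpoly V e"
  shows "p * q \<in> hpoly V (d + e)"
proof -
  have *: "poly.coeff p i * poly.coeff q (n - i) \<in> forms V (d + e - n)"
    if "i \<le> n" "n \<le> d + e" for i n
  proof (cases "i \<le> d \<and> n - i \<le> e")
    case True
    then have "poly.coeff p i * poly.coeff q (n - i) \<in> forms V ((d - i) + (e - (n - i)))"
      using assms by (intro forms_mult hpoly_coeff) auto
    also have "(d - i) + (e - (n - i)) = d + e - n" using True that by arith
    finally show ?thesis .
  next
    case False
    then have "poly.coeff p i = 0 \<or> poly.coeff q (n - i) = 0"
      using assms[THEN hpoly_degree] by (metis coeff_eq_0 le_trans not_le)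
    then show ?thesis by auto
  qed
  have "degree (p * q) \<le> d + e"
    using assms[THEN hpoly_degree] degree_mult_le[of p q] by linarith
  then have "poly.coeff (p * q) n = 0" if "n > d + e" for n
    using that by (simp add: coeff_eq_0)
  moreover have "poly.coeff (p * q) n \<in> forms V (d + e - n)" if "n \<le> d + e" for n
    unfolding coeff_mult by (rule forms_sum) (use * that in auto)
  ultimately show ?thesis by (auto simp: hpoly_def)
qed

lemma hpoly_pCons_0: "p \<in> forms V d \<Longrightarrow> [:p:] \<in> hpoly V d"
  by (auto simp: hpoly_def coeff_pCons split: nat.splits)

lemma hpoly_1 [simp]: "1 \<in> hpoly V 0"
  using hpoly_pCons_0[OF forms_1, of V] by (simp add: pCons_one)

lemma hpoly_const_mult: "p \<in> hpoly V d \<Longrightarrow> smult (const c) p \<in> hpoly V d"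
  by (auto simp: hpoly_def forms_const_mult)

lemma hpoly_power: "p \<in> hpoly V d \<Longrightarrow> p ^ n \<in> hpoly V (n * d)"
  by (induction n) (auto dest: hpoly_mult)

lemma hpoly_prod: "(\<And>i. i \<in> I \<Longrightarrow> p i \<in> hpoly V (d i)) \<Longrightarrow> prod p I \<in> hpoly V (sum d I)"
  by (induction I rule: infinite_finite_induct) (auto intro: hpoly_mult)

lemma hpoly_shift:
  assumes "p \<in> forms V d"
  shows "shift v p \<in> hpoly V d"
  unfolding shift_def meval_def
proof (rule hpoly_sum)
  fix m assume m: "m \<in> Poly_Mapping.keys p"
  have "mono_eval (\<lambda>i. [:xvar i, const (v i):]) m \<in> hpoly V (\<Sum>i\<in>Poly_Mapping.keys m. Poly_Mapping.lookup m i)"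
    unfolding mono_eval_def
  proof (rule hpoly_prod)
    fix i assume "i \<in> Poly_Mapping.keys m"
    then have "i \<in> V" using assms m by (auto simp: forms_def)
    then have "[:xvar i, const (v i):] \<in> hpoly V 1"
      by (auto simp: hpoly_def coeff_pCons forms_xvar[simplified] split: nat.splits)
    then show "[:xvar i, const (v i):] ^ Poly_Mapping.lookup m i \<in> hpoly V (Poly_Mapping.lookup m i)"
      using hpoly_power[of _ V 1] by simp
  qed
  also have "(\<Sum>i\<in>Poly_Mapping.keys m. Poly_Mapping.lookup m i) = d"
    using assms m by (simp add: forms_def)
  finally show "[:const (Poly_Mapping.lookup p m):] * mono_eval (\<lambda>i. [:xvar i, const (v i):]) m \<in> hpoly V d"
    using hpoly_const_mult by simp
qed

lemma poly_hpoly: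
  assumes "P \<in> hpoly V d" "r \<in> forms V 1"
  shows "poly P r \<in> forms V d"
  unfolding poly_altdef
proof (rule forms_sum)
  fix j assume "j \<in> {..degree P}"
  then have j: "j \<le> d" using hpoly_degree[OF assms(1)] by auto
  have "poly.coeff P j * r ^ j \<in> forms V ((d - j) + j * 1)"
    by (intro forms_mult hpoly_coeff assms forms_power j)
  with j show "poly.coeff P j * r ^ j \<in> forms V d" by simp
qed

lemma forms_degree_0:
  assumes "p \<in> forms V 0"
  shows "p = const (meval (\<lambda>c. c) \<sigma> p)"
proof -
  have "Poly_Mapping.keys p \<subseteq> {0}"
    using assms by (auto simp: forms_def in_keys_iff intro!: poly_mapping_eqI)
  then have "p = const (Poly_Mapping.lookup p 0)"
    by (intro poly_mapping_eqI) (auto simp: const_def lookup_single when_def in_keys_iff subset_iff)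
  then show ?thesis by (metis meval_const[OF comm_ring_hom_id])
qed

lemma meval_monom_forms:
  assumes "p \<in> forms V d"
  shows "meval (\<lambda>c. [:c:]) (\<lambda>i. monom (v i) 1) p = monom (meval (\<lambda>c. c) v p) d"
proof -
  have "meval (\<lambda>c. [:c:]) (\<lambda>i. monom (v i) 1) p =
      (\<Sum>m\<in>Poly_Mapping.keys p. monom (Poly_Mapping.lookup p m * mono_eval v m) d)"
    unfolding meval_def
  proof (rule sum.cong)
    fix m assume "m \<in> Poly_Mapping.keys p"
    then have "mdeg m = d" using assms by (simp add: forms_iff)
    then show "[:Poly_Mapping.lookup p m:] * mono_eval (\<lambda>i. monom (v i) 1) m = monom (Poly_Mapping.lookup p m * mono_eval v m) d"
      unfolding mono_eval_monom by (simp add: smult_monom)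
  qed simp
  then show ?thesis by (simp add: meval_def monom_sum)
qed

text \<open>Putting x = 0 leaves p(T v) = p(v) T^d. The coefficient of T^d is a form of degree 0, so
  putting x = 0 does not change it.\<close>

lemma coeff_shift_top:
  assumes "p \<in> forms V d"
  shows "poly.coeff (shift v p) d = const (meval (\<lambda>c. c) v p)"
proof -
  let ?\<epsilon> = "meval (\<lambda>c::'a. c) (\<lambda>_. 0)"
  interpret e: comm_ring_hom ?\<epsilon> by (rule comm_ring_hom_meval[OF comm_ring_hom_id])
  interpret ee: map_poly_comm_ring_hom ?\<epsilon> ..
  have "map_poly ?\<epsilon> (shift v p) = meval (\<lambda>c. [:c:]) (\<lambda>i. monom (v i) 1) p"
    unfolding shift_def
    by (subst hom_meval[OF ee.comm_ring_hom_axioms], rule meval_ext)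
      (auto simp: hom_distribs meval_const[OF comm_ring_hom_id] meval_xvar[OF comm_ring_hom_id] monom_Suc monom_0)
  also have "\<dots> = monom (meval (\<lambda>c. c) v p) d" by (rule meval_monom_forms[OF assms])
  finally have "?\<epsilon> (poly.coeff (shift v p) d) = meval (\<lambda>c. c) v p"
    by (metis coeff_monom e.coeff_map_poly_hom)
  moreover have "poly.coeff (shift v p) d \<in> forms V 0"
    using hpoly_coeff[OF hpoly_shift[OF assms], of d] by simp
  ultimately show ?thesis by (metis forms_degree_0)
qed

text \<open>As in Noether normalisation, only the top homogeneous part of \<open>d\<close> reaches
  the highest power of T, through its value at \<open>v\<close>. If that value is nonzero, the
  leading coefficient is a unit and one can divide by \<open>shift v d\<close>.\<close>

lemma shift_lead_coeff:
  fixes d :: "'k::field_char_0 mpoly"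
  assumes "meval (\<lambda>c. c) v (lead_coeff (hscale d)) \<noteq> 0"
  shows "lead_coeff (shift v d) = const (meval (\<lambda>c. c) v (lead_coeff (hscale d)))"
proof -
  let ?D = "degree (hscale d)"
  let ?c = "\<lambda>j. poly.coeff (hscale d) j"
  have c: "?c j \<in> forms UNIV j" for j by (rule coeff_hscale_forms) simp
  have "d = (\<Sum>j\<le>?D. ?c j)"
    using poly_hscale_1[of d] unfolding poly_altdef by simp
  then have eq: "shift v d = (\<Sum>j\<le>?D. shift v (?c j))" by (metis shift.hom_sum)
  have dj: "degree (shift v (?c j)) \<le> j" for j
    by (rule hpoly_degree[OF hpoly_shift[OF c]])
  have "poly.coeff (shift v d) ?D = (\<Sum>j\<le>?D. if j = ?D then poly.coeff (shift v (?c j)) ?D else 0)"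
    unfolding eq coeff_sum
  proof (rule sum.cong)
    fix j assume "j \<in> {..?D}"
    then show "poly.coeff (shift v (?c j)) ?D = (if j = ?D then poly.coeff (shift v (?c j)) ?D else 0)"
      using coeff_eq_0[OF le_less_trans[OF dj, of j ?D]] by auto
  qed simp
  also have "\<dots> = poly.coeff (shift v (?c ?D)) ?D" by simp
  also have "\<dots> = const (meval (\<lambda>c. c) v (?c ?D))" by (rule coeff_shift_top[OF c])
  finally have top: "poly.coeff (shift v d) ?D = const (meval (\<lambda>c. c) v (?c ?D))" .
  have "degree (shift v d) \<le> ?D"
    unfolding eq by (rule degree_sum_le) (use order_trans[OF dj] in auto)
  moreover have "poly.coeff (shift v d) ?D \<noteq> 0" using top assms by simp
  ultimately have "degree (shift v d) = ?D" by (metis coeff_eq_0 le_neq_implies_less)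
  with top show ?thesis by simp
qed

text \<open>Pseudo-division multiplies \<open>a\<close> only by a power of a unit. The remainder is
  divisible by \<open>b\<close> over the field and of smaller degree, hence 0.\<close>

lemma monic_dvd_descend:
  fixes a b :: "'a::idom poly" and f :: "'a \<Rightarrow> 'b::field"
  assumes "inj_idom_hom f" and u: "lead_coeff b dvd 1" and dvd: "map_poly f b dvd map_poly f a"
  shows "b dvd a"
proof -
  interpret f: inj_idom_hom f by fact
  interpret ff: map_poly_inj_idom_hom f ..
  obtain q r where qr: "pseudo_divmod a b = (q, r)" by fastforce
  have b0: "b \<noteq> 0" using u by auto
  let ?c = "lead_coeff b ^ (Suc (degree a) - degree b)"
  have eq: "smult ?c a = b * q + r" and r: "r = 0 \<or> degree r < degree b"
    using pseudo_divmod[OF b0 qr] by auto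
  have "map_poly f r = map_poly f (smult ?c a) - map_poly f b * map_poly f q"
    by (simp add: eq ff.hom_add ff.hom_mult)
  then have "map_poly f b dvd map_poly f r"
    using dvd by (simp add: f.map_poly_hom_smult dvd_smult)
  then have "r = 0"
    using r b0 dvd_imp_degree_le[of "map_poly f b" "map_poly f r"] by force
  then have "b dvd smult ?c a" using eq by simp
  moreover have "?c dvd 1 ^ (Suc (degree a) - degree b)" by (rule dvd_power_same[OF u])
  then obtain c' where "?c * c' = 1" by (metis dvdE power_one)
  ultimately show ?thesis
    by (metis dvd_smult mult.commute smult_1_left smult_smult)
qed

text \<open>The rational root argument: the relation is an integral equation for a / b with
  denominators cleared. After cancelling the gcd, b' divides a'^n and is coprime to it, so b' is a
  unit.\<close>

lemma integral_dvd:
  fixes a b :: "'a::{idom, ring_gcd}"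
  assumes rel: "a ^ n + (\<Sum>k<n. g k * a ^ k * b ^ (n - k)) = 0" and "b \<noteq> 0"
  shows "b dvd a"
proof -
  have n: "n > 0" using rel by (cases n) auto
  obtain a' b' where ab: "a = a' * gcd a b" "b = b' * gcd a b" "coprime a' b'"
    using gcd_coprime_exists[of a b] assms(2) by (metis gcd_eq_0_iff mult.commute)
  let ?d = "gcd a b"
  have d0: "?d \<noteq> 0" using assms(2) by simp
  have "a ^ n + (\<Sum>k<n. g k * a ^ k * b ^ (n - k)) = ?d ^ n * (a' ^ n + (\<Sum>k<n. g k * a' ^ k * b' ^ (n - k)))"
  proof -
    have "g k * a ^ k * b ^ (n - k) = ?d ^ n * (g k * a' ^ k * b' ^ (n - k))" if "k < n" for k
    proof -
      have "g k * a ^ k * b ^ (n - k) = g k * (a' * ?d) ^ k * (b' * ?d) ^ (n - k)"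
        using ab(1,2) by simp
      also have "\<dots> = (?d ^ k * ?d ^ (n - k)) * (g k * a' ^ k * b' ^ (n - k))"
        by (simp only: power_mult_distrib mult_ac)
      also have "?d ^ k * ?d ^ (n - k) = ?d ^ n" using that by (simp flip: power_add)
      finally show ?thesis .
    qed
    then have "(\<Sum>k<n. g k * a ^ k * b ^ (n - k)) = (\<Sum>k<n. ?d ^ n * (g k * a' ^ k * b' ^ (n - k)))"
      by (intro sum.cong) auto
    moreover have "a ^ n = ?d ^ n * a' ^ n"
      using ab(1) by (metis mult.commute power_mult_distrib)
    ultimately show ?thesis by (simp only: distrib_left sum_distrib_left)
  qed
  then have "a' ^ n + (\<Sum>k<n. g k * a' ^ k * b' ^ (n - k)) = 0" using rel d0 by (metis mult_eq_0_iff power_not_zero)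
  then have "a' ^ n = - (\<Sum>k<n. g k * a' ^ k * b' ^ (n - k))" by (rule eq_neg_iff_add_eq_0[THEN iffD2])
  moreover have "b' dvd (\<Sum>k<n. g k * a' ^ k * b' ^ (n - k))"
    by (rule dvd_sum) (auto intro!: dvd_mult dvd_power)
  ultimately have "b' dvd a' ^ n" by simp
  moreover have "coprime b' (a' ^ n)" using ab(3) by (simp add: coprime_commute)
  ultimately have "b' dvd 1" by (metis coprime_def dvd_refl)
  then show ?thesis
    by (metis ab(1,2) dvd_triv_right mult_dvd_mono one_dvd dvd_trans mult_1)
qed

instance fract :: ("{idom,ring_char_0}") field_char_0
proof
  show "inj (of_nat :: nat \<Rightarrow> 'a fract)"
    by (auto simp: inj_on_def Fract_of_nat_eq[symmetric] eq_fract)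
qed

text \<open>The variables are the coordinates of a generic point x; the roots in T and S that occur
  in plane sections through it live in this algebraically closed field.\<close>

abbreviation to_clos :: "'k::field_char_0 mpoly \<Rightarrow> 'k mpoly fract alg_closure" where
  "to_clos p \<equiv> to_ac (to_fract p)"

lemma inj_idom_hom_to_clos: "inj_idom_hom to_clos"
  by unfold_locales simp_all

text \<open>On a line x + T v the question concerns univariate polynomials over a field, where
  \<open>integral_dvd\<close> applies. A direction in which \<open>b\<close> gets a unit as leading
  coefficient brings divisibility back to polynomial coefficients, and T = 0 returns
  \<open>a\<close> and \<open>b\<close>.\<close>

lemma mpoly_integrally_closed:
  fixes a b :: "'k::field_char_0 mpoly"
  assumes rel: "a ^ n + (\<Sum>k<n. g k * a ^ k * b ^ (n - k)) = 0" and b: "b \<noteq> 0"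
  shows "b dvd a"
proof -
  obtain v where v: "meval (\<lambda>c. c) v (lead_coeff (hscale b)) \<noteq> 0"
    using mpoly_nonroot_exists[of "lead_coeff (hscale b)"] b by auto
  interpret J: inj_idom_hom "to_clos :: 'k mpoly \<Rightarrow> _" by (fact inj_idom_hom_to_clos)
  interpret JJ: map_poly_inj_idom_hom "to_clos :: 'k mpoly \<Rightarrow> _" ..
  let ?h = "\<lambda>p. map_poly to_clos (shift v p)"
  interpret h: comm_ring_hom ?h
    by (rule comm_ring_hom_comp[OF JJ.comm_ring_hom_axioms comm_ring_hom_shift])
  have lc: "lead_coeff (shift v b) = const (meval (\<lambda>c. c) v (lead_coeff (hscale b)))"
    by (rule shift_lead_coeff[OF v])
  have "?h (a ^ n + (\<Sum>k<n. g k * a ^ k * b ^ (n - k))) = 0" by (simp add: rel)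
  then have "?h a ^ n + (\<Sum>k<n. ?h (g k) * ?h a ^ k * ?h b ^ (n - k)) = 0"
    by (simp add: h.hom_add h.hom_mult h.hom_sum h.hom_power)
  moreover have "shift v b \<noteq> 0" using b by (metis poly_0 poly_shift_0)
  then have "?h b \<noteq> 0" by simp
  ultimately have "?h b dvd ?h a" by (rule integral_dvd)
  moreover have "const (meval (\<lambda>c. c) v (lead_coeff (hscale b))) dvd 1"
    using v by (intro dvdI[of _ _ "const (inverse (meval (\<lambda>c. c) v (lead_coeff (hscale b))))"])
      (simp flip: const_hom.hom_mult)
  ultimately have "shift v b dvd shift v a"
    using monic_dvd_descend[OF inj_idom_hom_to_clos] lc by metis
  then obtain q where "shift v a = shift v b * q" ..
  then have "poly (shift v a) 0 = poly (shift v b) 0 * poly q 0" by simp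
  then show ?thesis by simp
qed

text \<open>The root is integral, hence a polynomial \<open>r'\<close>, and the grading forces
  degree 1. With the variables scaled by t and e the degree of \<open>r'\<close>, the term of index
  j has t-degree at most (n - j) + j e; for e > 1 this is below n e when j < n, so the top term
  could not cancel. Setting t = 0 shows that the constant term vanishes.\<close>

lemma hpoly_root_linear_form:
  fixes P :: "'k::field_char_0 mpoly poly"
  assumes P: "P \<in> hpoly V n" and top: "poly.coeff P n = const c" "c \<noteq> 0"
    and root: "poly (map_poly to_fract P) r = 0"
  obtains r' where "r' \<in> forms UNIV 1" "r = to_fract r'"
proof -
  interpret F: inj_idom_hom "to_fract :: 'k mpoly \<Rightarrow> _" by unfold_locales simp_all
  have deg: "degree P = n"
    using hpoly_degree[OF P] top by (metis const_eq_0_iff le_degree order_antisym)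
  have n: "n > 0"
  proof (rule ccontr)
    assume "\<not> n > 0"
    then have "P = [:const c:]" using deg top by (metis degree_0_id gr0I)
    then show False using root top(2) by (simp add: hom_distribs)
  qed
  obtain a b where ab: "r = to_fract a / to_fract b" "b \<noteq> 0"
    by (cases r) (simp add: Fract_conv_to_fract)
  have "0 = to_fract (const (inverse c)) * (to_fract b ^ n * (\<Sum>j\<le>n. to_fract (poly.coeff P j) * r ^ j))"
    using root deg by (simp add: poly_altdef)
  also have "\<dots> = to_fract (const (inverse c)) * (\<Sum>j\<le>n. to_fract (poly.coeff P j * a ^ j * b ^ (n - j)))"
  proof -
    have "to_fract b ^ n * (to_fract (poly.coeff P j) * r ^ j) = to_fract (poly.coeff P j * a ^ j * b ^ (n - j))"
      if "j \<le> n" for j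
    proof -
      have "to_fract b ^ n = to_fract b ^ j * to_fract b ^ (n - j)" using that by (simp flip: power_add)
      then show ?thesis using ab by (simp add: power_divide F.hom_power)
    qed
    then have "(\<Sum>j\<le>n. to_fract b ^ n * (to_fract (poly.coeff P j) * r ^ j)) = (\<Sum>j\<le>n. to_fract (poly.coeff P j * a ^ j * b ^ (n - j)))"
      by (intro sum.cong) auto
    then show ?thesis by (simp only: sum_distrib_left)
  qed
  also have "\<dots> = to_fract (\<Sum>j\<le>n. const (inverse c) * poly.coeff P j * a ^ j * b ^ (n - j))"
    by (simp add: sum_distrib_left mult.assoc)
  also have "(\<Sum>j\<le>n. const (inverse c) * poly.coeff P j * a ^ j * b ^ (n - j))
      = a ^ n + (\<Sum>j<n. (const (inverse c) * poly.coeff P j) * a ^ j * b ^ (n - j))"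
    using top by (simp add: lessThan_Suc_atMost[symmetric] flip: const_hom.hom_mult)
  finally have "a ^ n + (\<Sum>j<n. (const (inverse c) * poly.coeff P j) * a ^ j * b ^ (n - j)) = 0"
    by (simp del: to_fract_add to_fract_mult to_fract_sum)
  then have "b dvd a" by (rule mpoly_integrally_closed) fact
  then obtain r' where r': "a = b * r'" ..
  then have rr: "r = to_fract r'" using ab by simp
  then have "to_fract (poly P r') = 0" using root by simp
  then have root': "poly P r' = 0" by simp
  let ?B = "hscale r'"
  let ?e = "degree ?B"
  have "0 = hscale (poly P r')" by (simp add: root')
  also have "\<dots> = (\<Sum>j\<le>n. monom (poly.coeff P j) (n - j) * ?B ^ j)"
    unfolding poly_altdef deg hscale.hom_sum hscale.hom_mult hscale.hom_power
    by (intro sum.cong refl) (simp add: hscale_forms[OF hpoly_coeff[OF P]])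
  also have "\<dots> = (\<Sum>j<n. monom (poly.coeff P j) (n - j) * ?B ^ j) + smult (const c) (?B ^ n)"
    using top by (simp add: lessThan_Suc_atMost[symmetric] monom_0)
  finally have rel: "(\<Sum>j<n. monom (poly.coeff P j) (n - j) * ?B ^ j) + smult (const c) (?B ^ n) = 0" by simp
  have "?e \<le> 1"
  proof (rule ccontr)
    assume e: "\<not> ?e \<le> 1"
    have "degree (monom (poly.coeff P j) (n - j) * ?B ^ j) < n * ?e" if "j < n" for j
    proof -
      have "degree (monom (poly.coeff P j) (n - j) * ?B ^ j) \<le> (n - j) + j * ?e"
        by (rule order_trans[OF degree_mult_le]) (use degree_monom_le[of "poly.coeff P j" "n - j"] degree_power_le[of ?B j] in \<open>simp add: mult.commute add_mono\<close>)
      also have "\<dots> < (n - j) * ?e + j * ?e"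
      proof (rule add_strict_right_mono)
        show "n - j < (n - j) * ?e" using mult_strict_left_mono[of 1 ?e "n - j"] that e by simp
      qed
      also have "\<dots> = n * ?e" using that by (simp flip: distrib_right)
      finally show ?thesis .
    qed
    then have "poly.coeff (\<Sum>j<n. monom (poly.coeff P j) (n - j) * ?B ^ j) (n * ?e) = 0"
      unfolding coeff_sum by (intro sum.neutral) (auto intro: coeff_eq_0)
    moreover have "poly.coeff (smult (const c) (?B ^ n)) (n * ?e) = const c * lead_coeff ?B ^ n"
      using lead_coeff_power[of ?B n] degree_power_eq[of ?B n] e by (cases "?B = 0") (auto simp: mult.commute[of n])
    ultimately have "const c * lead_coeff ?B ^ n = 0"
      using arg_cong[OF rel, of "\<lambda>p. poly.coeff p (n * ?e)"] by (simp only: coeff_add coeff_0 add_0)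
    then have "lead_coeff ?B ^ n = 0" using top(2) by (simp only: mult_eq_0_iff const_eq_0_iff simp_thms)
    then have "?B = 0" using power_not_zero[of "lead_coeff ?B" n] by auto
    with e show False by simp
  qed
  have "poly.coeff ?B 0 = 0"
  proof -
    have "poly ((\<Sum>j<n. monom (poly.coeff P j) (n - j) * ?B ^ j) + smult (const c) (?B ^ n)) 0 = const c * poly ?B 0 ^ n"
      by (auto simp: poly_sum poly_monom zero_power intro!: sum.neutral)
    then show ?thesis using rel top(2) by (simp add: poly_0_coeff_0)
  qed
  have "?B = monom (poly.coeff ?B 1) 1"
  proof (intro poly_eqI)
    fix i
    show "poly.coeff ?B i = poly.coeff (monom (poly.coeff ?B 1) 1) i"
    proof (cases "i \<le> 1")
      case True
      then show ?thesis using \<open>poly.coeff ?B 0 = 0\<close> by (cases i) auto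
    next
      case False
      then show ?thesis using \<open>?e \<le> 1\<close> by (simp add: coeff_eq_0)
    qed
  qed
  then have "r' = poly.coeff ?B 1" by (metis mult_1_right poly_hscale_1 poly_monom power_one)
  then have "r' \<in> forms UNIV 1" using coeff_hscale_forms[of r' UNIV 1] by simp
  with rr show ?thesis using that by blast
qed

section \<open>Singular points of plane cubics\<close>

lemma root_factor:
  fixes p :: "'a::comm_ring_1 poly"
  assumes "poly p a = 0"
  obtains q where "p = [:-a, 1:] * q"
  using assms by (auto simp: poly_eq_0_iff_dvd dvd_def)

text \<open>Two double roots count four with multiplicity.\<close>

lemma cubic_double_zero:
  fixes F :: "'a::field_char_0 poly"
  assumes "degree F \<le> 3" "\<beta>1 \<noteq> \<beta>2"
    "poly F \<beta>1 = 0" "poly (pderiv F) \<beta>1 = 0" "poly F \<beta>2 = 0" "poly (pderiv F) \<beta>2 = 0"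
  shows "F = 0"
proof (rule ccontr)
  assume F: "F \<noteq> 0"
  have "2 \<le> order \<beta> F" if z: "poly F \<beta> = 0" "poly (pderiv F) \<beta> = 0" for \<beta>
  proof -
    obtain G where G: "F = [:-\<beta>, 1:] * G" by (rule root_factor[OF z(1)])
    have "pderiv F = G + [:-\<beta>, 1:] * pderiv G" unfolding G by (simp only: pderiv_mult) (simp add: pderiv_pCons)
    then have "poly G \<beta> = 0" using z(2) by simp
    then obtain H where "G = [:-\<beta>, 1:] * H" by (rule root_factor)
    then have "[:-\<beta>, 1:] ^ 2 dvd F" unfolding G power2_eq_square by (metis dvd_triv_left mult.assoc)
    then show ?thesis using F by (simp add: order_divides)
  qed
  then have "2 \<le> order \<beta>1 F" "2 \<le> order \<beta>2 F" using assms by auto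
  moreover have "(\<Sum>x\<in>{\<beta>1, \<beta>2}. order x F) \<le> degree F"
  proof -
    have "(\<Sum>x\<in>{\<beta>1, \<beta>2}. order x F) \<le> (\<Sum>x | poly F x = 0. order x F)"
      by (rule sum_mono2) (use F assms in \<open>auto simp: poly_roots_finite\<close>)
    also have "\<dots> \<le> degree F" by (rule sum_order_le_degree[OF F])
    finally show ?thesis .
  qed
  ultimately show False using assms(1,2) by simp
qed

text \<open>\<open>S\<^sup>3 + a S\<^sup>2 + p S + q\<close> becomes \<open>\<sigma>\<^sup>3 + P \<sigma> + Q\<close> for \<open>\<sigma> = S + a / 3\<close>; the discriminant
  below is \<open>4 P\<^sup>3 + 27 Q\<^sup>2\<close> in terms of \<open>3 P = cubic_P a p\<close> and \<open>27 Q = cubic_Q a p q\<close>, up to a factor 27.\<close>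

definition cubic_P :: "'a::comm_ring_1 \<Rightarrow> 'a \<Rightarrow> 'a" where
  "cubic_P a p = 3 * p - a ^ 2"

definition cubic_Q :: "'a::comm_ring_1 \<Rightarrow> 'a \<Rightarrow> 'a \<Rightarrow> 'a" where
  "cubic_Q a p q = 27 * q - 9 * a * p + 2 * a ^ 3"

definition cubic_disc :: "'a::comm_ring_1 \<Rightarrow> 'a \<Rightarrow> 'a \<Rightarrow> 'a" where
  "cubic_disc a p q = 4 * cubic_P a p ^ 3 + cubic_Q a p q ^ 2"

lemma cubic_depressed:
  fixes r a p q :: "'a::comm_ring_1"
  shows "27 * (r ^ 3 + a * r ^ 2 + p * r + q) = (3 * r + a) ^ 3 + 3 * cubic_P a p * (3 * r + a) + cubic_Q a p q"
  unfolding cubic_P_def cubic_Q_def by (simp add: power2_eq_square power3_eq_cube algebra_simps)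

text \<open>The depressed cubic in s = 3 r + a has the double root s, so its scaled coefficients are
  P = -s^2 and Q = 2 s^3. The discriminant cancels, and s = -Q / (2 P) is rational in the
  coefficients if P is nonzero.\<close>

lemma cubic_double_root:
  fixes r a p q :: "'a::idom"
  assumes "r ^ 3 + a * r ^ 2 + p * r + q = 0" "3 * r ^ 2 + 2 * a * r + p = 0"
  shows "cubic_disc a p q = 0" "2 * cubic_P a p * (3 * r + a) = - cubic_Q a p q"
    "cubic_P a p = - ((3 * r + a) ^ 2)"
proof -
  have "p = (3 * r ^ 2 + 2 * a * r + p) - 3 * r ^ 2 - 2 * a * r" by simp
  then have p: "p = - 3 * r ^ 2 - 2 * a * r" unfolding assms(2) by simp
  have "q = (r ^ 3 + a * r ^ 2 + p * r + q) - r ^ 3 - a * r ^ 2 - p * r" by simp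
  then have q: "q = - (r ^ 3) - a * r ^ 2 - p * r" unfolding assms(1) by simp
  show P: "cubic_P a p = - ((3 * r + a) ^ 2)"
    unfolding cubic_P_def p by (simp add: power2_eq_square algebra_simps)
  have Q: "cubic_Q a p q = 2 * (3 * r + a) ^ 3"
    unfolding cubic_Q_def q p by (simp add: power2_eq_square power3_eq_cube algebra_simps)
  show "cubic_disc a p q = 0" "2 * cubic_P a p * (3 * r + a) = - cubic_Q a p q"
    unfolding cubic_disc_def P Q by (simp_all add: power2_eq_square power3_eq_cube algebra_simps)
qed

text \<open>A multiple root already lies in the field: s = -Q / (2 P), or s = 0 if P = 0. Hence a
  cubic without roots in its field has nonzero discriminant, which is what allows a generic
  direction \<open>v\<close> to be chosen off the discriminant.\<close>

lemma cubic_disc_root: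
  fixes a p q :: "'a::field_char_0"
  assumes "cubic_disc a p q = 0"
  shows "\<exists>r. r ^ 3 + a * r ^ 2 + p * r + q = 0"
proof -
  let ?P = "cubic_P a p" and ?Q = "cubic_Q a p q"
  obtain s where s: "s ^ 3 + 3 * ?P * s + ?Q = 0"
  proof (cases "?P = 0")
    case True
    then have "?Q = 0" using assms by (simp add: cubic_disc_def)
    with True show ?thesis using that[of 0] by simp
  next
    case False
    define s where "s = - ?Q / (2 * ?P)"
    have s1: "2 * ?P * s = - ?Q" using False by (simp add: s_def)
    have "4 * ?P ^ 2 * (s ^ 2 + ?P) = (2 * ?P * s) ^ 2 + 4 * ?P ^ 3"
      by (simp add: power2_eq_square power3_eq_cube algebra_simps)
    also have "\<dots> = 0" using assms unfolding s1 cubic_disc_def by (simp add: add.commute)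
    finally have "4 * ?P ^ 2 * (s ^ 2 + ?P) = 0" .
    then have s2: "s ^ 2 = - ?P" using False by (simp add: eq_neg_iff_add_eq_0)
    have "s ^ 3 + 3 * ?P * s + ?Q = s * s ^ 2 + 3 * ?P * s + ?Q" by (simp add: power3_eq_cube power2_eq_square)
    also have "\<dots> = 2 * ?P * s + ?Q" unfolding s2 by (simp add: algebra_simps)
    also have "\<dots> = 0" unfolding s1 by simp
    finally show ?thesis using that by blast
  qed
  define r where "r = (s - a) / 3"
  have "3 * r + a = s" by (simp add: r_def field_simps)
  then have "27 * (r ^ 3 + a * r ^ 2 + p * r + q) = 0"
    using cubic_depressed[of r a p q] s by simp
  then have "r ^ 3 + a * r ^ 2 + p * r + q = 0" by (simp only: mult_eq_0_iff) simp
  then show ?thesis ..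
qed

lemma poly_cubic: "poly [:q, p, a, 1:] r = r ^ 3 + a * r ^ 2 + p * r + (q::'a::comm_ring_1)"
  by (simp add: power2_eq_square power3_eq_cube algebra_simps)

text \<open>The sum is an integral equation for h / d with denominators cleared, taken modulo
  \<open>c\<close>. This lemma and the next two say how it behaves when \<open>h\<close> is
  multiplied by \<open>l\<close>, when \<open>h\<close> is changed modulo \<open>c\<close>, and when
  \<open>h\<close> is divisible by \<open>d\<close>.\<close>

lemma power_sum_absorb:
  fixes c h :: "'a::comm_ring_1"
  assumes "c dvd h ^ n + (\<Sum>k<n. g k * h ^ k * d ^ (n - k))"
  shows "c dvd (l * h) ^ n + (\<Sum>k<n. (g k * l ^ (n - k)) * (l * h) ^ k * d ^ (n - k))"
proof -
  have "l ^ n * (h ^ n + (\<Sum>k<n. g k * h ^ k * d ^ (n - k)))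
      = (l * h) ^ n + (\<Sum>k<n. (g k * l ^ (n - k)) * (l * h) ^ k * d ^ (n - k))"
  proof -
    have "l ^ n * (g k * h ^ k * d ^ (n - k)) = (g k * l ^ (n - k)) * (l * h) ^ k * d ^ (n - k)" if "k < n" for k
    proof -
      have "l ^ n = l ^ k * l ^ (n - k)" using that by (simp flip: power_add)
      then show ?thesis by (simp add: power_mult_distrib mult_ac)
    qed
    then have "(\<Sum>k<n. l ^ n * (g k * h ^ k * d ^ (n - k))) = (\<Sum>k<n. (g k * l ^ (n - k)) * (l * h) ^ k * d ^ (n - k))"
      by (intro sum.cong) auto
    then show ?thesis by (simp add: distrib_left sum_distrib_left power_mult_distrib)
  qed
  then show ?thesis using assms by (metis dvd_mult)
qed

lemma power_sum_cong_dvd: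
  fixes c h :: "'a::comm_ring_1"
  assumes "c dvd h - h'" "c dvd h ^ n + (\<Sum>k<n. g k * h ^ k * d ^ (n - k))"
  shows "c dvd h' ^ n + (\<Sum>k<n. g k * h' ^ k * d ^ (n - k))"
proof -
  have pw: "c dvd h ^ k - h' ^ k" for k
    using assms(1) by (metis dvd_mult2 power_diff_sumr2)
  have "c dvd (\<Sum>k<n. g k * d ^ (n - k) * (h ^ k - h' ^ k))"
    by (intro dvd_sum dvd_mult pw)
  then have "c dvd (h ^ n - h' ^ n) + (\<Sum>k<n. g k * d ^ (n - k) * (h ^ k - h' ^ k))"
    using pw by (rule dvd_add[rotated])
  also have "(h ^ n - h' ^ n) + (\<Sum>k<n. g k * d ^ (n - k) * (h ^ k - h' ^ k))
      = (h ^ n + (\<Sum>k<n. g k * h ^ k * d ^ (n - k))) - (h' ^ n + (\<Sum>k<n. g k * h' ^ k * d ^ (n - k)))"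
    by (simp add: sum_subtractf right_diff_distrib mult_ac)
  finally show ?thesis using assms(2) by (metis dvd_diff_right_iff)
qed

lemma power_sum_scale:
  fixes d Y :: "'a::comm_ring_1"
  shows "(d * Y) ^ n + (\<Sum>k<n. g k * (d * Y) ^ k * d ^ (n - k)) = d ^ n * (Y ^ n + (\<Sum>k<n. g k * Y ^ k))"
proof -
  have "g k * (d * Y) ^ k * d ^ (n - k) = d ^ n * (g k * Y ^ k)" if "k < n" for k
  proof -
    have "d ^ n = d ^ k * d ^ (n - k)" using that by (simp flip: power_add)
    then show ?thesis by (simp add: power_mult_distrib mult_ac)
  qed
  then have "(\<Sum>k<n. g k * (d * Y) ^ k * d ^ (n - k)) = (\<Sum>k<n. d ^ n * (g k * Y ^ k))"
    by (intro sum.cong) auto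
  then show ?thesis by (simp add: distrib_left sum_distrib_left power_mult_distrib)
qed

lemma monic_dvd_smult_cancel:
  fixes c :: "'a::idom poly"
  assumes "lead_coeff c = 1" "c dvd smult s Y" "s \<noteq> 0"
  shows "c dvd Y"
proof -
  obtain q r where qr: "pseudo_divmod Y c = (q, r)" by fastforce
  have c0: "c \<noteq> 0" using assms(1) by auto
  have eq: "Y = c * q + r" and r: "r = 0 \<or> degree r < degree c"
    using pseudo_divmod[OF c0 qr] assms(1) by auto
  have "smult s Y = c * smult s q + smult s r" by (simp add: eq smult_add_right)
  then have "c dvd smult s r" using assms(2) by (metis dvd_add_right_iff dvd_triv_left)
  then have "r = 0" using r assms(3) dvd_imp_degree_le[of c "smult s r"] by force
  then show ?thesis using eq by simp
qed

lemma monic_cubic_factor: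
  fixes q p a :: "'a::alg_closed_field"
  obtains x y z where "[:q, p, a, 1:] = [:-x, 1:] * [:-y, 1:] * [:-z, 1:]"
proof -
  obtain x where "poly [:q, p, a, 1:] x = 0"
    using alg_closed_imp_poly_has_root[of "[:q, p, a, 1:]"] by auto
  then obtain G where G: "[:q, p, a, 1:] = [:-x, 1:] * G" by (rule root_factor)
  then have G0: "G \<noteq> 0" by auto
  have "degree [:q, p, a, 1:] = degree [:-x, 1:] + degree G"
    unfolding G using G0 by (intro degree_mult_eq) auto
  then have dG: "degree G = 2" by simp
  have "lead_coeff [:q, p, a, 1:] = lead_coeff [:-x, 1:] * lead_coeff G"
    unfolding G by (rule lead_coeff_mult)
  then have lG: "lead_coeff G = 1" by simp
  obtain y where "poly G y = 0" using alg_closed_imp_poly_has_root[of G] dG by auto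
  then obtain H where H: "G = [:-y, 1:] * H" by (rule root_factor)
  then have H0: "H \<noteq> 0" using G0 by auto
  have "degree G = degree [:-y, 1:] + degree H"
    unfolding H using H0 by (intro degree_mult_eq) auto
  then have dH: "degree H = 1" using dG by simp
  have "lead_coeff G = lead_coeff [:-y, 1:] * lead_coeff H"
    unfolding H by (rule lead_coeff_mult)
  then have lH: "poly.coeff H 1 = 1" using lG dH by simp
  have "H = [:-(- poly.coeff H 0), 1:]"
    by (rule poly_eqI) (use lH dH in \<open>auto simp: coeff_pCons coeff_eq_0 split: nat.splits\<close>)
  with G H show ?thesis using that[of x y "- poly.coeff H 0"] by (simp only: mult.assoc)
qed

text \<open>Elimination of \<open>g\<close>: modulo \<open>c\<close>, \<open>s * lh\<close> is
  \<open>d\<close> times \<open>s * r - k * t\<close>. In the criterion below \<open>d\<close> is T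
  - \<beta>, and this quotient is the new integral element \<open>Y\<close>.\<close>

lemma combine_remainders:
  fixes c :: "'a::comm_ring_1"
  assumes "lh = d * r + k * g + c * m" "s * g = c - d * t"
  shows "s * lh - d * (s * r - k * t) = c * (k + s * m)"
proof -
  have "s * lh - d * (s * r - k * t) = k * (s * g) + c * (s * m) + d * k * t"
    unfolding assms(1) by (simp add: algebra_simps)
  then show ?thesis unfolding assms(2) by (simp add: algebra_simps)
qed

text \<open>Singular points \<open>(S, T) = (\<alpha>, \<beta>)\<close> of \<open>S\<^sup>3 + a(T) S\<^sup>2 + p(T) S + q(T) = 0\<close>.\<close>

definition sing_pt :: "'a::field poly \<Rightarrow> 'a poly \<Rightarrow> 'a poly \<Rightarrow> 'a \<Rightarrow> 'a \<Rightarrow> bool" where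
  "sing_pt a p q \<alpha> \<beta> \<longleftrightarrow>
     \<alpha> ^ 3 + poly a \<beta> * \<alpha> ^ 2 + poly p \<beta> * \<alpha> + poly q \<beta> = 0 \<and>
     3 * \<alpha> ^ 2 + 2 * poly a \<beta> * \<alpha> + poly p \<beta> = 0 \<and>
     poly (pderiv a) \<beta> * \<alpha> ^ 2 + poly (pderiv p) \<beta> * \<alpha> + poly (pderiv q) \<beta> = 0"

text \<open>The criterion of Dedekind: at a root of the denominator of an integral element of
  \<open>L[T, S] / (c)\<close>, all of \<open>c\<close>, \<open>c\<^sub>S\<close> and \<open>c\<^sub>T\<close> vanish somewhere. Here \<open>c\<close> is a polynomial in \<open>S\<close> over
  \<open>L[T]\<close>.\<close>

lemma integral_sing_pt:
  fixes a p q d2 :: "'a::alg_closed_field poly" and h :: "'a poly poly"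
  assumes deg: "degree h \<le> 2" and nz: "map_poly (\<lambda>r. poly r \<beta>) h \<noteq> 0"
    and rel: "[:q, p, a, 1:] dvd h ^ n + (\<Sum>k<n. g k * h ^ k * [:[:-\<beta>, 1:] * d2:] ^ (n - k))"
  shows "\<exists>\<alpha>. sing_pt a p q \<alpha> \<beta>"
proof -
  let ?ev = "\<lambda>r. poly r \<beta>"
  let ?c = "[:q, p, a, 1:]"
  let ?D = "[:[:-\<beta>, 1:]:]"
  interpret ev: comm_ring_hom ?ev by (rule comm_ring_hom_poly)
  interpret E: map_poly_comm_ring_hom ?ev ..
  interpret io: comm_ring_hom "\<lambda>r::'a. [:r:]" by (rule comm_ring_hom_pCons)
  interpret I: map_poly_comm_ring_hom "\<lambda>r::'a. [:r:]" ..
  \<comment> \<open>\<open>?E\<close> reduces coefficients modulo T - \<beta>, and \<open>?I\<close>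
    lifts a polynomial in S back to one whose coefficients are constant in T.\<close>
  let ?E = "map_poly ?ev" and ?I = "map_poly (\<lambda>r::'a. [:r:])"
  have coE: "poly.coeff (?E u) i = poly (poly.coeff u i) \<beta>" for u i by (simp add: coeff_map_poly)
  have coI: "poly.coeff (?I u) i = [:poly.coeff u i:]" for u i by (simp add: coeff_map_poly)
  have EI: "?E (?I u) = u" for u by (rule poly_eqI) (simp add: coE coI)
  have ED: "?E ?D = 0" by (rule poly_eqI) (simp add: coE coeff_pCons split: nat.splits)
  have Ec': "?E ?c = [:poly q \<beta>, poly p \<beta>, poly a \<beta>, 1:]" by (simp add: map_poly_pCons)
  have ker: "\<exists>Z. Y = ?D * Z" if "?E Y = 0" for Y
  proof -
    have "poly (poly.coeff Y i) \<beta> = 0" for i using coE[of Y i] that by simp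
    then have "?D dvd Y" by (simp add: const_poly_dvd_iff poly_eq_0_iff_dvd)
    then show ?thesis by (elim dvdE) blast
  qed
  have n: "n > 0"
  proof (rule ccontr)
    assume "\<not> n > 0"
    then have "?c dvd 1" using rel by simp
    then show False by (auto simp: poly_dvd_1)
  qed
  let ?H = "?E h"
  have degH: "degree ?H \<le> 2" using deg degree_map_poly_le[of ?ev h] by simp
  have D_eq: "[:[:-\<beta>, 1:] * d2:] = ?D * [:d2:]" by simp
  have "?E ?c dvd ?E (h ^ n + (\<Sum>k<n. g k * h ^ k * [:[:-\<beta>, 1:] * d2:] ^ (n - k)))"
    using rel by (rule E.hom_dvd)
  also have "\<dots> = ?H ^ n"
  proof -
    have "?E [:[:-\<beta>, 1:] * d2:] = 0" by (rule poly_eqI) (simp add: coE coeff_pCons split: nat.splits)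
    then show ?thesis by (simp only: E.hom_add E.hom_sum E.hom_mult E.hom_power) (simp add: zero_power)
  qed
  finally have Hn: "?E ?c dvd ?H ^ n" .
  obtain x y z where xyz: "?E ?c = [:-x, 1:] * [:-y, 1:] * [:-z, 1:]"
    unfolding Ec' by (rule monic_cubic_factor)
  have root: "poly ?H w = 0" if "poly (?E ?c) w = 0" for w
  proof -
    obtain k where "?H ^ n = ?E ?c * k" using Hn by (rule dvdE)
    then have "poly ?H w ^ n = poly (?E ?c) w * poly k w" by (simp only: poly_mult flip: poly_power)
    then show ?thesis using that by simp
  qed
  \<comment> \<open>At T = \<beta> the relation makes \<open>?H ^ n\<close> divisible by the reduced
    cubic. So all roots of the cubic are among those of \<open>?H\<close>, which is nonzero of
    degree at most 2, and the cubic has a multiple root.\<close>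
  have "card {x, y, z} \<le> card {w. poly ?H w = 0}"
  proof (rule card_mono)
    show "finite {w. poly ?H w = 0}" using nz by (rule poly_roots_finite)
    have "poly (?E ?c) x = 0" "poly (?E ?c) y = 0" "poly (?E ?c) z = 0"
      by (simp_all only: xyz poly_mult) simp_all
    then show "{x, y, z} \<subseteq> {w. poly ?H w = 0}" using root by blast
  qed
  also have "\<dots> \<le> 2" using poly_roots_degree[OF nz] degH by linarith
  finally have "x = y \<or> x = z \<or> y = z" by (auto simp: card_insert_if split: if_splits)
  then obtain \<alpha> \<gamma> where Ec: "?E ?c = [:-\<alpha>, 1:] * ([:-\<alpha>, 1:] * [:-\<gamma>, 1:])"
  proof (elim disjE)
    assume "x = y"
    then show ?thesis using that[of x z] xyz by (simp only: mult_ac)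
  next
    assume "x = z"
    then show ?thesis using that[of x y] xyz by (simp only: mult_ac)
  next
    assume "y = z"
    then show ?thesis using that[of y x] xyz by (simp only: mult_ac)
  qed
  let ?g = "[:-\<alpha>, 1:] * [:-\<gamma>, 1:]" and ?s = "[:-\<alpha>, 1:]"
  have c0: "poly (?E ?c) \<alpha> = 0" "poly (?E ?c) \<gamma> = 0" by (simp_all only: Ec poly_mult) simp_all
  then have rts: "poly ?H \<alpha> = 0" "poly ?H \<gamma> = 0" using root by blast+
  from rts(1) obtain H1 where H1: "?H = ?s * H1" by (rule root_factor)
  then have H10: "H1 \<noteq> 0" using nz by auto
  have dH1: "degree H1 \<le> 1"
    using degH H10 unfolding H1 by (subst (asm) degree_mult_eq) auto
  \<comment> \<open>If \<open>H1\<close> vanishes at \<gamma>, then \<open>?H\<close> is a constant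
    multiple of \<open>?g\<close>. Otherwise \<gamma> = \<alpha> and \<open>?H\<close> has only a
    simple zero there; multiplication by \<open>l\<close> = S - \<alpha> supplies the missing factor
    modulo the cube.\<close>
  have "\<exists>l \<kappa> m. \<kappa> \<noteq> 0 \<and> l * ?H = smult \<kappa> ?g + ?E ?c * m"
  proof (cases "poly H1 \<gamma> = 0")
    case True
    then obtain W where W: "H1 = [:-\<gamma>, 1:] * W" by (rule root_factor)
    then have "W \<noteq> 0" using H10 by auto
    then have "degree W = 0" using dH1 unfolding W by (subst (asm) degree_mult_eq) auto
    then obtain \<kappa> where "W = [:\<kappa>:]" by (metis degree_eq_zeroE)
    then have "\<kappa> \<noteq> 0 \<and> 1 * ?H = smult \<kappa> ?g + ?E ?c * 0"
      using \<open>W \<noteq> 0\<close> H1 W by (simp add: algebra_simps)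
    then show ?thesis by blast
  next
    case False
    then have "\<gamma> = \<alpha>" using rts(2) by (simp add: H1)
    have "poly (H1 - [:poly H1 \<alpha>:]) \<alpha> = 0" by simp
    then obtain m where "H1 - [:poly H1 \<alpha>:] = ?s * m" by (rule root_factor)
    then have "H1 = [:poly H1 \<alpha>:] + ?s * m" by (metis add.commute diff_add_cancel)
    then have "?s * ?H = ?s * (?s * ([:poly H1 \<alpha>:] + ?s * m))" unfolding H1 by (simp only:)
    also have "\<dots> = [:poly H1 \<alpha>:] * (?s * ?s) + ?s * (?s * ?s) * m" by (simp only: algebra_simps)
    also have "\<dots> = smult (poly H1 \<alpha>) ?g + ?E ?c * m"
      unfolding Ec \<open>\<gamma> = \<alpha>\<close> by simp
    finally have "?s * ?H = smult (poly H1 \<alpha>) ?g + ?E ?c * m" .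
    then show ?thesis using False \<open>\<gamma> = \<alpha>\<close> by blast
  qed
  then obtain l \<kappa> m where \<kappa>: "\<kappa> \<noteq> 0" and lH: "l * ?H = smult \<kappa> ?g + ?E ?c * m" by blast
  have "?E (?c - ?I ?s * ?I ?g) = 0"
    by (simp only: E.hom_minus E.hom_mult EI Ec) simp
  \<comment> \<open>The subtracted product has coefficients constant in T, so \<open>t\<close> at T
    = \<beta> is the T-derivative of the cubic; see \<open>ct\<close> below. The aim is to show that
    it vanishes at S = \<alpha>.\<close>
  then obtain t where t: "?c - ?I ?s * ?I ?g = ?D * t" using ker by blast
  have "?E (?I l * h - ?I [:\<kappa>:] * ?I ?g - ?c * ?I m) = 0"
    by (simp only: E.hom_minus E.hom_mult EI lH) simp
  then obtain r where r: "?I l * h - ?I [:\<kappa>:] * ?I ?g - ?c * ?I m = ?D * r" using ker by blast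
  \<comment> \<open>Modulo the cubic, \<open>Y\<close> represents s l h / (T - \<beta>), with s = S
    - \<alpha>. It satisfies a monic equation with the coefficients \<open>G k\<close>, because
    powers of T - \<beta> can be cancelled against a monic divisor.\<close>
  define Y where "Y = ?I ?s * r - ?I [:\<kappa>:] * t"
  define G where "G = (\<lambda>k. g k * [:d2:] ^ (n - k) * (?I ?s * ?I l) ^ (n - k))"
  have "?c dvd h ^ n + (\<Sum>k<n. (g k * [:d2:] ^ (n - k)) * h ^ k * ?D ^ (n - k))"
    using rel unfolding D_eq power_mult_distrib by (simp only: mult_ac)
  from power_sum_absorb[OF this, of "?I ?s * ?I l"]
  have "?c dvd (?I ?s * ?I l * h) ^ n + (\<Sum>k<n. G k * (?I ?s * ?I l * h) ^ k * ?D ^ (n - k))"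
    by (simp only: G_def)
  moreover have "?c dvd ?I ?s * ?I l * h - ?D * Y"
  proof -
    have "?I l * h = (?I l * h - ?I [:\<kappa>:] * ?I ?g - ?c * ?I m) + ?I [:\<kappa>:] * ?I ?g + ?c * ?I m" by simp
    then have lh: "?I l * h = ?D * r + ?I [:\<kappa>:] * ?I ?g + ?c * ?I m" unfolding r .
    have "?I ?s * ?I ?g = ?c - (?c - ?I ?s * ?I ?g)" by simp
    then have "?I ?s * ?I ?g = ?c - ?D * t" unfolding t .
    from combine_remainders[OF lh this]
    have "?I ?s * ?I l * h - ?D * Y = ?c * (?I [:\<kappa>:] + ?I ?s * ?I m)"
      unfolding Y_def by (simp only: mult.assoc)
    then show ?thesis by (rule dvdI)
  qed
  ultimately have "?c dvd (?D * Y) ^ n + (\<Sum>k<n. G k * (?D * Y) ^ k * ?D ^ (n - k))"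
    by (rule power_sum_cong_dvd[rotated])
  then have "?c dvd ?D ^ n * (Y ^ n + (\<Sum>k<n. G k * Y ^ k))" by (simp only: power_sum_scale)
  then have "?c dvd smult ([:-\<beta>, 1:] ^ n) (Y ^ n + (\<Sum>k<n. G k * Y ^ k))"
    by (simp only: poly_const_pow mult_pCons_left mult_zero_left pCons_0_0 add_0_right)
  then have "?c dvd Y ^ n + (\<Sum>k<n. G k * Y ^ k)"
    by (rule monic_dvd_smult_cancel[rotated]) auto
  then have "?E ?c dvd ?E (Y ^ n + (\<Sum>k<n. G k * Y ^ k))" by (rule E.hom_dvd)
  then obtain w where "?E (Y ^ n + (\<Sum>k<n. G k * Y ^ k)) = ?E ?c * w" by (rule dvdE)
  then have "poly (?E (Y ^ n + (\<Sum>k<n. G k * Y ^ k))) \<alpha> = poly (?E ?c) \<alpha> * poly w \<alpha>"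
    by (simp only: poly_mult)
  then have "poly (?E (Y ^ n + (\<Sum>k<n. G k * Y ^ k))) \<alpha> = 0" by (simp only: c0 mult_zero_left)
  \<comment> \<open>For k < n the coefficient \<open>G k\<close> contains a positive power of S -
    \<alpha>, so at (\<alpha>, \<beta>) the equation becomes Y^n = 0. There \<open>Y\<close> equals
    -\<kappa> t.\<close>
  moreover have "poly (?E (G k)) \<alpha> = 0" if "k < n" for k
    using that by (simp only: G_def E.hom_mult E.hom_power EI poly_mult poly_power) (simp add: zero_power)
  ultimately have "poly (?E Y) \<alpha> ^ n = 0"
    by (simp only: E.hom_add E.hom_sum E.hom_mult E.hom_power poly_sum poly_add poly_mult poly_power) simp
  then have "poly (?E Y) \<alpha> = 0" by simp
  then have Et: "poly (?E t) \<alpha> = 0"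
    using \<kappa> by (simp only: Y_def E.hom_minus E.hom_mult EI poly_mult poly_diff) simp
  have ct: "poly (pderiv (poly.coeff ?c i)) \<beta> = poly (poly.coeff t i) \<beta>" for i
  proof -
    have "?c = ?I ?s * ?I ?g + (?c - ?I ?s * ?I ?g)" by simp
    then have "?c = ?I ?s * ?I ?g + ?D * t" unfolding t .
    then have "?c = ?I (?s * ?g) + ?D * t" by (simp only: I.hom_mult)
    then have "poly.coeff ?c i = poly.coeff (?I (?s * ?g)) i + poly.coeff (?D * t) i"
      by (metis coeff_add)
    then have "poly.coeff ?c i = [:poly.coeff (?s * ?g) i:] + [:-\<beta>, 1:] * poly.coeff t i"
      unfolding coI by simp
    then show ?thesis by (simp only: pderiv_add pderiv_mult) (simp add: pderiv_pCons)
  qed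
  have "?E t = map_poly (\<lambda>r. poly (pderiv r) \<beta>) ?c"
    by (rule poly_eqI) (simp only: ct coE coeff_map_poly pderiv_0 poly_0)
  then have "poly (pderiv a) \<beta> * \<alpha> ^ 2 + poly (pderiv p) \<beta> * \<alpha> + poly (pderiv q) \<beta> = 0"
    using Et by (simp add: map_poly_pCons power2_eq_square algebra_simps)
  moreover have "\<alpha> ^ 3 + poly a \<beta> * \<alpha> ^ 2 + poly p \<beta> * \<alpha> + poly q \<beta> = 0"
    using arg_cong[OF Ec, of "\<lambda>u. poly u \<alpha>"] by (simp only: Ec' poly_cubic) simp
  moreover have "poly (pderiv (?E ?c)) \<alpha> = 0" unfolding Ec by (simp only: pderiv_mult poly_add poly_mult) simp
  then have "3 * \<alpha> ^ 2 + 2 * poly a \<beta> * \<alpha> + poly p \<beta> = 0"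
    unfolding Ec' by (simp add: pderiv_pCons power2_eq_square algebra_simps)
  ultimately show ?thesis unfolding sing_pt_def by blast
qed

text \<open>The line through two singular points of a plane cubic is a component.\<close>

lemma sing_pt_unique:
  fixes a p q :: "'a::field_char_0 poly"
  assumes deg: "degree a \<le> 1" "degree p \<le> 2" "degree q \<le> 3"
    and line: "\<And>\<kappa> m. poly [:q, p, a, 1:] [:\<kappa>, m:] \<noteq> 0"
    and s1: "sing_pt a p q \<alpha>1 \<beta>1" and s2: "sing_pt a p q \<alpha>2 \<beta>2"
  shows "\<alpha>1 = \<alpha>2 \<and> \<beta>1 = \<beta>2"
proof (cases "\<beta>1 = \<beta>2")
  case True
  \<comment> \<open>Two singular points on a line T = const would be two double roots of a monic
    cubic in S.\<close>
  have "\<alpha>1 = \<alpha>2"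
  proof (rule ccontr)
    assume "\<alpha>1 \<noteq> \<alpha>2"
    then have "[:poly q \<beta>1, poly p \<beta>1, poly a \<beta>1, 1:] = 0"
      using s1 s2 True unfolding sing_pt_def
      by (intro cubic_double_zero[of _ \<alpha>1 \<alpha>2]) (auto simp: pderiv_pCons power2_eq_square power3_eq_cube algebra_simps)
    then show False by simp
  qed
  with True show ?thesis by simp
next
  case False
  \<comment> \<open>S = \<kappa> + m T is the line through both points. The restriction
    \<open>F\<close> of the cubic to it has a derivative that combines the two partial derivatives,
    so both points are double roots of \<open>F\<close>.\<close>
  define m where "m = (\<alpha>1 - \<alpha>2) / (\<beta>1 - \<beta>2)"
  define \<kappa> where "\<kappa> = \<alpha>1 - m * \<beta>1"
  let ?l = "[:\<kappa>, m:]"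
  have "m * (\<beta>1 - \<beta>2) = \<alpha>1 - \<alpha>2" using False by (simp add: m_def)
  then have l1: "poly ?l \<beta>1 = \<alpha>1" and l2: "poly ?l \<beta>2 = \<alpha>2"
    by (simp_all add: \<kappa>_def algebra_simps)
  define F where "F = ?l ^ 3 + a * ?l ^ 2 + p * ?l + q"
  have F: "F = poly [:q, p, a, 1:] ?l" unfolding F_def poly_cubic ..
  have l: "degree ?l \<le> 1" by simp
  have "degree F \<le> 3"
    unfolding F_def
  proof (intro degree_add_le)
    show "degree (?l ^ 3) \<le> 3" using degree_power_le[of ?l 3] l by linarith
    have "degree (?l ^ 2) \<le> 2" using degree_power_le[of ?l 2] l by linarith
    then show "degree (a * ?l ^ 2) \<le> 3" using degree_mult_le[of a "?l ^ 2"] deg by linarith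
    show "degree (p * ?l) \<le> 3" using degree_mult_le[of p ?l] deg l by linarith
  qed fact
  have dF: "poly (pderiv F) \<beta> = m * (3 * poly ?l \<beta> ^ 2 + 2 * poly a \<beta> * poly ?l \<beta> + poly p \<beta>)
      + (poly (pderiv a) \<beta> * poly ?l \<beta> ^ 2 + poly (pderiv p) \<beta> * poly ?l \<beta> + poly (pderiv q) \<beta>)" for \<beta>
    unfolding F_def power3_eq_cube power2_eq_square
    by (simp only: pderiv_add pderiv_mult) (simp add: pderiv_pCons algebra_simps)
  have pF: "poly F \<beta> = poly ?l \<beta> ^ 3 + poly a \<beta> * poly ?l \<beta> ^ 2 + poly p \<beta> * poly ?l \<beta> + poly q \<beta>" for \<beta>
    by (simp only: F_def poly_add poly_mult poly_power)
  have "F = 0"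
  proof (rule cubic_double_zero[of F \<beta>1 \<beta>2])
    show "degree F \<le> 3" "\<beta>1 \<noteq> \<beta>2" by fact+
    show "poly F \<beta>1 = 0" "poly F \<beta>2 = 0" unfolding pF l1 l2 using s1 s2 by (simp_all add: sing_pt_def)
    show "poly (pderiv F) \<beta>1 = 0" "poly (pderiv F) \<beta>2 = 0"
      unfolding dF l1 l2 using s1 s2 by (simp_all add: sing_pt_def)
  qed
  then show ?thesis using line F by metis
qed

interpretation to_fract: inj_idom_hom to_fract
  by unfold_locales simp_all

interpretation to_ac: inj_idom_hom to_ac
  by unfold_locales simp_all

lemma solve_linear:
  fixes d k n :: "'a::field"
  assumes "d * k + n = 0" "d \<noteq> 0"
  shows "k = - n / d"
proof -
  have "d * k = - n" using assms(1) by (rule eq_neg_iff_add_eq_0[THEN iffD2])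
  then show ?thesis unfolding nonzero_eq_divide_eq[OF assms(2)] by (simp only: mult.commute)
qed

text \<open>The coefficients of T^3, T^2 and T^0 on the line S = \<kappa> + m T: an equation for the
  slope alone, an equation linear in \<kappa> whose factor is the derivative of the first at m, and
  the cubic at T = 0 evaluated at \<kappa>. They are used in this order to descend m and \<kappa> to
  smaller fields.\<close>

lemma line_in_cubic:
  fixes \<kappa> m :: "'a::idom"
  assumes "poly [:[:q0, q1, q2, q3:], [:p0, p1, p2:], [:a0, a1:], 1:] [:\<kappa>, m:] = 0"
  shows "m ^ 3 + a1 * m ^ 2 + p2 * m + q3 = 0"
    "(3 * m ^ 2 + 2 * a1 * m + p2) * \<kappa> + (a0 * m ^ 2 + p1 * m + q2) = 0"
    "\<kappa> ^ 3 + a0 * \<kappa> ^ 2 + p0 * \<kappa> + q0 = 0"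
proof -
  have eq: "poly [:[:q0, q1, q2, q3:], [:p0, p1, p2:], [:a0, a1:], 1:] [:\<kappa>, m:] =
    [:\<kappa> ^ 3 + a0 * \<kappa> ^ 2 + p0 * \<kappa> + q0,
      (3 * \<kappa> ^ 2 * m + 2 * a0 * \<kappa> * m + p0 * m) + (a1 * \<kappa> ^ 2 + p1 * \<kappa> + q1),
      (3 * m ^ 2 + 2 * a1 * m + p2) * \<kappa> + (a0 * m ^ 2 + p1 * m + q2),
      m ^ 3 + a1 * m ^ 2 + p2 * m + q3:]"
    by (simp add: power2_eq_square power3_eq_cube algebra_simps)
  show "m ^ 3 + a1 * m ^ 2 + p2 * m + q3 = 0"
    "(3 * m ^ 2 + 2 * a1 * m + p2) * \<kappa> + (a0 * m ^ 2 + p1 * m + q2) = 0"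
    "\<kappa> ^ 3 + a0 * \<kappa> ^ 2 + p0 * \<kappa> + q0 = 0"
    using assms unfolding eq pCons_eq_0_iff by blast+
qed

text \<open>\<open>P\<close> is a constant times a power of X - \<beta>, and the binomial formula
  gives its second coefficient. In characteristic 0 this expresses \<beta> rationally in the
  coefficients of \<open>P\<close>.\<close>

lemma single_root_coeff:
  fixes P :: "'a::alg_closed_field poly"
  assumes P: "degree P > 0" and single: "\<And>x. poly P x = 0 \<Longrightarrow> x = \<beta>"
  shows "poly.coeff P (degree P - 1) = - of_nat (degree P) * lead_coeff P * \<beta>"
proof -
  have P0: "P \<noteq> 0" using P by auto
  obtain q where q: "P = [:-\<beta>, 1:] ^ order \<beta> P * q" "\<not> [:-\<beta>, 1:] dvd q"
    using order_decomp[OF P0] by blast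
  have "degree q = 0"
  proof (rule ccontr)
    assume "degree q \<noteq> 0"
    then obtain x where "poly q x = 0" using alg_closed_imp_poly_has_root[of q] by auto
    moreover from this have "poly P x = 0" by (subst q(1)) simp
    ultimately show False using single q(2) by (metis poly_eq_0_iff_dvd)
  qed
  then obtain c where c: "q = [:c:]" by (metis degree_eq_zeroE)
  let ?m = "order \<beta> P"
  have Peq: "P = smult c ([:-\<beta>, 1:] ^ ?m)" using q(1) c by simp
  have c0: "c \<noteq> 0" using P0 Peq by (metis smult_0_left)
  have dP: "degree P = ?m" by (subst Peq) (simp add: c0 degree_linear_power)
  have lc: "poly.coeff P ?m = c" by (subst Peq) (simp add: coeff_linear_power)
  have ch: "?m choose (?m - 1) = ?m" using P dP binomial_symmetric[of 1 ?m] by simp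
  have "poly.coeff P (?m - 1) = c * (of_nat ?m * - \<beta>)"
    using P ch unfolding dP
    by (subst Peq) (simp add: coeff_linear_poly_power)
  then show ?thesis unfolding dP lc by (simp add: algebra_simps)
qed

lemma minimal_annihilator:
  fixes \<beta> :: "'a::field alg_closure"
  assumes "x \<noteq> 0" "poly (map_poly to_ac x) \<beta> = 0"
  obtains \<mu> where "\<mu> \<noteq> 0" "degree \<mu> > 0" "\<And>y. poly (map_poly to_ac y) \<beta> = 0 \<Longrightarrow> \<mu> dvd y"
proof -
  interpret tt: map_poly_inj_idom_hom "to_ac :: 'a \<Rightarrow> _" ..
  let ?S = "\<lambda>x. x \<noteq> 0 \<and> poly (map_poly to_ac x) \<beta> = 0"
  obtain \<mu> where \<mu>: "?S \<mu>" and least: "\<And>y. ?S y \<Longrightarrow> degree \<mu> \<le> degree y"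
    using ex_has_least_nat[of ?S x degree] assms by blast
  have "degree \<mu> > 0"
  proof (rule ccontr)
    assume "\<not> degree \<mu> > 0"
    then obtain c where "\<mu> = [:c:]" by (metis degree_eq_zeroE gr0I)
    then show False using \<mu> by (simp add: to_ac.map_poly_pCons_hom)
  qed
  moreover have "\<mu> dvd y" if "poly (map_poly to_ac y) \<beta> = 0" for y
  proof -
    have "map_poly to_ac y = map_poly to_ac (y div \<mu>) * map_poly to_ac \<mu> + map_poly to_ac (y mod \<mu>)"
      by (simp flip: tt.hom_mult tt.hom_add)
    then have "poly (map_poly to_ac (y mod \<mu>)) \<beta> = 0" using that \<mu> by simp
    then have "y mod \<mu> = 0"
      using least[of "y mod \<mu>"] degree_mod_less'[of \<mu> y] \<mu> by (meson leD)
    then show ?thesis by auto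
  qed
  ultimately show ?thesis using that \<mu> by blast
qed

text \<open>A multiplier of least degree that makes all \<open>c i\<close> divisible by
  \<open>d\<close> is the denominator of the family c i / d in lowest terms: if it and all
  \<open>u i\<close> vanished at \<beta>, the minimal polynomial of \<beta> could be cancelled,
  lowering the degree.\<close>

lemma reduced_denominator:
  fixes d :: "'a::field poly" and c :: "nat \<Rightarrow> 'a poly"
  assumes d: "d \<noteq> 0" and nd: "\<not> (\<forall>i. d dvd c i)"
  obtains d1 u where "degree d1 > 0" "\<And>i. d1 * c i = d * u i"
    "\<And>\<beta>. poly (map_poly to_ac d1) \<beta> = 0 \<Longrightarrow> \<exists>i. poly (map_poly to_ac (u i)) \<beta> \<noteq> 0"
proof -
  let ?S = "\<lambda>r. r \<noteq> 0 \<and> (\<forall>i. d dvd r * c i)"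
  obtain d1 where d1: "?S d1" and least: "\<And>y. ?S y \<Longrightarrow> degree d1 \<le> degree y"
    using ex_has_least_nat[of ?S d degree] d by auto
  then obtain u where u: "\<And>i. d1 * c i = d * u i" unfolding dvd_def by metis
  have "degree d1 > 0"
  proof (rule ccontr)
    assume "\<not> degree d1 > 0"
    then obtain e where e: "d1 = [:e:]" by (metis degree_eq_zeroE gr0I)
    then have "e \<noteq> 0" using d1 by auto
    then have "d dvd c i" for i using d1 e by (auto simp: dvd_smult_iff)
    with nd show False by blast
  qed
  moreover have "\<exists>i. poly (map_poly to_ac (u i)) \<beta> \<noteq> 0" if root: "poly (map_poly to_ac d1) \<beta> = 0" for \<beta>
  proof (rule ccontr)
    assume "\<not> ?thesis"
    then have ui: "poly (map_poly to_ac (u i)) \<beta> = 0" for i by blast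
    obtain \<mu> where \<mu>: "\<mu> \<noteq> 0" "degree \<mu> > 0" "\<And>y. poly (map_poly to_ac y) \<beta> = 0 \<Longrightarrow> \<mu> dvd y"
      using minimal_annihilator[OF _ root] d1 by blast
    obtain e where e: "d1 = \<mu> * e" using \<mu>(3)[OF root] by (rule dvdE)
    have e0: "e \<noteq> 0" using e d1 by auto
    have "d dvd e * c i" for i
    proof -
      obtain w where w: "u i = \<mu> * w" using \<mu>(3)[OF ui] by (rule dvdE)
      have "\<mu> * (e * c i) = \<mu> * (d * w)" using u[of i] unfolding e w by (simp only: mult_ac)
      then have "e * c i = d * w" using \<mu>(1) by simp
      then show ?thesis by simp
    qed
    then have "degree d1 \<le> degree e" using least e0 by blast
    moreover have "degree d1 = degree \<mu> + degree e" unfolding e by (rule degree_mult_eq[OF \<mu>(1) e0])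
    ultimately show False using \<mu>(2) by simp
  qed
  ultimately show ?thesis using that u by blast
qed

lemma power_sum_change_denominator:
  fixes c :: "'a::idom poly"
  assumes lc: "lead_coeff c = 1" and d: "d \<noteq> 0"
    and eq: "[:e:] * h = [:d:] * h'"
    and rel: "c dvd h ^ n + (\<Sum>k<n. g k * h ^ k * [:d:] ^ (n - k))"
  shows "c dvd h' ^ n + (\<Sum>k<n. g k * h' ^ k * [:e:] ^ (n - k))"
proof -
  have "c dvd ([:e:] * h) ^ n + (\<Sum>k<n. (g k * [:e:] ^ (n - k)) * ([:e:] * h) ^ k * [:d:] ^ (n - k))"
    by (rule power_sum_absorb[OF rel])
  then have "c dvd [:d:] ^ n * (h' ^ n + (\<Sum>k<n. (g k * [:e:] ^ (n - k)) * h' ^ k))"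
    unfolding eq by (simp only: power_sum_scale)
  then have "c dvd smult (d ^ n) (h' ^ n + (\<Sum>k<n. (g k * [:e:] ^ (n - k)) * h' ^ k))"
    by (simp only: poly_const_pow mult_pCons_left mult_zero_left pCons_0_0 add_0_right)
  then have "c dvd h' ^ n + (\<Sum>k<n. (g k * [:e:] ^ (n - k)) * h' ^ k)"
    by (rule monic_dvd_smult_cancel[OF lc]) (use d in simp)
  moreover have "(\<Sum>k<n. (g k * [:e:] ^ (n - k)) * h' ^ k) = (\<Sum>k<n. g k * h' ^ k * [:e:] ^ (n - k))"
    by (simp only: mult_ac)
  ultimately show ?thesis by simp
qed

lemma poly_eq_pCons_2: "degree r \<le> 1 \<Longrightarrow> r = [:poly.coeff r 0, poly.coeff r 1:]"
  by (rule poly_eqI) (auto simp: coeff_pCons coeff_eq_0 split: nat.splits)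

lemma poly_eq_pCons_3: "degree r \<le> 2 \<Longrightarrow> r = [:poly.coeff r 0, poly.coeff r 1, poly.coeff r 2:]"
  by (rule poly_eqI) (auto simp: coeff_pCons coeff_eq_0 numeral_2_eq_2 split: nat.splits)

lemma poly_eq_pCons_4: "degree r \<le> 3 \<Longrightarrow> r = [:poly.coeff r 0, poly.coeff r 1, poly.coeff r 2, poly.coeff r 3:]"
  by (rule poly_eqI) (auto simp: coeff_pCons coeff_eq_0 numeral_2_eq_2 numeral_3_eq_3 split: nat.splits)

lemma hom_cubic_disc:
  assumes "comm_ring_hom f"
  shows "f (cubic_disc a p q) = cubic_disc (f a) (f p) (f q)"
proof -
  interpret comm_ring_hom f by fact
  show ?thesis unfolding cubic_disc_def cubic_P_def cubic_Q_def
    by (simp add: hom_add hom_minus hom_mult hom_power hom_numeral)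
qed

section \<open>Generic plane sections\<close>

text \<open>The coefficients stand for those of f(x + S e) as a monic cubic in S;
  \<open>noroot\<close> amounts to its irreducibility over the fraction field.\<close>

locale cubic_extension =
  fixes a p q :: "'k::{alg_closed_field, field_char_0} mpoly"
  assumes a: "a \<in> forms UNIV 1" and p: "p \<in> forms UNIV 2" and q: "q \<in> forms UNIV 3"
    and noroot: "\<And>r. r ^ 3 + to_fract a * r ^ 2 + to_fract p * r + to_fract q \<noteq> 0"
begin

lemma comm_ring_hom_to_fract: "comm_ring_hom (to_fract :: 'k mpoly \<Rightarrow> _)"
  by unfold_locales simp_all

lemma disc_nz: "cubic_disc a p q \<noteq> 0"
proof
  assume "cubic_disc a p q = 0"
  then have "cubic_disc (to_fract a) (to_fract p) (to_fract q) = 0"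
    using hom_cubic_disc[OF comm_ring_hom_to_fract, of a p q] by simp
  then show False using cubic_disc_root noroot by blast
qed

lemma forms_disc: "cubic_disc a p q \<in> forms UNIV 6"
proof -
  have num: "numeral n \<in> forms UNIV 0" for n
    using forms_const[of "numeral n" UNIV] by (simp add: const_hom.hom_numeral)
  have "3 * p \<in> forms UNIV (0 + 2)" by (rule forms_mult[OF num p])
  moreover have "a ^ 2 \<in> forms UNIV (2 * 1)" by (rule forms_power[OF a])
  ultimately have P: "cubic_P a p \<in> forms UNIV 2"
    unfolding cubic_P_def by (intro forms_diff) (simp_all only: add_0 mult_1_right)
  have "27 * q \<in> forms UNIV (0 + 3)" by (rule forms_mult[OF num q])
  moreover have "9 * a * p \<in> forms UNIV (0 + 1 + 2)" by (rule forms_mult[OF forms_mult[OF num a] p])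
  moreover have "2 * a ^ 3 \<in> forms UNIV (0 + 3 * 1)" by (rule forms_mult[OF num forms_power[OF a]])
  moreover have "0 + 1 + 2 = (3::nat)" by simp
  ultimately have Q: "cubic_Q a p q \<in> forms UNIV 3"
    unfolding cubic_Q_def by (intro forms_add forms_diff) (simp_all only: add_0 mult_1_right)
  have "4 * cubic_P a p ^ 3 \<in> forms UNIV (0 + 3 * 2)" by (rule forms_mult[OF num forms_power[OF P]])
  then have "4 * cubic_P a p ^ 3 \<in> forms UNIV 6" by simp
  moreover have "cubic_Q a p q ^ 2 \<in> forms UNIV (2 * 3)" by (rule forms_power[OF Q])
  then have "cubic_Q a p q ^ 2 \<in> forms UNIV 6" by simp
  ultimately show ?thesis unfolding cubic_disc_def by (rule forms_add)
qed

abbreviation ext :: "(nat \<Rightarrow> 'k) \<Rightarrow> 'k mpoly \<Rightarrow> 'k mpoly fract alg_closure poly" where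
  "ext v r \<equiv> map_poly to_clos (shift v r)"

lemma comm_ring_hom_ext: "comm_ring_hom (ext v)"
  by (rule comm_ring_hom_comp[OF comm_ring_hom_map_poly comm_ring_hom_shift])
    (unfold_locales, simp_all)

text \<open>The line is a priori defined over the algebraic closure and has to be made rational. Its
  slope is a root of a cubic whose coefficients are the values of \<open>a\<close>,
  \<open>p\<close>, \<open>q\<close> at \<open>v\<close>, hence a constant; it is a simple root, as
  the discriminant is nonzero at \<open>v\<close>. So \<kappa> solves a linear equation over the
  fraction field, and as a root of the cubic at T = 0 it contradicts \<open>noroot\<close>.\<close>

lemma no_line:
  assumes v: "meval (\<lambda>c. c) v (cubic_disc a p q) \<noteq> 0"
  shows "poly [:ext v q, ext v p, ext v a, 1:] [:\<kappa>, m:] \<noteq> 0"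
proof
  assume zero: "poly [:ext v q, ext v p, ext v a, 1:] [:\<kappa>, m:] = 0"
  have co: "poly.coeff (ext v r) i = to_clos (poly.coeff (shift v r) i)" for r i by (simp add: coeff_map_poly)
  have deg: "degree (ext v r) \<le> n" if "r \<in> forms UNIV n" for r n
    by (rule order_trans[OF degree_map_poly_le hpoly_degree[OF hpoly_shift[OF that]]])
  let ?m = "meval (\<lambda>c. c) v"
  have top: "poly.coeff (ext v r) n = to_clos (const (?m r))" if "r \<in> forms UNIV n" for r n
    by (simp add: co coeff_shift_top[OF that])
  have bot: "poly.coeff (ext v r) 0 = to_clos r" for r
    using poly_shift_0[of v r] by (simp add: co poly_0_coeff_0)
  let ?L = "\<lambda>r i. poly.coeff (ext v r) i"
  have "poly [:[:?L q 0, ?L q 1, ?L q 2, ?L q 3:], [:?L p 0, ?L p 1, ?L p 2:], [:?L a 0, ?L a 1:], 1:] [:\<kappa>, m:] = 0"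
    using zero poly_eq_pCons_2[OF deg[OF a]] poly_eq_pCons_3[OF deg[OF p]] poly_eq_pCons_4[OF deg[OF q]] by presburger
  note eqs = line_in_cubic[OF this, unfolded top[OF a] top[OF p] top[OF q] bot]
  have \<epsilon>: "inj_idom_hom (\<lambda>c::'k. to_clos (const c))"
    by unfold_locales (simp_all add: const_hom.hom_add const_hom.hom_mult)
  interpret \<epsilon>: inj_idom_hom "\<lambda>c::'k. to_clos (const c)" by (fact \<epsilon>)
  interpret e: map_poly_inj_idom_hom "\<lambda>c::'k. to_clos (const c)" ..
  obtain x y z where xyz: "[:?m q, ?m p, ?m a, 1:] = [:-x, 1:] * [:-y, 1:] * [:-z, 1:]"
    by (rule monic_cubic_factor)
  have "poly [:to_clos (const (?m q)), to_clos (const (?m p)), to_clos (const (?m a)), 1:] m = 0"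
    using eqs(1) by (simp only: poly_cubic)
  moreover have "[:to_clos (const (?m q)), to_clos (const (?m p)), to_clos (const (?m a)), 1:]
      = map_poly (\<lambda>c. to_clos (const c)) [:?m q, ?m p, ?m a, 1:]"
    by (simp add: map_poly_pCons)
  ultimately have "poly (map_poly (\<lambda>c. to_clos (const c)) [:-x, 1:] * map_poly (\<lambda>c. to_clos (const c)) [:-y, 1:]
      * map_poly (\<lambda>c. to_clos (const c)) [:-z, 1:]) m = 0"
    by (simp only: xyz e.hom_mult)
  then have "m = to_clos (const x) \<or> m = to_clos (const y) \<or> m = to_clos (const z)"
    by (simp only: poly_mult mult_eq_0_iff) (simp add: \<epsilon>.map_poly_pCons_hom const_hom.hom_uminus)
  then obtain m0 where m0: "m = to_clos (const m0)" by blast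
  have "to_clos (const (m0 ^ 3 + ?m a * m0 ^ 2 + ?m p * m0 + ?m q)) = 0"
    using eqs(1) unfolding m0 by (simp add: const_hom.hom_add const_hom.hom_mult const_hom.hom_power to_fract.hom_power)
  then have r0: "m0 ^ 3 + ?m a * m0 ^ 2 + ?m p * m0 + ?m q = 0" by (simp only: \<epsilon>.hom_0_iff)
  \<comment> \<open>This is the coefficient of \<kappa> in the second equation.\<close>
  have dnz: "3 * m0 ^ 2 + 2 * ?m a * m0 + ?m p \<noteq> 0"
  proof
    assume "3 * m0 ^ 2 + 2 * ?m a * m0 + ?m p = 0"
    from cubic_double_root(1)[OF r0 this] v show False
      by (simp add: hom_cubic_disc[OF comm_ring_hom_meval[OF comm_ring_hom_id]])
  qed
  let ?\<delta> = "to_fract (const (3 * m0 ^ 2 + 2 * ?m a * m0 + ?m p))"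
  let ?\<nu> = "to_fract (a * const m0 ^ 2 + poly.coeff (shift v p) 1 * const m0 + poly.coeff (shift v q) 2)"
  have num: "const 2 = (2 :: 'k mpoly)" "const 3 = (3 :: 'k mpoly)" by (simp_all add: const_hom.hom_numeral)
  have "to_ac ?\<delta> * \<kappa> + to_ac ?\<nu> = 0"
    using eqs(2) unfolding m0 co
    by (simp add: const_hom.hom_add const_hom.hom_mult const_hom.hom_power num to_fract.hom_power to_fract.hom_numeral)
  moreover have "?\<delta> \<noteq> 0" using dnz by (simp only: to_fract_eq_0_iff const_eq_0_iff not_False_eq_True)
  then have "to_ac ?\<delta> \<noteq> 0" by (simp only: to_ac_eq_0_iff not_False_eq_True)
  ultimately have "\<kappa> = - to_ac ?\<nu> / to_ac ?\<delta>" by (rule solve_linear)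
  then have "\<kappa> = to_ac (- ?\<nu> / ?\<delta>)" by (simp only: to_ac_divide to_ac_minus)
  then obtain k0 where "\<kappa> = to_ac k0" by blast
  then have "to_ac (k0 ^ 3 + to_fract a * k0 ^ 2 + to_fract p * k0 + to_fract q) = 0"
    using eqs(3) by simp
  then show False using noroot by (simp only: to_ac_eq_0_iff)
qed

lemma ext_eval_rational: "poly (ext v r) (to_ac b) = to_ac (poly (map_poly to_fract (shift v r)) b)"
proof -
  have "ext v r = map_poly to_ac (map_poly to_fract (shift v r))"
    by (simp add: map_poly_map_poly o_def)
  then show ?thesis by (simp only: to_ac.poly_map_poly)
qed

lemma pderiv_ext_eval_rational:
  "poly (pderiv (ext v r)) (to_ac b) = to_ac (poly (map_poly to_fract (pderiv (shift v r))) b)"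
proof -
  have "ext v r = map_poly to_ac (map_poly to_fract (shift v r))"
    by (simp add: map_poly_map_poly o_def)
  then have "pderiv (ext v r) = map_poly to_ac (map_poly to_fract (pderiv (shift v r)))"
    by (simp only: to_fract.map_poly_pderiv to_ac.map_poly_pderiv)
  then show ?thesis by (simp only: to_ac.poly_map_poly)
qed

text \<open>At a singular point \<alpha> is a double root of a cubic with rational coefficients, so
  3 \<alpha> + a is -Q / (2 P), or 0 if P = 0.\<close>

lemma sing_pt_first_rational:
  assumes "sing_pt (ext v a) (ext v p) (ext v q) \<alpha> (to_ac b)"
  shows "\<alpha> \<in> range to_ac"
proof -
  let ?ev = "\<lambda>r. poly (map_poly to_fract (shift v r)) b"
  let ?P = "cubic_P (?ev a) (?ev p)" and ?Q = "cubic_Q (?ev a) (?ev p) (?ev q)"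
  have eq: "\<alpha> ^ 3 + to_ac (?ev a) * \<alpha> ^ 2 + to_ac (?ev p) * \<alpha> + to_ac (?ev q) = 0"
    "3 * \<alpha> ^ 2 + 2 * to_ac (?ev a) * \<alpha> + to_ac (?ev p) = 0"
    using assms unfolding sing_pt_def ext_eval_rational by blast+
  have P: "cubic_P (to_ac (?ev a)) (to_ac (?ev p)) = to_ac ?P"
    and Q: "cubic_Q (to_ac (?ev a)) (to_ac (?ev p)) (to_ac (?ev q)) = to_ac ?Q"
    unfolding cubic_P_def cubic_Q_def by simp_all
  note dr = cubic_double_root[OF eq, unfolded P Q]
  have "\<exists>s. 3 * \<alpha> + to_ac (?ev a) = to_ac s"
  proof (cases "?P = 0")
    case True
    then have "3 * \<alpha> + to_ac (?ev a) = to_ac 0" using dr(3) by simp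
    then show ?thesis by blast
  next
    case False
    have "3 * \<alpha> + to_ac (?ev a) = to_ac (- ?Q) / to_ac (2 * ?P)"
      using dr(2) False by (simp add: field_simps)
    then have "3 * \<alpha> + to_ac (?ev a) = to_ac (- ?Q / (2 * ?P))" by (simp only: to_ac_divide)
    then show ?thesis by blast
  qed
  then obtain s where "3 * \<alpha> + to_ac (?ev a) = to_ac s" by blast
  then have "\<alpha> = to_ac ((s - ?ev a) / 3)" by (simp add: field_simps)
  then show ?thesis by blast
qed

text \<open>All roots of the reduced denominator of an integral element give the same singular point,
  which therefore has coordinates in the fraction field; these are integral of degree 1.\<close>

lemma singular_family:
  assumes d: "d \<noteq> 0" and h: "degree h \<le> 2" "\<not> [:d:] dvd h"
    and rel: "[:q, p, a, 1:] dvd h ^ n + (\<Sum>k<n. g k * h ^ k * [:d:] ^ (n - k))"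
  obtains v \<alpha> \<beta> where "meval (\<lambda>c. c) v (cubic_disc a p q) \<noteq> 0"
    "\<alpha> \<in> forms UNIV 1" "\<beta> \<in> forms UNIV 1"
    "\<alpha> ^ 3 + poly (shift v a) \<beta> * \<alpha> ^ 2 + poly (shift v p) \<beta> * \<alpha> + poly (shift v q) \<beta> = 0"
    "3 * \<alpha> ^ 2 + 2 * poly (shift v a) \<beta> * \<alpha> + poly (shift v p) \<beta> = 0"
    "poly (pderiv (shift v a)) \<beta> * \<alpha> ^ 2 + poly (pderiv (shift v p)) \<beta> * \<alpha> + poly (pderiv (shift v q)) \<beta> = 0"
proof -
  \<comment> \<open>One direction serves two purposes: the first factor gives
    \<open>shift v d\<close> a constant leading coefficient, the second excludes line
    components.\<close>
  have "lead_coeff (hscale d) * cubic_disc a p q \<noteq> 0" using d disc_nz by simp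
  from mpoly_nonroot_exists[OF this] obtain v where
    "meval (\<lambda>c. c) v (lead_coeff (hscale d) * cubic_disc a p q) \<noteq> 0" ..
  then have v: "meval (\<lambda>c. c) v (lead_coeff (hscale d)) \<noteq> 0" "meval (\<lambda>c. c) v (cubic_disc a p q) \<noteq> 0"
    by (auto simp: meval_mult[OF comm_ring_hom_id])
  interpret FF: map_poly_inj_idom_hom "to_fract :: 'k mpoly \<Rightarrow> _" ..
  interpret AA: map_poly_inj_idom_hom "to_ac :: 'k mpoly fract \<Rightarrow> _" ..
  interpret E: comm_ring_hom "ext v" by (rule comm_ring_hom_ext)
  interpret EE: map_poly_comm_ring_hom "ext v" ..
  let ?F = "\<lambda>r. map_poly to_fract (shift v r)"
  have ext_F: "ext v r = map_poly to_ac (?F r)" for r by (simp add: map_poly_map_poly o_def)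
  let ?dF = "?F d"
  have inj0: "shift v r = 0 \<longleftrightarrow> r = 0" for r by (metis poly_0 poly_shift_0 shift.hom_zero)
  have dF: "?dF \<noteq> 0" using d by (simp add: inj0)
  \<comment> \<open>The denominator remains proper over the fraction field: as
    \<open>shift v d\<close> has a unit as leading coefficient, divisibility would descend to
    polynomial coefficients, and at T = 0 \<open>d\<close> would divide all coefficients of
    \<open>h\<close>.\<close>
  have nd: "\<not> (\<forall>i. ?dF dvd ?F (poly.coeff h i))"
  proof
    assume all: "\<forall>i. ?dF dvd ?F (poly.coeff h i)"
    let ?c = "meval (\<lambda>c. c) v (lead_coeff (hscale d))"
    have "lead_coeff (shift v d) = const ?c" by (rule shift_lead_coeff[OF v(1)])
    moreover have "const ?c dvd 1"
      using v(1) by (intro dvdI[of _ _ "const (inverse ?c)"]) (simp flip: const_hom.hom_mult)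
    ultimately have unit: "lead_coeff (shift v d) dvd 1" by simp
    have "d dvd poly.coeff h i" for i
    proof -
      have "shift v d dvd shift v (poly.coeff h i)"
        using monic_dvd_descend[OF to_fract.inj_idom_hom_axioms unit] all by blast
      then obtain w where "shift v (poly.coeff h i) = shift v d * w" ..
      then have "poly (shift v (poly.coeff h i)) 0 = poly (shift v d) 0 * poly w 0" by simp
      then show ?thesis by simp
    qed
    then show False using h(2) by (simp add: const_poly_dvd_iff)
  qed
  obtain d1 u where d1: "degree d1 > 0" and u: "\<And>i. d1 * ?F (poly.coeff h i) = ?dF * u i"
    and red: "\<And>\<beta>. poly (map_poly to_ac d1) \<beta> = 0 \<Longrightarrow> \<exists>i. poly (map_poly to_ac (u i)) \<beta> \<noteq> 0"
    using reduced_denominator[OF dF nd] by blast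
  \<comment> \<open>The \<open>u i\<close> are a bare sequence; taking the exact quotients inside
    \<open>map_poly\<close> collects them into a polynomial in S of degree at most that of
    \<open>h\<close>.\<close>
  define h1 where "h1 = map_poly (\<lambda>c. map_poly to_ac (d1 * ?F c div ?dF)) h"
  have h1: "poly.coeff h1 i = map_poly to_ac (u i)" for i
  proof -
    have "?dF * u i div ?dF = u i" using dF by simp
    then show ?thesis unfolding h1_def using u[of i] by (simp add: coeff_map_poly)
  qed
  let ?c = "[:ext v q, ext v p, ext v a, 1:]"
  have sing: "\<exists>\<alpha>. sing_pt (ext v a) (ext v p) (ext v q) \<alpha> \<beta>" if root: "poly (map_poly to_ac d1) \<beta> = 0" for \<beta>
  proof -
    obtain d2 where d2: "map_poly to_ac d1 = [:-\<beta>, 1:] * d2" using root by (rule root_factor)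
    have eq: "[:map_poly to_ac d1:] * map_poly (ext v) h = [:ext v d:] * h1"
    proof (rule poly_eqI)
      fix i
      have "map_poly to_ac d1 * ext v (poly.coeff h i) = ext v d * map_poly to_ac (u i)"
        unfolding ext_F by (simp only: u flip: AA.hom_mult)
      then show "poly.coeff ([:map_poly to_ac d1:] * map_poly (ext v) h) i = poly.coeff ([:ext v d:] * h1) i"
        by (simp add: coeff_map_poly h1)
    qed
    have "map_poly (ext v) [:q, p, a, 1:] dvd
        map_poly (ext v) (h ^ n + (\<Sum>k<n. g k * h ^ k * [:d:] ^ (n - k)))"
      by (rule EE.hom_dvd[OF rel])
    moreover have "map_poly (ext v) [:q, p, a, 1:] = ?c"
      by (simp add: E.map_poly_pCons_hom)
    moreover have "map_poly (ext v) [:d:] = [:ext v d:]" by (simp add: E.map_poly_pCons_hom)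
    ultimately have "?c dvd map_poly (ext v) h ^ n
        + (\<Sum>k<n. map_poly (ext v) (g k) * map_poly (ext v) h ^ k * [:ext v d:] ^ (n - k))"
      by (simp only: EE.hom_add EE.hom_sum EE.hom_mult EE.hom_power)
    from power_sum_change_denominator[OF _ _ eq this]
    have "?c dvd h1 ^ n + (\<Sum>k<n. map_poly (ext v) (g k) * h1 ^ k * [:[:-\<beta>, 1:] * d2:] ^ (n - k))"
      using dF by (simp add: d2 ext_F del: mult_pCons_left)
    moreover have "degree h1 \<le> 2" unfolding h1_def by (rule order_trans[OF degree_map_poly_le h(1)])
    moreover have "map_poly (\<lambda>r. poly r \<beta>) h1 \<noteq> 0"
    proof
      assume z: "map_poly (\<lambda>r. poly r \<beta>) h1 = 0"
      have "poly (poly.coeff h1 i) \<beta> = poly.coeff (map_poly (\<lambda>r. poly r \<beta>) h1) i" for i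
        by (simp add: coeff_map_poly)
      then have "poly (poly.coeff h1 i) \<beta> = 0" for i unfolding z by simp
      then show False using red[OF root] unfolding h1 by blast
    qed
    ultimately show ?thesis by (intro integral_sing_pt)
  qed
  have degs: "degree (ext v r) \<le> m" if "r \<in> forms UNIV m" for r m
    by (rule order_trans[OF degree_map_poly_le hpoly_degree[OF hpoly_shift[OF that]]])
  note unique = sing_pt_unique[OF degs[OF a] degs[OF p] degs[OF q] no_line[OF v(2)]]
  have "degree (map_poly to_ac d1) > 0" using d1 by simp
  then obtain \<beta> where \<beta>: "poly (map_poly to_ac d1) \<beta> = 0"
    using alg_closed_imp_poly_has_root by blast
  obtain \<alpha> where sp: "sing_pt (ext v a) (ext v p) (ext v q) \<alpha> \<beta>" using sing[OF \<beta>] by blast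
  \<comment> \<open>Each root of \<open>d1\<close> is the T-coordinate of a singular point, so by
    uniqueness \<open>d1\<close> has one root, which its coefficients then express.\<close>
  have "x = \<beta>" if "poly (map_poly to_ac d1) x = 0" for x
    using sing[OF that] unique sp by blast
  from single_root_coeff[OF \<open>degree (map_poly to_ac d1) > 0\<close> this]
  have "to_ac (poly.coeff d1 (degree d1 - 1)) = to_ac (- of_nat (degree d1) * lead_coeff d1) * \<beta>"
    by (simp add: coeff_map_poly)
  then have "to_ac (- of_nat (degree d1) * lead_coeff d1) * \<beta> + - to_ac (poly.coeff d1 (degree d1 - 1)) = 0"
    by simp
  moreover have "to_ac (- of_nat (degree d1) * lead_coeff d1) \<noteq> 0" using d1 by auto
  ultimately have "\<beta> = - (- to_ac (poly.coeff d1 (degree d1 - 1))) / to_ac (- of_nat (degree d1) * lead_coeff d1)"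
    by (rule solve_linear)
  then have "\<beta> = to_ac (poly.coeff d1 (degree d1 - 1) / (- of_nat (degree d1) * lead_coeff d1))"
    by (simp only: to_ac_divide minus_minus)
  then obtain b where b: "\<beta> = to_ac b" by blast
  then obtain e where e: "\<alpha> = to_ac e" using sing_pt_first_rational sp by blast
  have "to_ac (e ^ 3 + poly (?F a) b * e ^ 2 + poly (?F p) b * e + poly (?F q) b) = 0"
    "to_ac (3 * e ^ 2 + 2 * poly (?F a) b * e + poly (?F p) b) = 0"
    "to_ac (poly (map_poly to_fract (pderiv (shift v a))) b * e ^ 2
       + poly (map_poly to_fract (pderiv (shift v p))) b * e + poly (map_poly to_fract (pderiv (shift v q))) b) = 0"
    using sp unfolding b e sing_pt_def ext_eval_rational pderiv_ext_eval_rational by simp_all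
  then have eqs: "e ^ 3 + poly (?F a) b * e ^ 2 + poly (?F p) b * e + poly (?F q) b = 0"
    "3 * e ^ 2 + 2 * poly (?F a) b * e + poly (?F p) b = 0"
    "poly (map_poly to_fract (pderiv (shift v a))) b * e ^ 2
       + poly (map_poly to_fract (pderiv (shift v p))) b * e + poly (map_poly to_fract (pderiv (shift v q))) b = 0"
    by (simp_all only: to_ac_eq_0_iff)
  \<comment> \<open>The cubic at T = b has a double root, so b is a root of the discriminant along
    the line. This is homogeneous of degree 6 in T and the variables, and its coefficient of T^6 is
    the nonzero value at \<open>v\<close>; hence b is a linear form.\<close>
  have "poly (?F (cubic_disc a p q)) b = 0"
  proof -
    have "comm_ring_hom (\<lambda>r. poly (?F r) b)"
      by (rule comm_ring_hom_comp[OF comm_ring_hom_poly comm_ring_hom_comp[OF FF.comm_ring_hom_axioms comm_ring_hom_shift]])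
    from hom_cubic_disc[OF this] cubic_double_root(1)[OF eqs(1,2)] show ?thesis by simp
  qed
  then obtain \<beta>' where \<beta>': "\<beta>' \<in> forms UNIV 1" "b = to_fract \<beta>'"
    using hpoly_root_linear_form[OF hpoly_shift[OF forms_disc] coeff_shift_top[OF forms_disc] v(2)] by blast
  have pF: "poly (map_poly to_fract w) b = to_fract (poly w \<beta>')" for w unfolding \<beta>'(2) by (rule to_fract.poly_map_poly)
  \<comment> \<open>Once \<beta> is known to be a linear form, the cubic at T = \<beta> is monic in
    S and homogeneous of degree 3, which treats \<alpha> in the same way.\<close>
  let ?C = "[:poly (shift v q) \<beta>', poly (shift v p) \<beta>', poly (shift v a) \<beta>', 1:]"
  have C: "?C \<in> hpoly UNIV 3"
    using poly_hpoly[OF hpoly_shift[OF a] \<beta>'(1), of v] poly_hpoly[OF hpoly_shift[OF p] \<beta>'(1), of v]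
      poly_hpoly[OF hpoly_shift[OF q] \<beta>'(1), of v]
    by (auto simp: hpoly_def coeff_pCons numeral_2_eq_2 numeral_3_eq_3 split: nat.splits)
  have "poly.coeff ?C 3 = const 1" by (simp add: numeral_3_eq_3)
  moreover have "poly (map_poly to_fract ?C) e = 0"
  proof -
    have "map_poly to_fract ?C = [:to_fract (poly (shift v q) \<beta>'), to_fract (poly (shift v p) \<beta>'), to_fract (poly (shift v a) \<beta>'), 1:]"
      by (simp add: to_fract.map_poly_pCons_hom)
    then show ?thesis using eqs(1) unfolding pF by (simp only: poly_cubic)
  qed
  ultimately obtain \<alpha>' where \<alpha>': "\<alpha>' \<in> forms UNIV 1" "e = to_fract \<alpha>'"
    using hpoly_root_linear_form[OF C _ one_neq_zero] by blast
  have n23: "(3 :: 'k mpoly fract) = to_fract 3" "(2 :: 'k mpoly fract) = to_fract 2"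
    by (simp_all add: to_fract.hom_numeral)
  from eqs have "to_fract (\<alpha>' ^ 3 + poly (shift v a) \<beta>' * \<alpha>' ^ 2 + poly (shift v p) \<beta>' * \<alpha>' + poly (shift v q) \<beta>') = 0"
    "to_fract (3 * \<alpha>' ^ 2 + 2 * poly (shift v a) \<beta>' * \<alpha>' + poly (shift v p) \<beta>') = 0"
    "to_fract (poly (pderiv (shift v a)) \<beta>' * \<alpha>' ^ 2 + poly (pderiv (shift v p)) \<beta>' * \<alpha>' + poly (pderiv (shift v q)) \<beta>') = 0"
    unfolding pF \<alpha>'(2) n23 by (simp_all only: to_fract.hom_add to_fract.hom_mult to_fract.hom_power)
  then show ?thesis
    using that[OF v(2) \<alpha>'(1) \<beta>'(1)] by (simp only: to_fract_eq_0_iff)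
qed

end

section \<open>Common denominators, derivatives along a line, cubics without roots\<close>

lemma common_denominator:
  fixes w :: "'a::idom fract poly"
  obtains c w' where "c \<noteq> 0" "smult (to_fract c) w = map_poly to_fract w'"
proof -
  have "\<exists>c w'. c \<noteq> 0 \<and> smult (to_fract c) w = map_poly to_fract w'"
  proof (induction w)
    case 0
    show ?case by (intro exI[of _ 1] exI[of _ 0]) simp
  next
    case (pCons x w)
    then obtain c w' where IH: "c \<noteq> 0" "smult (to_fract c) w = map_poly to_fract w'" by blast
    obtain u t where ut: "x = to_fract u / to_fract t" "t \<noteq> 0"
      by (cases x) (simp add: Fract_conv_to_fract)
    have "smult (to_fract (t * c)) (pCons x w) = map_poly to_fract (pCons (c * u) (smult t w'))"
    proof -
      have "smult (to_fract (t * c)) w = smult (to_fract t) (map_poly to_fract w')"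
        by (simp flip: IH(2))
      also have "\<dots> = map_poly to_fract (smult t w')" by (simp add: to_fract.map_poly_hom_smult)
      finally show ?thesis using ut by (simp add: to_fract.map_poly_pCons_hom to_fract.map_poly_hom_smult)
    qed
    then show ?case using ut(2) IH(1) by (metis mult_eq_0_iff)
  qed
  then show ?thesis using that by blast
qed

lemma pderiv_shift:
  fixes p :: "'k::{idom} mpoly"
  assumes "finite V" "p \<in> polys V"
  shows "pderiv (shift v p) = (\<Sum>i\<in>V. smult (const (v i)) (shift v (pdiff i p)))"
  using assms(2)
proof (induction p rule: polys_induct)
  case (const c)
  then show ?case by simp
next
  case (xvar i)
  have "(\<Sum>k\<in>V. smult (const (v k)) (shift v (pdiff k (xvar i)))) = (\<Sum>k\<in>V. if k = i then [:const (v k):] else 0)"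
    by (rule sum.cong) (simp_all add: pdiff_xvar)
  then show ?case using xvar assms(1) by (simp add: shift_xvar pderiv_pCons)
next
  case (add p q)
  then show ?case by (simp add: pdiff_add shift.hom_add pderiv_add smult_add_right sum.distrib)
next
  case (mult p q)
  have "pderiv (shift v (p * q)) =
      shift v p * (\<Sum>i\<in>V. smult (const (v i)) (shift v (pdiff i q)))
      + shift v q * (\<Sum>i\<in>V. smult (const (v i)) (shift v (pdiff i p)))"
    by (simp add: shift.hom_mult pderiv_mult mult)
  also have "\<dots> = (\<Sum>i\<in>V. smult (const (v i)) (shift v (pdiff i (p * q))))"
    by (simp add: pdiff_mult shift.hom_add shift.hom_mult sum_distrib_left smult_add_right sum.distrib[symmetric] algebra_simps)
  finally show ?case .
qed

lemma pdiff_coeff_shift: "pdiff j (poly.coeff (shift v p) k) = poly.coeff (shift v (pdiff j p)) k"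
proof -
  have "p \<in> polys UNIV" by simp
  then show ?thesis
  proof (induction p arbitrary: k rule: polys_induct)
    case (const c)
    then show ?case by (simp add: coeff_pCons split: nat.splits)
  next
    case (xvar i)
    then show ?case
      by (auto simp: shift_xvar pdiff_xvar coeff_pCons one_pCons split: nat.splits)
  next
    case (add p q)
    then show ?case by (simp add: shift.hom_add pdiff_add)
  next
    case (mult p q)
    then show ?case
      by (simp add: shift.hom_mult shift.hom_add pdiff_mult coeff_mult pdiff_sum sum.distrib)
  qed
qed

lemma mono_eval_scale: "mono_eval (\<lambda>i. s * \<tau> i) m = s ^ mdeg m * mono_eval \<tau> m"
  unfolding mono_eval_def mdeg_def by (simp add: power_mult_distrib prod.distrib power_sum)

lemma meval_scale_forms:
  assumes "p \<in> forms V d"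
  shows "meval \<phi> (\<lambda>i. s * \<tau> i) p = s ^ d * meval \<phi> \<tau> p"
  unfolding meval_def sum_distrib_left
  by (rule sum.cong) (use assms in \<open>simp_all add: mono_eval_scale forms_iff\<close>)

lemma degree_1_root:
  fixes w :: "'a::field poly"
  assumes "degree w = 1"
  obtains x where "poly w x = 0"
proof -
  have w: "w = [:poly.coeff w 0, poly.coeff w 1:]" using assms by (intro poly_eq_pCons_2) simp
  have "poly.coeff w 1 \<noteq> 0" using assms by (metis leading_coeff_0_iff degree_0 zero_neq_one)
  then have "poly w (- poly.coeff w 0 / poly.coeff w 1) = 0" by (subst w) simp
  then show ?thesis using that by blast
qed

text \<open>In a factorisation of a cubic with both factors nonconstant, one factor is linear and
  has a root. So the cofactor of \<open>\<mu>\<close> is constant.\<close>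

lemma dvd_rootfree_cubic:
  fixes F :: "'a::field poly"
  assumes "degree F = 3" "\<And>x. poly F x \<noteq> 0" "\<mu> dvd F" "degree \<mu> > 0"
  shows "F dvd \<mu>"
proof -
  obtain w where w: "F = \<mu> * w" using assms(3) by (rule dvdE)
  then have nz: "\<mu> \<noteq> 0" "w \<noteq> 0" using assms(1) by auto
  have d: "degree \<mu> + degree w = 3" using assms(1) unfolding w by (simp add: degree_mult_eq nz)
  have "degree \<mu> \<noteq> 1" "degree w \<noteq> 1"
    using assms(2) degree_1_root[of \<mu>] degree_1_root[of w] unfolding w by (metis mult_eq_0_iff poly_mult)+
  then have "degree w = 0" using d assms(4) by linarith
  then obtain c where "w = [:c:]" by (metis degree_eq_zeroE)
  then show ?thesis using w nz by (simp add: smult_dvd_iff)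
qed

section \<open>Integral elements over an irreducible cubic\<close>

locale irreducible_cubic =
  fixes N :: nat and f :: "'k::{alg_closed_field, field_char_0} mpoly" and e :: "nat \<Rightarrow> 'k"
  assumes f: "f \<in> forms {..N} 3" and irr: "irreducible f" and e: "meval (\<lambda>c. c) e f = 1"
begin

definition "a = poly.coeff (shift e f) 2"
definition "p = poly.coeff (shift e f) 1"
definition "q = poly.coeff (shift e f) 0"

lemma f_UNIV: "f \<in> forms UNIV 3"
  using f forms_mono[of "{..N}" UNIV] by blast

lemma f_nz: "f \<noteq> 0"
  using irr by auto

lemma shift_f: "shift e f = [:q, p, a, 1:]"
proof -
  have "degree (shift e f) \<le> 3" by (rule hpoly_degree[OF hpoly_shift[OF f]])
  from poly_eq_pCons_4[OF this] show ?thesis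
    unfolding a_def p_def q_def coeff_shift_top[OF f] e by simp
qed

text \<open>A root would be a linear form r' with S - r' dividing f(x + S e). At S = 0 the factor
  -r' splits off from the irreducible cubic \<open>f\<close>, which degrees forbid.\<close>

lemma noroot_F: "poly (map_poly to_fract (shift e f)) r \<noteq> 0"
proof
  assume "poly (map_poly to_fract (shift e f)) r = 0"
  moreover have "poly.coeff (shift e f) 3 = const 1" by (simp add: coeff_shift_top[OF f] e)
  ultimately obtain r' where r': "r' \<in> forms UNIV 1" "r = to_fract r'"
    using hpoly_root_linear_form[OF hpoly_shift[OF f_UNIV] _ one_neq_zero] by blast
  then have "to_fract (poly (shift e f) r') = 0"
    using \<open>poly (map_poly to_fract (shift e f)) r = 0\<close> by (simp only: to_fract.poly_map_poly)
  then have "poly (shift e f) r' = 0" by (simp only: to_fract_eq_0_iff)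
  then obtain k where "shift e f = [:-r', 1:] * k" by (rule root_factor)
  then have "poly (shift e f) 0 = poly [:-r', 1:] 0 * poly k 0" by (simp only: poly_mult)
  then have fk: "f = - r' * poly k 0" by simp
  have r'f: "- r' \<in> forms UNIV 1" by (rule forms_uminus[OF r'(1)])
  from Factorial_Ring.irreducibleD[OF irr fk] show False
  proof
    assume "- r' dvd 1"
    then show False using forms_not_unit[OF r'f] by simp
  next
    assume k: "poly k 0 dvd 1"
    then have "hscale (poly k 0) dvd 1" using hscale.hom_dvd by fastforce
    then have dk: "degree (hscale (poly k 0)) = 0" by (metis poly_dvd_1)
    have nz: "- r' \<noteq> 0" "poly k 0 \<noteq> 0" using fk f_nz by auto
    have "degree (hscale f) = degree (hscale (- r')) + degree (hscale (poly k 0))"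
      by (subst fk, subst hscale.hom_mult, rule degree_mult_eq) (use nz in \<open>simp_all only: hscale_eq_0_iff not_False_eq_True\<close>)
    moreover have "degree (hscale f) = 3" unfolding hscale_forms[OF f] using f_nz by (simp add: degree_monom_eq)
    moreover have "degree (hscale (- r')) \<le> 1" unfolding hscale_forms[OF r'f] by (rule degree_monom_le)
    ultimately show False using dk by simp
  qed
qed

sublocale cubic_extension a p q
proof
  have h: "shift e f \<in> hpoly UNIV 3" by (rule hpoly_shift[OF f_UNIV])
  show "a \<in> forms UNIV 1" "p \<in> forms UNIV 2" "q \<in> forms UNIV 3"
    using hpoly_coeff[OF h, of 2] hpoly_coeff[OF h, of 1] hpoly_coeff[OF h, of 0] by (simp_all add: a_def p_def q_def numeral_2_eq_2)
  show "r ^ 3 + to_fract a * r ^ 2 + to_fract p * r + to_fract q \<noteq> 0" for r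
  proof -
    have "map_poly to_fract (shift e f) = [:to_fract q, to_fract p, to_fract a, 1:]"
      by (simp add: shift_f to_fract.map_poly_pCons_hom)
    then show ?thesis using noroot_F[of r] by (simp only: poly_cubic not_False_eq_True)
  qed
qed

abbreviation "F \<equiv> map_poly to_fract (shift e f)"

lemma degree_F: "degree F = 3"
  by (simp add: shift_f)

lemma F_nz: "F \<noteq> 0"
proof
  assume "F = 0"
  then have "degree F = degree (0 :: 'k mpoly fract poly)" by (rule arg_cong)
  then show False unfolding degree_F by simp
qed

lemma lead_shift_f: "lead_coeff (shift e f) = 1"
  by (simp add: shift_f)

lemma F_dvd_descend:
  assumes "F dvd map_poly to_fract w"
  shows "shift e f dvd w"
  by (rule monic_dvd_descend[OF to_fract.inj_idom_hom_axioms _ assms]) (simp only: lead_shift_f dvd_refl)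

text \<open>With this root, x + \<open>rho\<close> e is a generic point of the affine cone f = 0.
  Adjoining \<open>rho\<close> to the fraction field of the polynomial ring gives a field in which
  quotients of elements of the coordinate ring can be formed.\<close>

definition rho :: "'k mpoly fract alg_closure" where
  "rho = (SOME x. poly (map_poly to_clos (shift e f)) x = 0)"

lemma rho: "poly (map_poly to_clos (shift e f)) rho = 0"
proof -
  have "degree (map_poly to_clos (shift e f)) = 3" by (simp add: shift_f)
  then have "\<exists>x. poly (map_poly to_clos (shift e f)) x = 0"
    by (intro alg_closed_imp_poly_has_root) simp
  then show ?thesis unfolding rho_def by (rule someI_ex)
qed

definition at_rho :: "'k mpoly poly \<Rightarrow> 'k mpoly fract alg_closure" where
  "at_rho w = poly (map_poly to_clos w) rho"

lemma comm_ring_hom_to_clos: "comm_ring_hom (to_clos :: 'k mpoly \<Rightarrow> _)"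
  by unfold_locales simp_all

lemma comm_ring_hom_at_rho: "comm_ring_hom at_rho"
  unfolding at_rho_def
  by (rule comm_ring_hom_comp[OF comm_ring_hom_poly comm_ring_hom_map_poly[OF comm_ring_hom_to_clos]])

sublocale at_rho: comm_ring_hom at_rho
  by (rule comm_ring_hom_at_rho)

lemma at_rho_fract: "at_rho w = poly (map_poly to_ac (map_poly to_fract w)) rho"
  by (simp add: at_rho_def map_poly_map_poly o_def)

lemma at_rho_const: "at_rho [:c:] = to_clos c"
proof -
  interpret t: comm_ring_hom "to_clos :: 'k mpoly \<Rightarrow> _" by (rule comm_ring_hom_to_clos)
  show ?thesis by (simp add: at_rho_def t.map_poly_pCons_hom)
qed

lemma Frho: "poly (map_poly to_ac F) rho = 0"
  unfolding at_rho_fract[symmetric] by (simp only: at_rho_def rho)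

text \<open>Having no root, \<open>F\<close> divides each of its nonconstant factors, in particular
  the minimal polynomial of \<open>rho\<close>.\<close>

lemma fract_vanish:
  assumes "poly (map_poly to_ac w) rho = 0"
  shows "F dvd w"
proof (rule minimal_annihilator[OF F_nz Frho])
  fix \<mu> assume \<mu>: "degree \<mu> > 0" "\<And>y. poly (map_poly to_ac y) rho = 0 \<Longrightarrow> \<mu> dvd y"
  have "F dvd \<mu>"
    by (rule dvd_rootfree_cubic[OF degree_F noroot_F \<mu>(2)[OF Frho] \<mu>(1)])
  then show "F dvd w" using \<mu>(2)[OF assms] by (rule dvd_trans)
qed

lemma at_rho_eq_0_iff: "at_rho w = 0 \<longleftrightarrow> shift e f dvd w"
proof
  assume "at_rho w = 0"
  then show "shift e f dvd w" unfolding at_rho_fract by (intro F_dvd_descend fract_vanish)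
next
  assume "shift e f dvd w"
  then obtain u where "w = shift e f * u" ..
  then show "at_rho w = 0" by (simp only: at_rho.hom_mult) (simp only: at_rho_def rho mult_zero_left)
qed

text \<open>The value at the generic point x + \<open>rho\<close> e of the cone. Its kernel is (f),
  so its image is a copy of K[x]/(f) inside a field.\<close>

definition ev :: "'k mpoly \<Rightarrow> 'k mpoly fract alg_closure" where
  "ev r = at_rho (shift e r)"

sublocale ev: comm_ring_hom ev
  unfolding ev_def by (rule comm_ring_hom_comp[OF comm_ring_hom_at_rho comm_ring_hom_shift])

lemma ev_eq_0_iff: "ev r = 0 \<longleftrightarrow> f dvd r"
proof
  assume "ev r = 0"
  then have "shift e f dvd shift e r" by (simp add: ev_def at_rho_eq_0_iff)
  then obtain u where "shift e r = shift e f * u" ..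
  then have "poly (shift e r) 0 = poly (shift e f) 0 * poly u 0" by (simp only: poly_mult)
  then show "f dvd r" by simp
next
  assume "f dvd r"
  then show "ev r = 0" unfolding ev_def at_rho_eq_0_iff by (rule shift.hom_dvd)
qed

text \<open>Bezout: a nonzero combination of \<open>x\<close> and \<open>F\<close> of least degree
  divides both. Were it nonconstant, the rootfree \<open>F\<close> would divide it and hence
  \<open>x\<close>, against the hypothesis.\<close>

lemma fract_inverse:
  assumes "poly (map_poly to_ac x) rho \<noteq> 0"
  obtains w where "poly (map_poly to_ac w) rho * poly (map_poly to_ac x) rho = 1"
proof -
  interpret AA: map_poly_inj_idom_hom "to_ac :: 'k mpoly fract \<Rightarrow> _" ..
  let ?S = "\<lambda>w. w \<noteq> 0 \<and> (\<exists>s t. w = s * x + t * F)"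
  have "?S F" using F_nz by (auto intro: exI[of _ 0] exI[of _ 1])
  then obtain \<mu> where \<mu>: "?S \<mu>" and least: "\<And>y. ?S y \<Longrightarrow> degree \<mu> \<le> degree y"
    using ex_has_least_nat[of ?S F degree] by blast
  then obtain s t where st: "\<mu> = s * x + t * F" by blast
  have dvd: "\<mu> dvd y" if y: "y = s' * x + t' * F" for y s' t'
  proof -
    define k where "k = y div \<mu>"
    have "y mod \<mu> = y - k * \<mu>" by (simp add: minus_div_mult_eq_mod k_def)
    also have "\<dots> = (s' * x + t' * F) - k * (s * x + t * F)" unfolding y st ..
    also have "\<dots> = (s' - k * s) * x + (t' - k * t) * F" by (simp only: algebra_simps)
    finally have "y mod \<mu> = 0 \<or> ?S (y mod \<mu>)" by blast
    then show ?thesis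
      using least[of "y mod \<mu>"] degree_mod_less'[of \<mu> y] \<mu> by (metis leD mod_eq_0_iff_dvd)
  qed
  have "\<mu> dvd x" using dvd[of x 1 0] by simp
  moreover have "\<mu> dvd F" using dvd[of F 0 1] by simp
  moreover have "\<not> F dvd x"
  proof
    assume "F dvd x"
    then obtain u where "x = F * u" ..
    then show False using assms by (simp only: AA.hom_mult poly_mult Frho mult_zero_left simp_thms)
  qed
  ultimately have "\<not> degree \<mu> > 0"
    using dvd_rootfree_cubic[OF degree_F noroot_F] dvd_trans by blast
  then obtain c where c: "\<mu> = [:c:]" by (metis degree_eq_zeroE gr0I)
  then have c0: "c \<noteq> 0" using \<mu> by auto
  have "poly (map_poly to_ac \<mu>) rho = poly (map_poly to_ac s) rho * poly (map_poly to_ac x) rho"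
    unfolding st by (simp only: AA.hom_mult AA.hom_add poly_mult poly_add Frho mult_zero_right add_0_right)
  then have eq: "poly (map_poly to_ac s) rho * poly (map_poly to_ac x) rho = to_ac c"
    unfolding c by (simp add: to_ac.map_poly_pCons_hom)
  have "poly (map_poly to_ac (smult (inverse c) s)) rho = to_ac (inverse c) * poly (map_poly to_ac s) rho"
    by (simp add: to_ac.map_poly_hom_smult)
  then have "poly (map_poly to_ac (smult (inverse c) s)) rho * poly (map_poly to_ac x) rho = to_ac (inverse c) * to_ac c"
    by (simp only: mult.assoc eq)
  also have "\<dots> = 1" using c0 by simp
  finally show ?thesis using that by blast
qed

text \<open>An element of the fraction field of \<open>K[x]/(f)\<close> in the form \<open>h(\<rho>) / d\<close> with \<open>d\<close> free of \<open>\<rho>\<close>;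
  here \<open>x\<^sub>i\<close> acts as \<open>x\<^sub>i + e\<^sub>i \<rho>\<close>.\<close>

lemma not_integrally_closed:
  assumes B: "ev B \<noteq> 0"
    and rel: "(ev A / ev B) ^ n + (\<Sum>k<n. ev (g k) * (ev A / ev B) ^ k) = 0"
    and notin: "\<And>r. ev A / ev B \<noteq> ev r"
  obtains d h where "d \<noteq> 0" "degree h \<le> 2" "\<not> [:d:] dvd h"
    "[:q, p, a, 1:] dvd h ^ n + (\<Sum>k<n. shift e (g k) * h ^ k * [:d:] ^ (n - k))"
proof -
  let ?y = "ev A / ev B"
  obtain w where w: "poly (map_poly to_ac w) rho * ev B = 1"
    using fract_inverse[of "map_poly to_fract (shift e B)"] B by (auto simp: ev_def at_rho_fract)
  obtain d w' where d: "d \<noteq> 0" and w': "smult (to_fract d) w = map_poly to_fract w'"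
    by (rule common_denominator)
  have "at_rho w' = to_clos d * poly (map_poly to_ac w) rho"
    unfolding at_rho_fract w'[symmetric] by (simp add: to_ac.map_poly_hom_smult)
  then have w'B: "at_rho w' * ev B = to_clos d" using w by (simp add: mult.assoc)
  have d': "to_clos d \<noteq> 0" using d by simp
  \<comment> \<open>Division by the monic \<open>shift e f\<close> brings the numerator to degree at
    most 2 in S without changing its value at \<open>rho\<close>.\<close>
  obtain u h where uh: "pseudo_divmod (shift e A * w') (shift e f) = (u, h)" by fastforce
  have f0: "shift e f \<noteq> 0" by (simp add: shift_f)
  have H: "shift e A * w' = shift e f * u + h" and hd: "h = 0 \<or> degree h < 3"
    using pseudo_divmod[OF f0 uh] lead_shift_f by (auto simp: shift_f)
  have "at_rho h = at_rho (shift e A * w')"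
    unfolding H at_rho.hom_add at_rho.hom_mult using at_rho_eq_0_iff[of "shift e f"] by simp
  then have "at_rho h = ev A * at_rho w'" by (simp add: at_rho.hom_mult ev_def)
  then have hy: "at_rho h = to_clos d * ?y" using w'B B by (simp add: field_simps)
  \<comment> \<open>If \<open>d\<close> cancelled, \<open>?y\<close> would be the value at
    \<open>rho\<close> of a polynomial h' in S. Setting S = 0 in the resulting congruence modulo
    \<open>shift e f\<close> shows that \<open>?y\<close> is \<open>ev\<close> of the polynomial
    h'(0).\<close>
  have ndvd: "\<not> [:d:] dvd h"
  proof
    assume "[:d:] dvd h"
    then obtain h' where h': "h = [:d:] * h'" by (rule dvdE)
    have "to_clos d * ?y = to_clos d * at_rho h'"
      unfolding hy[symmetric] h' at_rho.hom_mult at_rho_const ..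
    then have "?y = at_rho h'" by (simp only: mult_left_cancel[OF d'])
    then have "at_rho (shift e A - shift e B * h') = 0"
      using B by (simp add: at_rho.hom_minus at_rho.hom_mult ev_def field_simps)
    then have "shift e f dvd shift e A - shift e B * h'" by (simp add: at_rho_eq_0_iff)
    then obtain z where "shift e A - shift e B * h' = shift e f * z" by (rule dvdE)
    then have "poly (shift e A - shift e B * h') 0 = poly (shift e f * z) 0" by (rule arg_cong)
    then have "A - B * poly h' 0 = f * poly z 0" by simp
    then have "ev (A - B * poly h' 0) = 0" by (simp add: ev_eq_0_iff)
    then have "?y = ev (poly h' 0)" using B by (simp add: ev.hom_minus ev.hom_mult field_simps)
    then show False using notin by blast
  qed
  have "at_rho (h ^ n + (\<Sum>k<n. shift e (g k) * h ^ k * [:d:] ^ (n - k))) = 0"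
  proof -
    have "at_rho (h ^ n + (\<Sum>k<n. shift e (g k) * h ^ k * [:d:] ^ (n - k)))
        = (to_clos d * ?y) ^ n + (\<Sum>k<n. ev (g k) * (to_clos d * ?y) ^ k * to_clos d ^ (n - k))"
      by (simp only: at_rho.hom_add at_rho.hom_sum at_rho.hom_mult at_rho.hom_power hy at_rho_const ev_def)
    also have "\<dots> = 0" unfolding power_sum_scale rel by simp
    finally show ?thesis .
  qed
  then have "[:q, p, a, 1:] dvd h ^ n + (\<Sum>k<n. shift e (g k) * h ^ k * [:d:] ^ (n - k))"
    unfolding at_rho_eq_0_iff shift_f .
  moreover have "degree h \<le> 2" using hd by auto
  ultimately show ?thesis using that[OF d _ ndvd] by blast
qed

text \<open>The family of singular points of the plane sections yields f(w) = 0 at w = x + \<beta> v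
  + \<alpha> e, and vanishing derivatives of \<open>f\<close> at w in the directions e and v only.
  Differentiating the identity f(w(x)) = 0 by x_j gives the rest: the contributions of the
  derivatives of \<alpha> and \<beta> are multiples of those two directional derivatives, which
  leaves the j-th partial derivative at w.\<close>

lemma singular_points:
  assumes "ev B \<noteq> 0"
    "(ev A / ev B) ^ n + (\<Sum>k<n. ev (g k) * (ev A / ev B) ^ k) = 0"
    "\<And>r. ev A / ev B \<noteq> ev r"
  obtains v \<alpha> \<beta> where "\<alpha> \<in> forms UNIV 1" "\<beta> \<in> forms UNIV 1"
    "\<And>s t. (\<And>i. i \<le> N \<Longrightarrow> s * e i + t * v i = 0) \<Longrightarrow> s = 0 \<and> t = 0"
    "meval const (\<lambda>i. xvar i + \<beta> * const (v i) + \<alpha> * const (e i)) f = 0"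
    "\<And>j. j \<le> N \<Longrightarrow> meval const (\<lambda>i. xvar i + \<beta> * const (v i) + \<alpha> * const (e i)) (pdiff j f) = 0"
proof -
  obtain d h where dh: "d \<noteq> 0" "degree h \<le> 2" "\<not> [:d:] dvd h"
    "[:q, p, a, 1:] dvd h ^ n + (\<Sum>k<n. shift e (g k) * h ^ k * [:d:] ^ (n - k))"
    using not_integrally_closed[OF assms] by blast
  obtain v \<alpha> \<beta> where v: "meval (\<lambda>c. c) v (cubic_disc a p q) \<noteq> 0"
    and \<alpha>: "\<alpha> \<in> forms UNIV 1" and \<beta>: "\<beta> \<in> forms UNIV 1"
    and eq1: "\<alpha> ^ 3 + poly (shift v a) \<beta> * \<alpha> ^ 2 + poly (shift v p) \<beta> * \<alpha> + poly (shift v q) \<beta> = 0"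
    and eq2: "3 * \<alpha> ^ 2 + 2 * poly (shift v a) \<beta> * \<alpha> + poly (shift v p) \<beta> = 0"
    and eq3: "poly (pderiv (shift v a)) \<beta> * \<alpha> ^ 2 + poly (pderiv (shift v p)) \<beta> * \<alpha> + poly (pderiv (shift v q)) \<beta> = 0"
    using singular_family[OF dh] by blast
  let ?w = "\<lambda>i. xvar i + \<beta> * const (v i) + \<alpha> * const (e i)"
  \<comment> \<open>\<open>\<Theta>\<close> sets T = \<beta> after translation along v, and
    \<open>\<Phi>\<close> below then sets S = \<alpha>; together they substitute the point
    w.\<close>
  define \<Theta> where "\<Theta> = (\<lambda>r. poly (shift v r) \<beta>)"
  have \<Theta>_hom: "comm_ring_hom \<Theta>"
    unfolding \<Theta>_def by (rule comm_ring_hom_comp[OF comm_ring_hom_poly comm_ring_hom_shift])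
  interpret \<Theta>: comm_ring_hom \<Theta> by (fact \<Theta>_hom)
  interpret \<Theta>': idom_hom \<Theta> ..
  define \<Phi> where "\<Phi> = (\<lambda>w. poly (map_poly \<Theta> w) \<alpha>)"
  have \<Phi>_hom: "comm_ring_hom \<Phi>"
    unfolding \<Phi>_def by (rule comm_ring_hom_comp[OF comm_ring_hom_poly comm_ring_hom_map_poly[OF \<Theta>_hom]])
  interpret \<Phi>: comm_ring_hom \<Phi> by (fact \<Phi>_hom)
  have shift\<Phi>: "\<Phi> (shift e r) = meval const ?w r" for r
    unfolding shift_def hom_meval[OF \<Phi>_hom]
    by (rule meval_ext) (simp_all add: \<Phi>_def \<Theta>.map_poly_pCons_hom, simp_all add: \<Theta>_def shift_xvar)
  have fw: "meval const ?w f = 0"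
    using eq1 unfolding shift\<Phi>[symmetric] shift_f \<Phi>_def
    by (simp add: \<Theta>.map_poly_pCons_hom \<Theta>_def power2_eq_square power3_eq_cube algebra_simps)
  have finN: "finite {..N}" by simp
  have fpolys: "f \<in> polys {..N}" using f forms_subset_polys by blast
  have de: "(\<Sum>i\<le>N. const (e i) * meval const ?w (pdiff i f)) = 0"
  proof -
    have "(\<Sum>i\<le>N. const (e i) * meval const ?w (pdiff i f)) = \<Phi> (pderiv (shift e f))"
      unfolding pderiv_shift[OF finN fpolys] \<Phi>.hom_sum shift\<Phi>[symmetric]
      by (rule sum.cong) (simp_all add: \<Phi>_def \<Theta>.map_poly_hom_smult, simp_all add: \<Theta>_def)
    also have "\<dots> = 3 * \<alpha> ^ 2 + 2 * poly (shift v a) \<beta> * \<alpha> + poly (shift v p) \<beta>"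
      unfolding shift_f \<Phi>_def \<Theta>'.map_poly_pderiv
      by (simp add: \<Theta>.map_poly_pCons_hom \<Theta>_def pderiv_pCons power2_eq_square algebra_simps)
    finally show ?thesis using eq2 by simp
  qed
  have dv: "(\<Sum>i\<le>N. const (v i) * meval const ?w (pdiff i f)) = 0"
  proof -
    have pd: "poly (pderiv (shift v r)) \<beta> = (\<Sum>i\<le>N. const (v i) * \<Theta> (pdiff i r))" if "r \<in> polys {..N}" for r
      unfolding pderiv_shift[OF finN that] by (simp add: poly_sum \<Theta>_def)
    have co: "poly.coeff (shift e f) k \<in> polys {..N}" for k
    proof (cases "k \<le> 3")
      case True
      then show ?thesis using hpoly_coeff[OF hpoly_shift[OF f]] forms_subset_polys by blast
    next
      case False
      then show ?thesis using hpoly_degree[OF hpoly_shift[OF f], of e] by (simp add: coeff_eq_0)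
    qed
    have di: "meval const ?w (pdiff i f) = \<Theta> (pdiff i a) * \<alpha> ^ 2 + \<Theta> (pdiff i p) * \<alpha> + \<Theta> (pdiff i q)" for i
    proof -
      have "pdiff i 1 = (0 :: 'k mpoly)" using pdiff_const[of i "1::'k"] by simp
      then have "shift e (pdiff i f) = [:pdiff i q, pdiff i p, pdiff i a:]"
        by (intro poly_eqI)
          (auto simp: pdiff_coeff_shift[symmetric] shift_f coeff_pCons split: nat.splits)
      then show ?thesis unfolding shift\<Phi>[symmetric] \<Phi>_def
        by (simp add: \<Theta>.map_poly_pCons_hom power2_eq_square algebra_simps)
    qed
    have "(\<Sum>i\<le>N. const (v i) * meval const ?w (pdiff i f))
      = (\<Sum>i\<le>N. const (v i) * \<Theta> (pdiff i a)) * \<alpha> ^ 2 + (\<Sum>i\<le>N. const (v i) * \<Theta> (pdiff i p)) * \<alpha>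
        + (\<Sum>i\<le>N. const (v i) * \<Theta> (pdiff i q))"
      unfolding di by (simp add: sum.distrib sum_distrib_right distrib_left mult.assoc)
    also have "\<dots> = 0" using eq3 unfolding pd[OF co[of 2, folded a_def]] pd[OF co[of 1, folded p_def]] pd[OF co[of 0, folded q_def]] .
    finally show ?thesis .
  qed
  have dj: "meval const ?w (pdiff j f) = 0" if "j \<le> N" for j
  proof -
    have pw: "pdiff j (?w i) = (if i = j then 1 else 0) + pdiff j \<beta> * const (v i) + pdiff j \<alpha> * const (e i)" for i
      by (simp add: pdiff_add pdiff_mult pdiff_xvar)
    have "0 = pdiff j (meval const ?w f)" by (simp add: fw)
    also have "\<dots> = (\<Sum>i\<le>N. meval const ?w (pdiff i f) * pdiff j (?w i))"
      by (rule pdiff_meval[OF finN fpolys])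
    also have "\<dots> = (\<Sum>i\<le>N. if i = j then meval const ?w (pdiff i f) else 0)
        + pdiff j \<beta> * (\<Sum>i\<le>N. const (v i) * meval const ?w (pdiff i f))
        + pdiff j \<alpha> * (\<Sum>i\<le>N. const (e i) * meval const ?w (pdiff i f))"
      unfolding pw sum_distrib_left sum.distrib[symmetric]
      by (rule sum.cong) (simp_all add: algebra_simps)
    also have "\<dots> = meval const ?w (pdiff j f)"
      unfolding de dv using that by simp
    finally show ?thesis by simp
  qed
  have indep: "s = 0 \<and> t = 0" if st: "\<And>i. i \<le> N \<Longrightarrow> s * e i + t * v i = 0" for s t
  proof -
    have e0: "\<not> (\<forall>i\<le>N. e i = 0)"
    proof
      assume "\<forall>i\<le>N. e i = 0"
      then have "meval (\<lambda>c. c) e f = meval (\<lambda>c. c) (\<lambda>i. 0 * e i) f"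
        by (intro meval_cong[OF fpolys]) auto
      also have "\<dots> = 0" unfolding meval_scale_forms[OF f] by simp
      finally show False using e by simp
    qed
    \<comment> \<open>If v agrees with \<open>?l\<close> times e, then f(v + S e) is the cube of
      \<open>?l\<close> + S, since f(e) = 1. Its discriminant vanishes, against the choice of
      v.\<close>
    have "t = 0"
    proof (rule ccontr)
      assume t: "t \<noteq> 0"
      let ?l = "- s / t"
      have ve: "v i = ?l * e i" if "i \<le> N" for i
        using st[OF that] t by (simp add: field_simps add_eq_0_iff2)
      let ?m = "meval (\<lambda>c::'k. c) v"
      have m_hom: "comm_ring_hom ?m" by (rule comm_ring_hom_meval[OF comm_ring_hom_id])
      interpret m: comm_ring_hom ?m by (fact m_hom)
      interpret mm: map_poly_comm_ring_hom ?m ..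
      have "map_poly ?m (shift e f) = meval (\<lambda>c. [:c:]) (\<lambda>i. [:v i, e i:]) f"
        unfolding shift_def
        by (subst hom_meval[OF mm.comm_ring_hom_axioms], rule meval_ext)
          (auto simp: m.map_poly_pCons_hom meval_const[OF comm_ring_hom_id] meval_xvar[OF comm_ring_hom_id])
      also have "\<dots> = meval (\<lambda>c. [:c:]) (\<lambda>i. [:?l, 1:] * [:e i:]) f"
        by (rule meval_cong[OF fpolys]) (use ve in \<open>auto simp: mult.commute\<close>)
      also have "\<dots> = [:?l, 1:] ^ 3 * meval (\<lambda>c. [:c:]) (\<lambda>i. [:e i:]) f"
        by (rule meval_scale_forms[OF f])
      also have "meval (\<lambda>c. [:c:]) (\<lambda>i. [:e i:]) f = [:meval (\<lambda>c. c) e f:]"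
        by (rule hom_meval[OF comm_ring_hom_pCons, symmetric])
      also have "\<dots> = 1" by (simp add: e pCons_one)
      finally have "[:?m q, ?m p, ?m a, 1:] = [:?l, 1:] ^ 3"
        by (simp add: shift_f m.map_poly_pCons_hom)
      then have cub: "[:?m q, ?m p, ?m a, 1:] = [:?l ^ 3, 3 * ?l ^ 2, 3 * ?l, 1:]"
        by (simp add: power2_eq_square power3_eq_cube algebra_simps)
      have "cubic_disc (?m a) (?m p) (?m q) = 0"
        by (rule cubic_double_root(1)[of "- ?l"])
          (use cub in \<open>simp_all add: power2_eq_square power3_eq_cube algebra_simps\<close>)
      then show False using v by (simp add: hom_cubic_disc[OF m_hom])
    qed
    moreover from this have "s = 0" using st e0 by auto
    ultimately show ?thesis by simp
  qed
  show ?thesis using that[OF \<alpha> \<beta> indep fw dj] by blast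
qed

end

section \<open>Linear spaces and the normal form\<close>

text \<open>Adding zero rows makes the matrix square; a right inverse is then impossible, because
  the row of index \<open>k\<close> is zero.\<close>

lemma kernel_vec_exists:
  fixes A :: "'a::field mat"
  assumes A: "A \<in> carrier_mat k m" and "k < m"
  obtains v where "v \<in> carrier_vec m" "v \<noteq> 0\<^sub>v m" "A *\<^sub>v v = 0\<^sub>v k"
proof -
  define A' where "A' = mat m m (\<lambda>(i, j). if i < k then A $$ (i, j) else 0)"
  have A': "A' \<in> carrier_mat m m" by (simp add: A'_def)
  have "det A' = 0"
  proof (rule ccontr)
    assume "det A' \<noteq> 0"
    then obtain B where B: "B \<in> carrier_mat m m" "A' * B = 1\<^sub>m m"
      using det_non_zero_imp_unit[OF A'] by (auto simp: Units_def ring_mat_def)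
    have "(A' * B) $$ (k, k) = 0"
      using \<open>k < m\<close> B(1) by (simp add: A'_def scalar_prod_def)
    then show False using B \<open>k < m\<close> by simp
  qed
  then obtain v where v: "v \<in> carrier_vec m" "v \<noteq> 0\<^sub>v m" "A' *\<^sub>v v = 0\<^sub>v m"
    using det_0_iff_vec_prod_zero_field[OF A'] by blast
  have "A *\<^sub>v v = 0\<^sub>v k"
  proof (rule eq_vecI)
    fix i assume "i < dim_vec (0\<^sub>v k)"
    then have i: "i < k" by simp
    then have "(A' *\<^sub>v v) $ i = (A *\<^sub>v v) $ i"
      using \<open>k < m\<close> A v(1) by (simp add: A'_def scalar_prod_def)
    then show "(A *\<^sub>v v) $ i = 0\<^sub>v k $ i" using v(3) i \<open>k < m\<close> by simp
  qed (use A in simp)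
  with v show ?thesis using that by blast
qed

text \<open>Columns outside the image are added one at a time. While k < n such a column exists:
  otherwise \<open>B\<close> would have a right inverse \<open>C\<close> of shape k by n, and a
  nonzero kernel vector of \<open>C\<close> would be killed by the identity matrix.\<close>

lemma extend_to_invertible:
  fixes B :: "'a::field mat"
  assumes B: "B \<in> carrier_mat n k" and inj: "\<And>x. x \<in> carrier_vec k \<Longrightarrow> B *\<^sub>v x = 0\<^sub>v n \<Longrightarrow> x = 0\<^sub>v k"
  shows "k \<le> n \<and> (\<exists>M \<in> carrier_mat n n. det M \<noteq> 0 \<and> (\<forall>i<n. \<forall>j<k. M $$ (i, j) = B $$ (i, j)))"
proof -
  have kn: "k \<le> n" if B: "B \<in> carrier_mat n k" and inj: "\<And>x. x \<in> carrier_vec k \<Longrightarrow> B *\<^sub>v x = 0\<^sub>v n \<Longrightarrow> x = 0\<^sub>v k"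
    for k and B :: "'a mat"
  proof (rule ccontr)
    assume "\<not> k \<le> n"
    then show False using kernel_vec_exists[OF B] inj by (metis not_le)
  qed
  have ex: "\<exists>M \<in> carrier_mat n n. det M \<noteq> 0 \<and> (\<forall>i<n. \<forall>j<k. M $$ (i, j) = B $$ (i, j))"
    if "d = n - k" and B: "B \<in> carrier_mat n k" and inj: "\<And>x. x \<in> carrier_vec k \<Longrightarrow> B *\<^sub>v x = 0\<^sub>v n \<Longrightarrow> x = 0\<^sub>v k"
    for d k and B :: "'a mat"
    using that
  proof (induction d arbitrary: k B)
    case 0
    then have "k = n" using kn by (metis diff_is_0_eq le_antisym)
    with 0 have Bn: "B \<in> carrier_mat n n" by simp
    have "det B \<noteq> 0" using det_0_iff_vec_prod_zero_field[OF Bn] 0(3) \<open>k = n\<close> by blast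
    then show ?case using Bn by blast
  next
    case (Suc d)
    then have kn: "k < n" by simp
    have "\<exists>u\<in>carrier_vec n. \<forall>c\<in>carrier_vec k. B *\<^sub>v c \<noteq> u"
    proof (rule ccontr)
      assume "\<not> ?thesis"
      then have "\<forall>j. \<exists>c. c \<in> carrier_vec k \<and> B *\<^sub>v c = unit_vec n j" by (metis unit_vec_carrier)
      then obtain c where c: "\<And>j. c j \<in> carrier_vec k" "\<And>j. B *\<^sub>v c j = unit_vec n j" by metis
      define C where "C = mat k n (\<lambda>(i, j). c j $ i)"
      have C: "C \<in> carrier_mat k n" by (simp add: C_def)
      have colC: "col C j = c j" if "j < n" for j using that c(1)[of j] by (intro eq_vecI) (auto simp: C_def)
      have BC: "B * C = 1\<^sub>m n"
      proof (rule eq_matI)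
        fix i j assume "i < dim_row (1\<^sub>m n)" "j < dim_col (1\<^sub>m n)"
        then have ij: "i < n" "j < n" by auto
        then have "(B * C) $$ (i, j) = (B *\<^sub>v c j) $ i" using Suc.prems(2) C by (simp add: colC)
        then show "(B * C) $$ (i, j) = 1\<^sub>m n $$ (i, j)" using ij by (auto simp: c(2) unit_vec_def)
      qed (use Suc.prems(2) C in auto)
      obtain v where v: "v \<in> carrier_vec n" "v \<noteq> 0\<^sub>v n" "C *\<^sub>v v = 0\<^sub>v k"
        by (rule kernel_vec_exists[OF C kn])
      have "v = (B * C) *\<^sub>v v" using v(1) by (simp add: BC)
      also have "\<dots> = B *\<^sub>v (C *\<^sub>v v)" by (rule assoc_mult_mat_vec[OF Suc.prems(2) C v(1)])
      also have "\<dots> = 0\<^sub>v n" unfolding v(3) using Suc.prems(2) by (intro eq_vecI) (auto simp: scalar_prod_def)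
      finally show False using v(2) by simp
    qed
    then obtain u where u: "u \<in> carrier_vec n" "\<And>c. c \<in> carrier_vec k \<Longrightarrow> B *\<^sub>v c \<noteq> u" by blast
    define B1 where "B1 = mat n (Suc k) (\<lambda>(i, j). if j < k then B $$ (i, j) else u $ i)"
    have B1: "B1 \<in> carrier_mat n (Suc k)" by (simp add: B1_def)
    have inj1: "x = 0\<^sub>v (Suc k)" if x: "x \<in> carrier_vec (Suc k)" "B1 *\<^sub>v x = 0\<^sub>v n" for x
    proof -
      define y where "y = vec k (\<lambda>i. x $ i)"
      have y: "y \<in> carrier_vec k" by (simp add: y_def)
      have eq: "(B *\<^sub>v y) $ i + x $ k * u $ i = 0" if "i < n" for i
      proof -
        have "(B1 *\<^sub>v x) $ i = (\<Sum>j<Suc k. B1 $$ (i, j) * x $ j)"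
          using that x(1) B1 by (simp add: scalar_prod_def atLeast0LessThan)
        also have "\<dots> = (B *\<^sub>v y) $ i + x $ k * u $ i"
          using that Suc.prems(2) by (simp add: B1_def scalar_prod_def atLeast0LessThan y_def mult.commute)
        finally show ?thesis using x(2) that by simp
      qed
      have xk: "x $ k = 0"
      proof (rule ccontr)
        assume "x $ k \<noteq> 0"
        let ?c = "(- inverse (x $ k)) \<cdot>\<^sub>v y"
        have "B *\<^sub>v ?c = u"
        proof (rule eq_vecI)
          fix i assume "i < dim_vec u"
          then have i: "i < n" using u(1) by simp
          have "(B *\<^sub>v ?c) $ i = - inverse (x $ k) * (B *\<^sub>v y) $ i"
            using i Suc.prems(2) y by (simp add: mult_mat_vec[OF Suc.prems(2) y])
          also have "(B *\<^sub>v y) $ i = - (x $ k * u $ i)" using eq[OF i] by (rule eq_neg_iff_add_eq_0[THEN iffD2])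
          finally show "(B *\<^sub>v ?c) $ i = u $ i" using \<open>x $ k \<noteq> 0\<close> by simp
        qed (use Suc.prems(2) u(1) in auto)
        moreover have "?c \<in> carrier_vec k" using y by simp
        ultimately show False using u(2) by blast
      qed
      have "B *\<^sub>v y = 0\<^sub>v n" using eq xk Suc.prems(2) by (intro eq_vecI) auto
      then have "y = 0\<^sub>v k" by (rule Suc.prems(3)[OF y])
      then have "y $ i = 0" if "i < k" for i using that by simp
      then have "x $ i = 0" if "i < k" for i using that by (simp add: y_def)
      with xk show ?thesis using x(1) by (intro eq_vecI) (auto simp: less_Suc_eq)
    qed
    have "d = n - Suc k" using Suc.prems(1) by simp
    from Suc.IH[OF this B1 inj1] obtain M where
      M: "M \<in> carrier_mat n n" "det M \<noteq> 0" "\<forall>i<n. \<forall>j<Suc k. M $$ (i, j) = B1 $$ (i, j)" by blast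
    then have "\<forall>i<n. \<forall>j<k. M $$ (i, j) = B $$ (i, j)" by (simp add: B1_def)
    with M show ?case by blast
  qed
  from kn[OF B inj] ex[OF refl B inj] show ?thesis by blast
qed

definition pad_vec :: "nat \<Rightarrow> 'a::zero vec \<Rightarrow> 'a vec" where
  "pad_vec n c = vec n (\<lambda>i. if i < dim_vec c then c $ i else 0)"

lemma mult_pad_vec:
  fixes M :: "'a::comm_ring_1 mat"
  assumes M: "M \<in> carrier_mat n m" and B: "B \<in> carrier_mat n k" and c: "c \<in> carrier_vec k" and "k \<le> m"
    and eq: "\<forall>i<n. \<forall>j<k. M $$ (i, j) = B $$ (i, j)"
  shows "M *\<^sub>v pad_vec m c = B *\<^sub>v c"
proof (rule eq_vecI)
  fix i assume "i < dim_vec (B *\<^sub>v c)"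
  then have i: "i < n" using B by simp
  have "(M *\<^sub>v pad_vec m c) $ i = (\<Sum>j<m. M $$ (i, j) * (if j < k then c $ j else 0))"
    using i M c by (simp add: scalar_prod_def pad_vec_def atLeast0LessThan)
  also have "\<dots> = (\<Sum>j<k. M $$ (i, j) * c $ j)"
    by (rule sum.mono_neutral_cong_right) (use \<open>k \<le> m\<close> in auto)
  also have "\<dots> = (B *\<^sub>v c) $ i"
    using i B c eq by (simp add: scalar_prod_def atLeast0LessThan)
  finally show "(M *\<^sub>v pad_vec m c) $ i = (B *\<^sub>v c) $ i" .
qed (use M B in simp)

lemma coord_space_eq_pad_vec:
  assumes "t \<le> N"
  shows "coord_space N t = pad_vec (N + 1) ` (proj_space t :: 'a::field vec set)"
proof
  show "pad_vec (N + 1) ` proj_space t \<subseteq> (coord_space N t :: 'a vec set)"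
  proof
    fix y :: "'a vec" assume "y \<in> pad_vec (N + 1) ` proj_space t"
    then obtain c where c: "c \<in> carrier_vec (t + 1)" "c \<noteq> 0\<^sub>v (t + 1)" "y = pad_vec (N + 1) c"
      by (auto simp: proj_space_def)
    have "y \<noteq> 0\<^sub>v (N + 1)"
    proof
      assume y0: "y = 0\<^sub>v (N + 1)"
      have "c $ i = 0" if i: "i < t + 1" for i
      proof -
        have "y $ i = 0" unfolding y0 using i \<open>t \<le> N\<close> by simp
        moreover have "y $ i = c $ i" using c i \<open>t \<le> N\<close> by (simp add: pad_vec_def)
        ultimately show ?thesis by simp
      qed
      then have "c = 0\<^sub>v (t + 1)" using c(1) by (intro eq_vecI) auto
      with c(2) show False ..
    qed
    then show "y \<in> coord_space N t" using c by (auto simp: coord_space_def proj_space_def pad_vec_def)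
  qed
next
  show "(coord_space N t :: 'a vec set) \<subseteq> pad_vec (N + 1) ` proj_space t"
  proof
    fix y :: "'a vec" assume y: "y \<in> coord_space N t"
    define c where "c = vec (t + 1) (\<lambda>i. y $ i)"
    have yc: "y = pad_vec (N + 1) c"
      using y by (intro eq_vecI) (auto simp: coord_space_def proj_space_def pad_vec_def c_def)
    have "c \<noteq> 0\<^sub>v (t + 1)"
    proof
      assume "c = 0\<^sub>v (t + 1)"
      then have "y = 0\<^sub>v (N + 1)" unfolding yc by (auto simp: pad_vec_def)
      then show False using y by (simp add: coord_space_def proj_space_def)
    qed
    then have "c \<in> proj_space t" by (simp add: proj_space_def c_def)
    then show "y \<in> pad_vec (N + 1) ` proj_space t" unfolding yc by (rule imageI)
  qed
qed

lemma proj_transformation_det: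
  "proj_transformation N A \<longleftrightarrow> A \<in> carrier_mat (N + 1) (N + 1) \<and> det A \<noteq> 0"
proof -
  have "invertible_mat A \<longleftrightarrow> det A \<noteq> 0" if A: "A \<in> carrier_mat (N + 1) (N + 1)"
  proof
    assume "invertible_mat A"
    then obtain B where B: "A * B = 1\<^sub>m (N + 1)" "B * A = 1\<^sub>m (dim_row B)"
      using A by (auto simp: invertible_mat_def inverts_mat_def)
    have "dim_col B = N + 1" using arg_cong[OF B(1), of dim_col] by simp
    moreover have "dim_row B = N + 1" using arg_cong[OF B(2), of dim_col] A by simp
    ultimately have "B \<in> carrier_mat (N + 1) (N + 1)" by auto
    then have "det A * det B = 1" using det_mult[OF A] B(1) by (metis det_one)
    then show "det A \<noteq> 0" by auto
  next
    assume "det A \<noteq> 0"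
    then obtain B where "B \<in> carrier_mat (N + 1) (N + 1)" "A * B = 1\<^sub>m (N + 1)" "B * A = 1\<^sub>m (N + 1)"
      using det_non_zero_imp_unit[OF A] by (auto simp: Units_def ring_mat_def)
    then show "invertible_mat A"
      using A by (auto simp: invertible_mat_def inverts_mat_def)
  qed
  then show ?thesis by (auto simp: proj_transformation_def)
qed

lemma linear_space_eq_image_coord_space:
  assumes "linear_space N t S"
  shows "t \<le> N \<and> (\<exists>A. proj_transformation N A \<and> (*\<^sub>v) A ` coord_space N t = S)"
proof -
  obtain B where B: "B \<in> carrier_mat (N + 1) (t + 1)" and inj: "inj_on ((*\<^sub>v) B) (carrier_vec (t + 1))"
    and S: "S = (*\<^sub>v) B ` proj_space t"
    using assms unfolding linear_space_def by blast
  have B0: "B *\<^sub>v 0\<^sub>v (t + 1) = 0\<^sub>v (N + 1)" using B by (intro eq_vecI) (auto simp: scalar_prod_def)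
  have "x = 0\<^sub>v (t + 1)" if "x \<in> carrier_vec (t + 1)" "B *\<^sub>v x = 0\<^sub>v (N + 1)" for x
    using inj_onD[OF inj, of x "0\<^sub>v (t + 1)"] that B0 by simp
  from extend_to_invertible[OF B this] obtain M where le: "t + 1 \<le> N + 1"
    and M: "M \<in> carrier_mat (N + 1) (N + 1)" "det M \<noteq> 0" "\<forall>i<N + 1. \<forall>j<t + 1. M $$ (i, j) = B $$ (i, j)"
    by blast
  have tN: "t \<le> N" using le by simp
  have "M *\<^sub>v pad_vec (N + 1) c = B *\<^sub>v c" if "c \<in> proj_space t" for c
    using that by (intro mult_pad_vec[OF M(1) B _ le M(3)]) (simp add: proj_space_def)
  then have "(*\<^sub>v) M ` coord_space N t = S"
    unfolding coord_space_eq_pad_vec[OF tN] S image_image by (rule image_cong[OF refl])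
  then show ?thesis using tN M by (auto simp: proj_transformation_det)
qed

section \<open>Linear substitutions, and restriction to coordinate subspaces\<close>

lemma lin_subst_forms:
  assumes "A \<in> carrier_mat (N + 1) (N + 1)" "g \<in> forms U d"
  shows "lin_subst A g \<in> forms {..N} d"
  unfolding lin_subst_eq_meval
proof (rule meval_forms[OF assms(2)])
  fix i
  show "(\<Sum>j<dim_col A. const (A $$ (i, j)) * xvar j) \<in> forms {..N} 1"
    using assms(1) by (intro forms_sum forms_const_mult forms_xvar) auto
qed

lemma peval_cong:
  fixes v :: "'k::comm_ring_1 vec"
  assumes "g \<in> polys {..N}" "\<And>i. i \<le> N \<Longrightarrow> v $ i = \<sigma> i"
  shows "peval g v = meval (\<lambda>c. c) \<sigma> g"
  unfolding peval_eq_meval by (rule meval_cong[OF assms(1)]) (use assms(2) in auto)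

lemma peval_lin_subst:
  fixes v :: "'k::comm_ring_1 vec"
  assumes A: "A \<in> carrier_mat (N + 1) (N + 1)" and v: "v \<in> carrier_vec (N + 1)" and g: "g \<in> polys {..N}"
  shows "peval (lin_subst A g) v = peval g (A *\<^sub>v v)"
proof -
  let ?h = "meval (\<lambda>c. c) (\<lambda>i. v $ i)"
  have h: "comm_ring_hom ?h" by (rule comm_ring_hom_meval[OF comm_ring_hom_id])
  interpret h: comm_ring_hom ?h by (fact h)
  have "peval (lin_subst A g) v = meval (\<lambda>c. c) (\<lambda>i. \<Sum>j<dim_col A. A $$ (i, j) * v $ j) g"
    unfolding peval_eq_meval lin_subst_eq_meval
    by (subst hom_meval[OF h], rule meval_ext)
      (simp_all add: h.hom_sum h.hom_mult meval_const[OF comm_ring_hom_id] meval_xvar[OF comm_ring_hom_id])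
  also have "\<dots> = peval g (A *\<^sub>v v)"
    by (rule peval_cong[OF g, symmetric]) (use A v in \<open>auto simp: scalar_prod_def atLeast0LessThan\<close>)
  finally show ?thesis .
qed

lemma pdiff_lin_subst:
  assumes A: "A \<in> carrier_mat (N + 1) (N + 1)" and g: "g \<in> polys {..N}" and j: "j \<le> N"
  shows "pdiff j (lin_subst A g) = (\<Sum>i\<le>N. const (A $$ (i, j)) * lin_subst A (pdiff i g))"
proof -
  have "pdiff j (\<Sum>k<dim_col A. const (A $$ (i, k)) * xvar k) = const (A $$ (i, j))" for i
  proof -
    have "pdiff j (\<Sum>k<dim_col A. const (A $$ (i, k)) * xvar k) = (\<Sum>k<N + 1. if k = j then const (A $$ (i, k)) else 0)"
      using A unfolding pdiff_sum pdiff_const_mult by (intro sum.cong) (auto simp: pdiff_xvar)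
    then show ?thesis using j by simp
  qed
  then show ?thesis
    unfolding lin_subst_eq_meval by (subst pdiff_meval[OF finite_atMost g]) (simp add: mult.commute)
qed

text \<open>Setting the variables outside \<open>V\<close> to zero leaves exactly the monomials
  supported in \<open>V\<close>. Their sum \<open>r\<close> is nonzero because of \<open>m\<close>,
  so it has a point of nonvanishing.\<close>

lemma meval_nonzero_restricted:
  fixes h :: "'k::field_char_0 mpoly"
  assumes "Poly_Mapping.lookup h m \<noteq> 0" "Poly_Mapping.keys m \<subseteq> V"
  obtains \<sigma> where "\<And>i. i \<notin> V \<Longrightarrow> \<sigma> i = 0" "meval (\<lambda>c. c) \<sigma> h \<noteq> 0"
proof -
  let ?K = "{m \<in> Poly_Mapping.keys h. Poly_Mapping.keys m \<subseteq> V}"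
  define r where "r = (\<Sum>m\<in>?K. Poly_Mapping.single m (Poly_Mapping.lookup h m))"
  have lr: "Poly_Mapping.lookup r k = (if k \<in> ?K then Poly_Mapping.lookup h k else 0)" for k
  proof -
    have "Poly_Mapping.lookup r k = (\<Sum>m\<in>?K. if m = k then Poly_Mapping.lookup h m else 0)"
      unfolding r_def lookup_sum by (rule sum.cong) (auto simp: lookup_single when_def)
    then show ?thesis by simp
  qed
  have "Poly_Mapping.lookup r m \<noteq> 0" using assms by (simp add: lr in_keys_iff)
  then have "r \<noteq> 0" by auto
  then obtain \<tau> where \<tau>: "meval (\<lambda>c. c) \<tau> r \<noteq> 0" using mpoly_nonroot_exists by blast
  define \<sigma> where "\<sigma> = (\<lambda>i. if i \<in> V then \<tau> i else 0)"
  have "Poly_Mapping.keys m \<subseteq> V" if "m \<in> Poly_Mapping.keys r" for m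
  proof -
    have "Poly_Mapping.lookup r m \<noteq> 0" using that by (simp add: in_keys_iff)
    then have "m \<in> ?K" unfolding lr by (simp split: if_splits)
    then show ?thesis by blast
  qed
  then have "r \<in> polys V" unfolding polys_def by blast
  then have "meval (\<lambda>c. c) \<sigma> r = meval (\<lambda>c. c) \<tau> r" by (rule meval_cong) (simp add: \<sigma>_def)
  moreover have "meval (\<lambda>c. c) \<sigma> r = meval (\<lambda>c. c) \<sigma> h"
  proof -
    have "meval (\<lambda>c. c) \<sigma> r = (\<Sum>m\<in>Poly_Mapping.keys h. Poly_Mapping.lookup r m * mono_eval \<sigma> m)"
      by (rule meval_superset) (auto simp: in_keys_iff lr)
    also have "\<dots> = meval (\<lambda>c. c) \<sigma> h"
      unfolding meval_def
    proof (rule sum.cong)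
      fix m assume "m \<in> Poly_Mapping.keys h"
      show "Poly_Mapping.lookup r m * mono_eval \<sigma> m = Poly_Mapping.lookup h m * mono_eval \<sigma> m"
      proof (cases "Poly_Mapping.keys m \<subseteq> V")
        case False
        then obtain i where "i \<in> Poly_Mapping.keys m" "i \<notin> V" by blast
        then have "mono_eval \<sigma> m = 0"
          unfolding mono_eval_def by (intro prod_zero) (auto simp: \<sigma>_def in_keys_iff intro!: bexI[of _ i])
        then show ?thesis by simp
      qed (use \<open>m \<in> _\<close> in \<open>simp add: lr\<close>)
    qed simp
    finally show ?thesis .
  qed
  ultimately show ?thesis using that[of \<sigma>] \<tau> by (simp add: \<sigma>_def)
qed

lemma keys_minus_single:
  "Poly_Mapping.lookup m i \<noteq> 0 \<Longrightarrow> (m :: nat \<Rightarrow>\<^sub>0 nat) = Poly_Mapping.single i 1 + (m - Poly_Mapping.single i 1)"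
  by (intro poly_mapping_eqI) (auto simp: lookup_add lookup_minus lookup_single when_def)

lemma lookup_pdiff:
  "Poly_Mapping.lookup (pdiff i g) n = of_nat (Suc (Poly_Mapping.lookup n i)) * Poly_Mapping.lookup g (n + Poly_Mapping.single i 1)"
proof (induction g rule: mpoly_single_induct)
  case (single m c)
  let ?e = "Poly_Mapping.single i (1::nat)"
  show ?case
  proof (cases "Poly_Mapping.lookup m i = 0")
    case True
    then have "n + ?e \<noteq> m" by (auto simp: lookup_add)
    then show ?thesis using True by (simp add: pdiff_single lookup_single)
  next
    case False
    then have "m - ?e = n \<longleftrightarrow> m = n + ?e"
      using keys_minus_single[OF False] by (auto simp: add.commute)
    moreover have "m = n + ?e \<Longrightarrow> Poly_Mapping.lookup m i = Suc (Poly_Mapping.lookup n i)"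
      by (simp add: lookup_add)
    ultimately show ?thesis by (auto simp: pdiff_single lookup_single when_def)
  qed
next
  case (add p q)
  then show ?case by (simp add: pdiff_add lookup_add distrib_left)
qed

lemma pdiff_eq_0:
  assumes "g \<in> polys V" "i \<notin> V"
  shows "pdiff i g = 0"
  unfolding pdiff_def
proof (rule sum.neutral, rule ballI)
  fix m assume "m \<in> Poly_Mapping.keys g"
  then have "i \<notin> Poly_Mapping.keys m" using assms unfolding polys_def by blast
  then have "Poly_Mapping.lookup m i = 0" by (simp add: in_keys_iff)
  then show "Poly_Mapping.single (m - Poly_Mapping.single i 1) (of_nat (Poly_Mapping.lookup m i) * Poly_Mapping.lookup g m) = 0"
    by simp
qed

text \<open>A monomial of degree at least 2 in \<open>x\<^sub>0, \<dots>, x\<^sub>t\<close> would survive in a partial derivative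
  restricted to the coordinate space.\<close>

lemma singular_cubic_low_degree:
  fixes g :: "'k::field_char_0 mpoly"
  assumes g: "g \<in> forms {..N} 3" and tN: "t \<le> N"
    and sing: "\<And>j x. j \<le> N \<Longrightarrow> x \<in> coord_space N t \<Longrightarrow> peval (pdiff j g) x = 0"
    and m: "m \<in> Poly_Mapping.keys g"
  shows "(\<Sum>i\<le>t. Poly_Mapping.lookup m i) \<le> 1"
proof (rule ccontr)
  assume ge: "\<not> ?thesis"
  have keys_m: "Poly_Mapping.keys m \<subseteq> {..N}" using g m by (auto simp: forms_def)
  have "mdeg m = 3" using g m by (auto simp: forms_iff)
  then have tot: "(\<Sum>i\<le>N. Poly_Mapping.lookup m i) = 3"
    using mdeg_superset[OF _ keys_m] by simp
  have split: "(\<Sum>i\<le>N. Poly_Mapping.lookup m i) = (\<Sum>i\<le>t. Poly_Mapping.lookup m i) + (\<Sum>i\<in>{t<..N}. Poly_Mapping.lookup m i)"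
    by (subst sum.union_disjoint[symmetric]) (use tN in \<open>auto intro!: sum.cong\<close>)
  \<comment> \<open>A variable is sought whose removal from \<open>m\<close> leaves only x_0, ...,
    x_t. The total degree is 3 and at least 2 of it lies in these, so at most one variable lies
    beyond \<open>t\<close>: that one is taken if it exists, and any variable of \<open>m\<close>
    otherwise.\<close>
  obtain i where i: "i \<le> N" "Poly_Mapping.lookup m i \<noteq> 0"
    and low: "Poly_Mapping.keys (m - Poly_Mapping.single i 1) \<subseteq> {..t}"
  proof (cases "\<exists>i\<in>{t<..N}. Poly_Mapping.lookup m i \<noteq> 0")
    case True
    then obtain i where i: "i \<in> {t<..N}" "Poly_Mapping.lookup m i \<noteq> 0" by blast
    have "(\<Sum>i\<in>{t<..N}. Poly_Mapping.lookup m i) = Poly_Mapping.lookup m i + (\<Sum>k\<in>{t<..N} - {i}. Poly_Mapping.lookup m k)"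
      using i(1) by (subst sum.remove[of _ i]) auto
    then have one: "Poly_Mapping.lookup m i = 1" "(\<Sum>k\<in>{t<..N} - {i}. Poly_Mapping.lookup m k) = 0"
      using ge tot split i(2) by linarith+
    have "Poly_Mapping.keys (m - Poly_Mapping.single i 1) \<subseteq> {..t}"
    proof
      fix k assume k: "k \<in> Poly_Mapping.keys (m - Poly_Mapping.single i 1)"
      have "k \<noteq> i" using k one(1) by (auto simp: in_keys_iff lookup_minus)
      have km: "k \<in> Poly_Mapping.keys m" using k by (auto simp: in_keys_iff lookup_minus)
      then have "k \<le> N" using keys_m by blast
      show "k \<in> {..t}"
      proof (rule ccontr)
        assume "k \<notin> {..t}"
        then have "k \<in> {t<..N} - {i}" using \<open>k \<le> N\<close> \<open>k \<noteq> i\<close> by auto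
        then have "Poly_Mapping.lookup m k = 0" using one(2) by simp
        then show False using km by (simp add: in_keys_iff)
      qed
    qed
    then show ?thesis using that i by auto
  next
    case False
    have km: "Poly_Mapping.keys m \<subseteq> {..t}"
    proof
      fix k assume k: "k \<in> Poly_Mapping.keys m"
      then have "k \<le> N" using keys_m by blast
      show "k \<in> {..t}"
      proof (rule ccontr)
        assume "k \<notin> {..t}"
        then have "k \<in> {t<..N}" using \<open>k \<le> N\<close> by auto
        then have "Poly_Mapping.lookup m k = 0" using False by blast
        then show False using k by (simp add: in_keys_iff)
      qed
    qed
    have "m \<noteq> 0" using \<open>mdeg m = 3\<close> by auto
    then have "Poly_Mapping.keys m \<noteq> {}" by simp
    then obtain i where i: "i \<in> Poly_Mapping.keys m" by blast
    have "Poly_Mapping.keys (m - Poly_Mapping.single i 1) \<subseteq> Poly_Mapping.keys m"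
      by (auto simp: in_keys_iff lookup_minus)
    then have "Poly_Mapping.keys (m - Poly_Mapping.single i 1) \<subseteq> {..t}" using km by (rule order_trans)
    moreover have "i \<le> N" using i keys_m by blast
    moreover have "Poly_Mapping.lookup m i \<noteq> 0" using i by (simp add: in_keys_iff)
    ultimately show ?thesis by (intro that)
  qed
  let ?n = "m - Poly_Mapping.single i 1"
  have "Poly_Mapping.lookup (pdiff i g) ?n \<noteq> 0"
    using m i(2) keys_minus_single[OF i(2)] unfolding lookup_pdiff
    by (simp add: add.commute in_keys_iff del: of_nat_Suc)
  from meval_nonzero_restricted[OF this low] obtain \<sigma> where
    \<sigma>: "\<And>j. j \<notin> {..t} \<Longrightarrow> \<sigma> j = 0" "meval (\<lambda>c. c) \<sigma> (pdiff i g) \<noteq> 0" by blast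
  have dg: "pdiff i g \<in> forms {..N} 2" using forms_pdiff[of g "{..N}" 2] g by (simp add: numeral_3_eq_3)
  then have dgp: "pdiff i g \<in> polys {..N}" using forms_subset_polys by blast
  let ?x = "vec (N + 1) \<sigma>"
  have ev: "peval (pdiff i g) ?x = meval (\<lambda>c. c) \<sigma> (pdiff i g)"
    by (rule peval_cong[OF dgp]) simp
  have "?x \<noteq> 0\<^sub>v (N + 1)"
  proof
    assume x0: "?x = 0\<^sub>v (N + 1)"
    have "\<sigma> j = 0 * \<sigma> j" if j: "j \<le> N" for j
    proof -
      have "?x $ j = 0" unfolding x0 using j by simp
      then show ?thesis using j by simp
    qed
    then have "meval (\<lambda>c. c) \<sigma> (pdiff i g) = meval (\<lambda>c. c) (\<lambda>j. 0 * \<sigma> j) (pdiff i g)"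
      by (intro meval_cong[OF dgp]) auto
    also have "\<dots> = 0" unfolding meval_scale_forms[OF dg] by simp
    finally show False using \<sigma>(2) by simp
  qed
  then have "?x \<in> coord_space N t" using \<sigma>(1) by (auto simp: coord_space_def proj_space_def)
  then show False using sing[OF i(1)] ev \<sigma>(2) by simp
qed

text \<open>Each monomial contains either exactly one of x_0, ..., x_t, to the first power, or none.
  Dividing out that variable gives the contributions to the \<open>C i\<close>; the other monomials
  form \<open>D\<close>.\<close>

lemma low_degree_decomposition:
  fixes g :: "'k::field_char_0 mpoly"
  assumes g: "g \<in> forms {..N} 3" and low: "\<And>m. m \<in> Poly_Mapping.keys g \<Longrightarrow> (\<Sum>i\<le>t. Poly_Mapping.lookup m i) \<le> 1"
  obtains C D where "\<And>i. i \<le> t \<Longrightarrow> C i \<in> forms {t + 1..N} 2" "D \<in> forms {t + 1..N} 3"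
    "g = (\<Sum>i\<le>t. xvar i * C i) + D"
proof -
  let ?L = "\<lambda>m. Poly_Mapping.single m (Poly_Mapping.lookup g m)"
  let ?e = "\<lambda>i. Poly_Mapping.single i (1::nat)"
  define C where "C = (\<lambda>i. \<Sum>m | m \<in> Poly_Mapping.keys g \<and> i \<in> Poly_Mapping.keys m. Poly_Mapping.single (m - ?e i) (Poly_Mapping.lookup g m))"
  define D where "D = (\<Sum>m | m \<in> Poly_Mapping.keys g \<and> Poly_Mapping.keys m \<inter> {..t} = {}. ?L m)"
  have uniq: "Poly_Mapping.lookup m i = 1 \<and> (\<forall>k\<le>t. k \<noteq> i \<longrightarrow> Poly_Mapping.lookup m k = 0)"
    if "m \<in> Poly_Mapping.keys g" "i \<in> Poly_Mapping.keys m" "i \<le> t" for m i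
  proof -
    have "(\<Sum>i\<le>t. Poly_Mapping.lookup m i) = Poly_Mapping.lookup m i + (\<Sum>k\<in>{..t} - {i}. Poly_Mapping.lookup m k)"
      using that(3) by (subst sum.remove[of _ i]) auto
    moreover have "Poly_Mapping.lookup m i \<noteq> 0" using that(2) by (simp add: in_keys_iff)
    ultimately have "Poly_Mapping.lookup m i = 1" "(\<Sum>k\<in>{..t} - {i}. Poly_Mapping.lookup m k) = 0"
      using low[OF that(1)] by linarith+
    then show ?thesis by auto
  qed
  have keysg: "Poly_Mapping.keys m \<subseteq> {..N}" "mdeg m = 3" if "m \<in> Poly_Mapping.keys g" for m
    using g that by (auto simp: forms_iff polys_def)
  have "C i \<in> forms {t + 1..N} 2" if i: "i \<le> t" for i
    unfolding C_def
  proof (rule forms_sum)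
    fix m assume "m \<in> {m. m \<in> Poly_Mapping.keys g \<and> i \<in> Poly_Mapping.keys m}"
    then have m: "m \<in> Poly_Mapping.keys g" "i \<in> Poly_Mapping.keys m" by auto
    have dm: "m = ?e i + (m - ?e i)" using m(2) by (intro keys_minus_single) (simp add: in_keys_iff)
    have "mdeg m = 1 + mdeg (m - ?e i)" by (subst dm) (simp only: mdeg_add mdeg_single)
    then have "mdeg (m - ?e i) = 2" using keysg(2)[OF m(1)] by simp
    moreover have "Poly_Mapping.keys (m - ?e i) \<subseteq> {t + 1..N}"
    proof
      fix k assume k: "k \<in> Poly_Mapping.keys (m - ?e i)"
      then have "k \<in> Poly_Mapping.keys m" by (auto simp: in_keys_iff lookup_minus)
      moreover have "\<not> k \<le> t" using k uniq[OF m i] by (auto simp: in_keys_iff lookup_minus lookup_single when_def split: if_splits)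
      ultimately show "k \<in> {t + 1..N}" using keysg(1)[OF m(1)] by auto
    qed
    ultimately show "Poly_Mapping.single (m - ?e i) (Poly_Mapping.lookup g m) \<in> forms {t + 1..N} 2"
      using forms_single by metis
  qed
  moreover have "D \<in> forms {t + 1..N} 3"
    unfolding D_def
  proof (rule forms_sum)
    fix m assume "m \<in> {m. m \<in> Poly_Mapping.keys g \<and> Poly_Mapping.keys m \<inter> {..t} = {}}"
    then have m: "m \<in> Poly_Mapping.keys g" "Poly_Mapping.keys m \<inter> {..t} = {}" by auto
    have "Poly_Mapping.keys m \<subseteq> {t + 1..N}" using keysg(1)[OF m(1)] m(2) by force
    then show "?L m \<in> forms {t + 1..N} 3" using forms_single keysg(2)[OF m(1)] by metis
  qed
  moreover have "g = (\<Sum>i\<le>t. xvar i * C i) + D"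
  proof -
    have xC: "xvar i * C i = (\<Sum>m\<in>Poly_Mapping.keys g. if i \<in> Poly_Mapping.keys m then ?L m else 0)" for i
    proof -
      have "xvar i * C i = (\<Sum>m | m \<in> Poly_Mapping.keys g \<and> i \<in> Poly_Mapping.keys m. ?L m)"
        unfolding C_def sum_distrib_left
      proof (rule sum.cong)
        fix m assume "m \<in> {m. m \<in> Poly_Mapping.keys g \<and> i \<in> Poly_Mapping.keys m}"
        then have "?e i + (m - ?e i) = m" by (intro keys_minus_single[symmetric]) (simp add: in_keys_iff)
        then show "xvar i * Poly_Mapping.single (m - ?e i) (Poly_Mapping.lookup g m) = ?L m"
          unfolding xvar_def mult_single by (simp only: mult_1)
      qed simp
      also have "\<dots> = (\<Sum>m\<in>Poly_Mapping.keys g. if i \<in> Poly_Mapping.keys m then ?L m else 0)"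
        by (rule sum.inter_filter) simp
      finally show ?thesis .
    qed
    have D': "D = (\<Sum>m\<in>Poly_Mapping.keys g. if Poly_Mapping.keys m \<inter> {..t} = {} then ?L m else 0)"
      unfolding D_def by (rule sum.inter_filter) simp
    have "(\<Sum>i\<le>t. xvar i * C i) + D = (\<Sum>m\<in>Poly_Mapping.keys g. (\<Sum>i\<le>t. if i \<in> Poly_Mapping.keys m then ?L m else 0)
        + (if Poly_Mapping.keys m \<inter> {..t} = {} then ?L m else 0))"
      unfolding xC D' sum.distrib by (subst sum.swap) simp
    also have "\<dots> = (\<Sum>m\<in>Poly_Mapping.keys g. ?L m)"
    proof (rule sum.cong)
      fix m assume m: "m \<in> Poly_Mapping.keys g"
      show "(\<Sum>i\<le>t. if i \<in> Poly_Mapping.keys m then ?L m else 0)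
        + (if Poly_Mapping.keys m \<inter> {..t} = {} then ?L m else 0) = ?L m"
      proof (cases "Poly_Mapping.keys m \<inter> {..t} = {}")
        case True
        then have "(\<Sum>i\<le>t. if i \<in> Poly_Mapping.keys m then ?L m else 0) = 0"
          by (intro sum.neutral) auto
        with True show ?thesis by simp
      next
        case False
        then obtain k where k: "k \<in> Poly_Mapping.keys m" "k \<le> t" by auto
        have "(\<Sum>i\<le>t. if i \<in> Poly_Mapping.keys m then ?L m else 0) = (\<Sum>i\<le>t. if i = k then ?L m else 0)"
          using uniq[OF m k] k by (intro sum.cong) (auto simp: in_keys_iff)
        with False k show ?thesis by simp
      qed
    qed simp
    also have "\<dots> = g" by (rule mpoly_sum_single[symmetric])
    finally show ?thesis by simp
  qed
  ultimately show ?thesis using that by blast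
qed

section \<open>Vanishing hessian and cones\<close>

text \<open>A permutation cannot map the \<open>k\<close> rows of the block into the n - k < k
  columns outside it, so each term of the Leibniz expansion contains an entry of the zero
  block.\<close>

lemma det_zero_block:
  fixes H :: "'a::comm_ring_1 mat"
  assumes H: "H \<in> carrier_mat n n" and zero: "\<And>i j. i < k \<Longrightarrow> j < k \<Longrightarrow> H $$ (i, j) = 0"
    and k: "k \<le> n" "n < 2 * k"
  shows "det H = 0"
  unfolding det_def'[OF H]
proof (rule sum.neutral, rule ballI)
  fix \<pi> assume "\<pi> \<in> {\<pi>. \<pi> permutes {0..<n}}"
  then have \<pi>: "\<pi> permutes {0..<n}" by simp
  have "\<exists>i<k. \<pi> i < k"
  proof (rule ccontr)
    assume no: "\<not> (\<exists>i<k. \<pi> i < k)"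
    have "\<pi> i \<in> {k..<n}" if "i \<in> {..<k}" for i
      using no that permutes_in_image[OF \<pi>, of i] k(1) by auto
    then have "\<pi> ` {..<k} \<subseteq> {k..<n}" by blast
    then have "card (\<pi> ` {..<k}) \<le> card {k..<n}" by (rule card_mono[rotated]) simp
    moreover have "card (\<pi> ` {..<k}) = k"
      using card_image[OF inj_on_subset[OF permutes_inj[OF \<pi>] subset_UNIV], of "{..<k}"] by simp
    ultimately show False using k by simp
  qed
  then obtain i where i: "i < k" "\<pi> i < k" by blast
  have "(\<Prod>i = 0..<n. H $$ (i, \<pi> i)) = 0"
    by (rule prod_zero) (use i k zero in \<open>auto intro!: bexI[of _ i]\<close>)
  then show "signof \<pi> * (\<Prod>i = 0..<n. H $$ (i, \<pi> i)) = 0" by simp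
qed

lemma comm_ring_hom_peval: "comm_ring_hom (\<lambda>g. peval g (v::'k::comm_ring_1 vec))"
  unfolding peval_eq_meval by (rule comm_ring_hom_meval[OF comm_ring_hom_id])

lemma invertible_preimage:
  fixes A :: "'a::field mat"
  assumes A: "A \<in> carrier_mat n n" and d: "det A \<noteq> 0" and v: "v \<in> carrier_vec n"
  obtains u where "u \<in> carrier_vec n" "A *\<^sub>v u = v"
proof -
  obtain B where B: "B \<in> carrier_mat n n" "A * B = 1\<^sub>m n"
    using det_non_zero_imp_unit[OF A d] by (auto simp: Units_def ring_mat_def)
  have "A *\<^sub>v (B *\<^sub>v v) = (A * B) *\<^sub>v v" by (rule assoc_mult_mat_vec[OF A B(1) v, symmetric])
  then have "A *\<^sub>v (B *\<^sub>v v) = v" using v by (simp add: B(2))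
  then show ?thesis using that[of "B *\<^sub>v v"] B(1) v by simp
qed

text \<open>Suppose the hessian is nonzero at a point A u. There the matrix of second derivatives is
  some H with nonzero determinant, and the one of the transformed cubic at u is A^T H A, which has a
  zero block of size t + 1.\<close>

lemma hessian_eq_0:
  fixes f :: "'k::field_char_0 mpoly"
  assumes f: "f \<in> forms {..N} 3" and A: "A \<in> carrier_mat (N + 1) (N + 1)" and d: "det A \<noteq> 0"
    and zero: "\<And>i j. i \<le> t \<Longrightarrow> j \<le> t \<Longrightarrow> pdiff i (pdiff j (lin_subst A f)) = 0"
    and t: "t \<le> N" "N + 1 < 2 * (t + 1)"
  shows "hessian N f = 0"
proof (rule ccontr)
  assume "hessian N f \<noteq> 0"
  then obtain \<sigma> where \<sigma>: "meval (\<lambda>c. c) \<sigma> (hessian N f) \<noteq> 0" using mpoly_nonroot_exists by blast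
  let ?v = "vec (N + 1) \<sigma>"
  obtain u where u: "u \<in> carrier_vec (N + 1)" "A *\<^sub>v u = ?v"
    using invertible_preimage[OF A d, of ?v] by auto
  have f1: "pdiff j f \<in> polys {..N}" and f2: "pdiff i (pdiff j f) \<in> polys {..N}" for i j
    using forms_pdiff[of f "{..N}" 2 j] forms_pdiff[of "pdiff j f" "{..N}" 1 i] f forms_subset_polys
    by (auto simp: numeral_3_eq_3 numeral_2_eq_2)
  have f0: "f \<in> polys {..N}" using f forms_subset_polys by blast
  define H where "H = mat (N + 1) (N + 1) (\<lambda>(i, j). peval (pdiff i (pdiff j f)) ?v)"
  have H: "H \<in> carrier_mat (N + 1) (N + 1)" by (simp add: H_def)
  interpret m: comm_ring_hom "meval (\<lambda>c. c) \<sigma>" by (rule comm_ring_hom_meval[OF comm_ring_hom_id])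
  have "meval (\<lambda>c. c) \<sigma> (hessian N f) = det (map_mat (meval (\<lambda>c. c) \<sigma>) (mat (N + 1) (N + 1) (\<lambda>(i, j). pdiff i (pdiff j f))))"
    unfolding hessian_def by (rule m.hom_det[symmetric])
  also have "map_mat (meval (\<lambda>c. c) \<sigma>) (mat (N + 1) (N + 1) (\<lambda>(i, j). pdiff i (pdiff j f))) = H"
    unfolding H_def by (rule eq_matI) (auto intro!: peval_cong[OF f2, symmetric])
  finally have detH: "det H \<noteq> 0" using \<sigma> by simp
  interpret p: comm_ring_hom "\<lambda>g. peval g u" by (rule comm_ring_hom_peval)
  have pc: "peval (const c) u = c" for c
    unfolding peval_eq_meval by (rule meval_const[OF comm_ring_hom_id])
  let ?G = "transpose_mat A * (H * A)"
  have G: "?G \<in> carrier_mat (N + 1) (N + 1)" using A H by auto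
  have "?G $$ (i, j) = peval (pdiff i (pdiff j (lin_subst A f))) u" if ij: "i \<le> N" "j \<le> N" for i j
  proof -
    have "pdiff i (pdiff j (lin_subst A f))
        = (\<Sum>l\<le>N. const (A $$ (l, j)) * (\<Sum>k\<le>N. const (A $$ (k, i)) * lin_subst A (pdiff k (pdiff l f))))"
      unfolding pdiff_lin_subst[OF A f0 ij(2)] pdiff_sum pdiff_const_mult pdiff_lin_subst[OF A f1 ij(1)] ..
    then have "peval (pdiff i (pdiff j (lin_subst A f))) u
        = (\<Sum>l\<le>N. A $$ (l, j) * (\<Sum>k\<le>N. A $$ (k, i) * peval (pdiff k (pdiff l f)) ?v))"
      by (simp only: p.hom_sum p.hom_mult pc peval_lin_subst[OF A u(1) f2] u(2))
    also have "\<dots> = (\<Sum>l\<le>N. \<Sum>k\<le>N. A $$ (k, i) * (peval (pdiff k (pdiff l f)) ?v * A $$ (l, j)))"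
      by (simp add: sum_distrib_left mult_ac)
    also have "\<dots> = (\<Sum>k\<le>N. \<Sum>l\<le>N. A $$ (k, i) * (peval (pdiff k (pdiff l f)) ?v * A $$ (l, j)))"
      by (rule sum.swap)
    also have "\<dots> = ?G $$ (i, j)"
      using A ij by (simp add: H_def scalar_prod_def atLeast0LessThan lessThan_Suc_atMost sum_distrib_left)
    finally show ?thesis by simp
  qed
  then have "?G $$ (i, j) = 0" if "i < t + 1" "j < t + 1" for i j
    using that t(1) zero[of i j] by (simp add: p.hom_zero)
  then have "det ?G = 0" by (rule det_zero_block[OF G]) (use t in auto)
  moreover have "det ?G = det A * (det H * det A)"
    using A H by (subst det_mult[of _ "N + 1"], simp, simp, subst det_mult[OF H A], subst det_transpose[OF A]) simp
  ultimately show False using d detH by simp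
qed

lemma mdeg_Suc:
  assumes "mdeg m = Suc d"
  obtains i n where "m = Poly_Mapping.single i 1 + n" "mdeg n = d"
proof -
  have "m \<noteq> 0" using assms by auto
  then have "Poly_Mapping.keys m \<noteq> {}" by simp
  then obtain i where "i \<in> Poly_Mapping.keys m" by blast
  then have m: "m = Poly_Mapping.single i 1 + (m - Poly_Mapping.single i 1)"
    by (intro keys_minus_single) (simp add: in_keys_iff)
  have "mdeg m = 1 + mdeg (m - Poly_Mapping.single i 1)" by (subst m) (simp only: mdeg_add mdeg_single)
  then show ?thesis using that[OF m] assms by simp
qed

lemma mdeg_eq_0: "mdeg m = 0 \<Longrightarrow> m = 0"
  unfolding mdeg_def by (intro poly_mapping_eqI) (auto simp: in_keys_iff)

lemma sum_gauss: "(\<Sum>j<n. j + 1) = n * (n + 1) div (2::nat)"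
  by (induction n) auto

lemma card_quadratic_monomials:
  assumes "t \<le> N"
  shows "finite {m. Poly_Mapping.keys m \<subseteq> {t + 1..N} \<and> mdeg m = 2}"
    "card {m. Poly_Mapping.keys m \<subseteq> {t + 1..N} \<and> mdeg m = 2} \<le> (N - t) * (N - t + 1) div 2"
proof -
  let ?S = "{m. Poly_Mapping.keys m \<subseteq> {t + 1..N} \<and> mdeg m = 2}"
  \<comment> \<open>Pairs i \<le> j index products of two of the \<open>N - t\<close> variables.
    Ordering the two variables of a quadratic monomial shows that every monomial arises.\<close>
  let ?P = "SIGMA j:{..<N - t}. {..j}"
  let ?g = "\<lambda>(j, i). Poly_Mapping.single (t + 1 + i) (1::nat) + Poly_Mapping.single (t + 1 + j) 1"
  have sub: "?S \<subseteq> ?g ` ?P"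
  proof
    fix m assume m: "m \<in> ?S"
    then obtain a n where a: "m = Poly_Mapping.single a 1 + n" "mdeg n = 1"
      using mdeg_Suc[of m 1] by (auto simp: numeral_2_eq_2)
    then obtain b n' where b: "n = Poly_Mapping.single b 1 + n'" "mdeg n' = 0"
      using mdeg_Suc[of n 0] by auto
    have mab: "m = Poly_Mapping.single a 1 + Poly_Mapping.single b 1"
      using a b mdeg_eq_0[OF b(2)] by simp
    have "Poly_Mapping.keys m = {a} \<union> {b}" unfolding mab keys_add_nat by simp
    then have ab: "a \<in> {t + 1..N}" "b \<in> {t + 1..N}" using m by auto
    have "?g (max a b - (t + 1), min a b - (t + 1)) = m"
      unfolding mab using ab by (auto simp: max_def min_def add.commute)
    moreover have "(max a b - (t + 1), min a b - (t + 1)) \<in> ?P" using ab by auto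
    ultimately show "m \<in> ?g ` ?P" by (metis (no_types, lifting) imageI)
  qed
  have "card ?P = (\<Sum>j<N - t. j + 1)" by (simp add: card_SigmaI)
  also have "\<dots> = (N - t) * (N - t + 1) div 2"
    by (rule sum_gauss)
  finally have cP: "card ?P = (N - t) * (N - t + 1) div 2" .
  have fin: "finite (?g ` ?P)" by auto
  then show "finite ?S" by (rule finite_subset[OF sub])
  have "card ?S \<le> card (?g ` ?P)" by (rule card_mono[OF fin sub])
  also have "\<dots> \<le> card ?P" by (rule card_image_le) auto
  finally show "card ?S \<le> (N - t) * (N - t + 1) div 2" unfolding cP .
qed

text \<open>A linear relation is a kernel vector of the coefficient matrix, which has one row per
  quadratic monomial and one column per form, hence more columns than rows.\<close>

lemma quadratic_forms_dependent:
  fixes C :: "nat \<Rightarrow> 'k::field mpoly"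
  assumes C: "\<And>i. i \<le> t \<Longrightarrow> C i \<in> forms {t + 1..N} 2" and "t \<le> N" and card: "(N - t) * (N - t + 1) div 2 < t + 1"
  obtains c where "c \<in> carrier_vec (t + 1)" "c \<noteq> 0\<^sub>v (t + 1)" "(\<Sum>i\<le>t. const (c $ i) * C i) = 0"
proof -
  let ?S = "{m. Poly_Mapping.keys m \<subseteq> {t + 1..N} \<and> mdeg m = 2}"
  note S = card_quadratic_monomials[OF \<open>t \<le> N\<close>]
  obtain h where h: "bij_betw h {0..<card ?S} ?S" using ex_bij_betw_nat_finite[OF S(1)] by blast
  define A where "A = mat (card ?S) (t + 1) (\<lambda>(r, i). Poly_Mapping.lookup (C i) (h r))"
  have A: "A \<in> carrier_mat (card ?S) (t + 1)" by (simp add: A_def)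
  have "card ?S < t + 1" using S(2) card by linarith
  then obtain c where c: "c \<in> carrier_vec (t + 1)" "c \<noteq> 0\<^sub>v (t + 1)" "A *\<^sub>v c = 0\<^sub>v (card ?S)"
    by (rule kernel_vec_exists[OF A])
  have lc: "Poly_Mapping.lookup (const x * p) m = x * Poly_Mapping.lookup p m" for x :: 'k and p m
    unfolding const_def mult_map_scale_conv_mult[symmetric] by (simp add: Poly_Mapping.map.rep_eq when_def)
  have "Poly_Mapping.lookup (\<Sum>i\<le>t. const (c $ i) * C i) m = 0" for m
  proof (cases "m \<in> ?S")
    case True
    then obtain r where r: "r < card ?S" "m = h r"
      using bij_betw_imp_surj_on[OF h] by (metis (no_types, lifting) atLeastLessThan_iff imageE)
    have "(A *\<^sub>v c) $ r = (\<Sum>i\<le>t. Poly_Mapping.lookup (C i) m * c $ i)"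
      using r c(1) by (simp add: A_def scalar_prod_def atLeast0LessThan lessThan_Suc_atMost)
    then have "(\<Sum>i\<le>t. c $ i * Poly_Mapping.lookup (C i) m) = 0" using c(3) r(1) by (simp add: mult.commute)
    then show ?thesis unfolding lookup_sum lc .
  next
    case False
    have "Poly_Mapping.lookup (C i) m = 0" if "i \<le> t" for i
    proof (rule ccontr)
      assume "Poly_Mapping.lookup (C i) m \<noteq> 0"
      then have "m \<in> Poly_Mapping.keys (C i)" by (simp add: in_keys_iff)
      then have "m \<in> ?S" using C[OF that] by (auto simp: forms_iff polys_def)
      with False show False ..
    qed
    then show ?thesis by (simp add: lookup_sum lc)
  qed
  then have "(\<Sum>i\<le>t. const (c $ i) * C i) = 0" by (intro poly_mapping_eqI) simp
  with c show ?thesis using that by blast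
qed

text \<open>Beyond index \<open>t\<close> the padded vector is zero, so \<open>g\<close> sees only
  the scaled \<open>x\<close>.\<close>

lemma peval_at_sum:
  assumes "g \<in> forms {t + 1..N} d" "x \<in> carrier_vec (N + 1)" "c \<in> carrier_vec (t + 1)" "t \<le> N"
  shows "peval g (s \<cdot>\<^sub>v pad_vec (N + 1) c + r \<cdot>\<^sub>v x) = r ^ d * peval g (x :: 'k::field vec)"
proof -
  have "peval g (s \<cdot>\<^sub>v pad_vec (N + 1) c + r \<cdot>\<^sub>v x) = meval (\<lambda>c. c) (\<lambda>i. r * x $ i) g"
    unfolding peval_eq_meval
    by (rule meval_cong[OF forms_subset_polys[THEN subsetD, OF assms(1)]]) (use assms(2-4) in \<open>auto simp: pad_vec_def\<close>)
  also have "\<dots> = r ^ d * peval g x"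
    unfolding peval_eq_meval by (rule meval_scale_forms[OF assms(1)])
  finally show ?thesis .
qed

text \<open>Let z have the coefficients of a linear relation between the \<open>C i\<close> as its
  first coordinates and zeros after them. Moving along z changes the transformed cubic by a multiple
  of that relation, so f(A (s z + r x)) = r^3 f(A x), and A z is a vertex.\<close>

lemma is_cone_of_dependent:
  fixes f :: "'k::field_char_0 mpoly"
  assumes f: "f \<in> forms {..N} 3" and A: "A \<in> carrier_mat (N + 1) (N + 1)" and d: "det A \<noteq> 0"
    and C: "\<And>i. i \<le> t \<Longrightarrow> C i \<in> forms {t + 1..N} 2" and D: "D \<in> forms {t + 1..N} 3"
    and eq: "lin_subst A f = (\<Sum>i\<le>t. xvar i * C i) + D"
    and t: "t \<le> N" "(N - t) * (N - t + 1) div 2 < t + 1"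
  shows "is_cone (hypersurface N f)"
proof -
  obtain c where c: "c \<in> carrier_vec (t + 1)" "c \<noteq> 0\<^sub>v (t + 1)" "(\<Sum>i\<le>t. const (c $ i) * C i) = 0"
    by (rule quadratic_forms_dependent[OF C t])
  let ?z = "pad_vec (N + 1) c"
  have z: "?z \<in> carrier_vec (N + 1)" by (simp add: pad_vec_def)
  have f0: "f \<in> polys {..N}" using f forms_subset_polys by blast
  have ptz: "peval f (A *\<^sub>v (s \<cdot>\<^sub>v ?z + r \<cdot>\<^sub>v x)) = r ^ 3 * peval f (A *\<^sub>v x)"
    if x: "x \<in> carrier_vec (N + 1)" for s r x
  proof -
    have val: "peval (lin_subst A f) y = (\<Sum>i\<le>t. y $ i * peval (C i) y) + peval D y" for y
    proof -
      interpret p: comm_ring_hom "\<lambda>g. peval g y" by (rule comm_ring_hom_peval)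
      have "peval (xvar i) y = y $ i" for i unfolding peval_eq_meval by (rule meval_xvar[OF comm_ring_hom_id])
      then show ?thesis unfolding eq by (simp add: p.hom_add p.hom_sum p.hom_mult)
    qed
    interpret px: comm_ring_hom "\<lambda>g. peval g x" by (rule comm_ring_hom_peval)
    have "peval (const k) x = k" for k unfolding peval_eq_meval by (rule meval_const[OF comm_ring_hom_id])
    then have cC: "(\<Sum>i\<le>t. c $ i * peval (C i) x) = 0"
      using arg_cong[OF c(3), of "\<lambda>g. peval g x"] by (simp add: px.hom_sum px.hom_mult)
    let ?y = "s \<cdot>\<^sub>v ?z + r \<cdot>\<^sub>v x"
    have y: "?y \<in> carrier_vec (N + 1)" using z x by simp
    have yi: "?y $ i = s * c $ i + r * x $ i" if "i \<le> t" for i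
      using that t(1) x c(1) by (simp add: pad_vec_def)
    have "peval f (A *\<^sub>v ?y) = (\<Sum>i\<le>t. ?y $ i * peval (C i) ?y) + peval D ?y"
      unfolding peval_lin_subst[OF A y f0, symmetric] by (rule val)
    also have "\<dots> = (\<Sum>i\<le>t. (s * c $ i + r * x $ i) * (r ^ 2 * peval (C i) x)) + r ^ 3 * peval D x"
      using peval_at_sum[OF C x c(1) t(1)] peval_at_sum[OF D x c(1) t(1)] yi by simp
    also have "\<dots> = s * r ^ 2 * (\<Sum>i\<le>t. c $ i * peval (C i) x) + r ^ 3 * ((\<Sum>i\<le>t. x $ i * peval (C i) x) + peval D x)"
      by (simp add: sum_distrib_left sum.distrib distrib_left distrib_right power2_eq_square power3_eq_cube mult_ac)
    also have "\<dots> = r ^ 3 * peval (lin_subst A f) x" unfolding cC val by simp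
    finally show ?thesis unfolding peval_lin_subst[OF A x f0] .
  qed
  have inj: "A *\<^sub>v x \<noteq> 0\<^sub>v (N + 1)" if "x \<in> carrier_vec (N + 1)" "x \<noteq> 0\<^sub>v (N + 1)" for x
    using det_0_iff_vec_prod_zero_field[OF A] d that by blast
  have "c \<in> proj_space t" using c by (simp add: proj_space_def)
  then have "?z \<in> coord_space N t" unfolding coord_space_eq_pad_vec[OF t(1)] by (rule imageI)
  then have z0: "?z \<noteq> 0\<^sub>v (N + 1)" by (simp add: coord_space_def proj_space_def)
  let ?p = "A *\<^sub>v ?z"
  have pc: "?p \<in> carrier_vec (N + 1)" using A z by simp
  have p0: "?p \<noteq> 0\<^sub>v (N + 1)" by (rule inj[OF z z0])
  \<comment> \<open>The vertex lies on X: this is the case s = 1, r = 0 of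
    \<open>ptz\<close>.\<close>
  have "peval f ?p = 0"
  proof -
    have "1 \<cdot>\<^sub>v ?z + 0 \<cdot>\<^sub>v ?z = ?z" using z by (intro eq_vecI) auto
    then show ?thesis using ptz[OF z, of 1 0] by simp
  qed
  then have pX: "?p \<in> hypersurface N f" using pc p0 by (simp add: hypersurface_def proj_space_def)
  show ?thesis unfolding is_cone_def
  proof (intro bexI[OF _ pX] ballI impI allI)
    fix y and s r :: 'k
    assume y: "y \<in> hypersurface N f" and nm: "\<nexists>k. y = k \<cdot>\<^sub>v ?p" and sr: "s \<noteq> 0 \<or> r \<noteq> 0"
    have yc: "y \<in> carrier_vec (N + 1)" and fy: "peval f y = 0" using y by (auto simp: hypersurface_def proj_space_def)
    obtain x where x: "x \<in> carrier_vec (N + 1)" "A *\<^sub>v x = y" by (rule invertible_preimage[OF A d yc])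
    have "A *\<^sub>v (s \<cdot>\<^sub>v ?z + r \<cdot>\<^sub>v x) = A *\<^sub>v (s \<cdot>\<^sub>v ?z) + A *\<^sub>v (r \<cdot>\<^sub>v x)"
      by (rule mult_add_distrib_mat_vec[OF A]) (use z x in auto)
    also have "\<dots> = s \<cdot>\<^sub>v ?p + r \<cdot>\<^sub>v y"
      using mult_mat_vec[OF A z] mult_mat_vec[OF A x(1)] x(2) by simp
    finally have Aeq: "A *\<^sub>v (s \<cdot>\<^sub>v ?z + r \<cdot>\<^sub>v x) = s \<cdot>\<^sub>v ?p + r \<cdot>\<^sub>v y" .
    have "peval f (s \<cdot>\<^sub>v ?p + r \<cdot>\<^sub>v y) = 0" using ptz[OF x(1), of s r] fy unfolding Aeq x(2) by simp
    \<comment> \<open>The combination must be a point of projective space. It could vanish only if y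
      were a multiple of the vertex.\<close>
    moreover have "s \<cdot>\<^sub>v ?p + r \<cdot>\<^sub>v y \<noteq> 0\<^sub>v (N + 1)"
    proof
      assume z: "s \<cdot>\<^sub>v ?p + r \<cdot>\<^sub>v y = 0\<^sub>v (N + 1)"
      have co: "s * ?p $ i + r * y $ i = 0" if "i < N + 1" for i
        using arg_cong[OF z, of "\<lambda>w. w $ i"] that pc yc A by simp
      show False
      proof (cases "r = 0")
        case True
        then have "?p $ i = 0" if "i < N + 1" for i using co[OF that] sr by simp
        then have "?p = 0\<^sub>v (N + 1)" using pc A by (intro eq_vecI) auto
        with p0 show False ..
      next
        case False
        have "y = (- s / r) \<cdot>\<^sub>v ?p"
        proof (rule eq_vecI)
          fix i assume "i < dim_vec ((- s / r) \<cdot>\<^sub>v ?p)"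
          then have i: "i < N + 1" using pc A by simp
          have "r * y $ i + s * ?p $ i = 0" using co[OF i] by (simp add: add.commute)
          from solve_linear[OF this False] show "y $ i = ((- s / r) \<cdot>\<^sub>v ?p) $ i" using i pc A by simp
        qed (use pc yc A in simp)
        then show False using nm by blast
      qed
    qed
    ultimately show "s \<cdot>\<^sub>v ?p + r \<cdot>\<^sub>v y \<in> hypersurface N f"
      using pc yc by (simp add: hypersurface_def proj_space_def)
  qed
qed

section \<open>Non-normal cubics\<close>

text \<open>The linear forms \<alpha> and \<beta> are only known to lie in
  \<open>forms UNIV 1\<close>. On points whose coordinates beyond \<open>N\<close> vanish, the
  coefficients of x_0, ..., x_N suffice.\<close>

lemma linear_form_eval:
  assumes "g \<in> forms UNIV 1"
  shows "\<exists>b. \<forall>\<sigma>. (\<forall>i>N. \<sigma> i = 0) \<longrightarrow> meval (\<lambda>c. c) \<sigma> g = (\<Sum>j\<le>N. b j * \<sigma> j :: 'k::comm_ring_1)"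
proof -
  let ?b = "\<lambda>j. Poly_Mapping.lookup g (Poly_Mapping.single j 1)"
  let ?J = "{..N} \<union> {j. Poly_Mapping.single j (1::nat) \<in> Poly_Mapping.keys g}"
  have inj: "inj (\<lambda>j. Poly_Mapping.single j (1::nat))"
    by (rule injI) (metis keys_single one_neq_zero singleton_inject)
  have "finite {j. Poly_Mapping.single j (1::nat) \<in> Poly_Mapping.keys g}"
    using finite_vimageI[OF finite_keys[of g] inj] by (simp add: vimage_def)
  then have J: "finite ?J" by simp
  have sub: "Poly_Mapping.keys g \<subseteq> (\<lambda>j. Poly_Mapping.single j 1) ` ?J"
  proof
    fix m assume m: "m \<in> Poly_Mapping.keys g"
    then have "mdeg m = Suc 0" using assms by (simp add: forms_iff)
    then obtain j n where "m = Poly_Mapping.single j 1 + n" "mdeg n = 0" by (rule mdeg_Suc)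
    then have "m = Poly_Mapping.single j 1" using mdeg_eq_0 by fastforce
    then show "m \<in> (\<lambda>j. Poly_Mapping.single j 1) ` ?J" using m by blast
  qed
  have "meval (\<lambda>c. c) \<sigma> g = (\<Sum>j\<le>N. ?b j * \<sigma> j)" if "\<forall>i>N. \<sigma> i = 0" for \<sigma>
  proof -
    have "meval (\<lambda>c. c) \<sigma> g = (\<Sum>m\<in>(\<lambda>j. Poly_Mapping.single j 1) ` ?J. Poly_Mapping.lookup g m * mono_eval \<sigma> m)"
      by (rule meval_superset) (use J sub in auto)
    also have "\<dots> = (\<Sum>j\<in>?J. ?b j * \<sigma> j)"
      using sum.reindex[OF inj_on_subset[OF inj subset_UNIV], of "\<lambda>m. Poly_Mapping.lookup g m * mono_eval \<sigma> m" ?J] by simp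
    also have "\<dots> = (\<Sum>j\<le>N. ?b j * \<sigma> j)"
      by (rule sum.mono_neutral_right[OF J]) (use that in auto)
    finally show ?thesis .
  qed
  then show ?thesis by (intro exI[of _ ?b]) simp
qed

text \<open>The points \<open>w(y) = y + \<beta>(y) v + \<alpha>(y) e\<close> depend linearly on \<open>y\<close>, and \<open>y\<close> is determined by \<open>w(y)\<close>
  modulo the plane spanned by \<open>e\<close> and \<open>v\<close>.\<close>

lemma linear_space_of_singular_points:
  fixes f :: "'k::field mpoly"
  assumes f: "f \<in> forms {..N} 3" and N: "N \<ge> 2"
    and \<alpha>: "\<alpha> \<in> forms UNIV 1" and \<beta>: "\<beta> \<in> forms UNIV 1"
    and indep: "\<And>s t. (\<And>i. i \<le> N \<Longrightarrow> s * e i + t * v i = 0) \<Longrightarrow> s = 0 \<and> t = 0"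
    and fw: "meval const (\<lambda>i. xvar i + \<beta> * const (v i) + \<alpha> * const (e i)) f = 0"
    and dw: "\<And>j. j \<le> N \<Longrightarrow> meval const (\<lambda>i. xvar i + \<beta> * const (v i) + \<alpha> * const (e i)) (pdiff j f) = 0"
  obtains S where "linear_space N (N - 2) S" "S \<subseteq> sing_locus N f"
proof -
  let ?w = "\<lambda>i. xvar i + \<beta> * const (v i) + \<alpha> * const (e i)"
  obtain a where a: "\<forall>\<sigma>. (\<forall>i>N. \<sigma> i = 0) \<longrightarrow> meval (\<lambda>c. c) \<sigma> \<alpha> = (\<Sum>j\<le>N. a j * \<sigma> j)"
    using linear_form_eval[OF \<alpha>, of N] ..
  obtain b where b: "\<forall>\<sigma>. (\<forall>i>N. \<sigma> i = 0) \<longrightarrow> meval (\<lambda>c. c) \<sigma> \<beta> = (\<Sum>j\<le>N. b j * \<sigma> j)"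
    using linear_form_eval[OF \<beta>, of N] ..
  define W where "W = (\<lambda>y::'k vec. vec (N + 1) (\<lambda>i. y $ i + (\<Sum>j\<le>N. b j * y $ j) * v i + (\<Sum>j\<le>N. a j * y $ j) * e i))"
  have peW: "peval g (W y) = 0" if g: "g \<in> polys {..N}" "meval const ?w g = 0" for g y
  proof -
    define \<sigma> where "\<sigma> = (\<lambda>i. if i \<le> N then y $ i else 0)"
    have \<sigma>0: "\<forall>i>N. \<sigma> i = 0" by (simp add: \<sigma>_def)
    let ?h = "meval (\<lambda>c. c) \<sigma>"
    have h: "comm_ring_hom ?h" by (rule comm_ring_hom_meval[OF comm_ring_hom_id])
    interpret h: comm_ring_hom ?h by (fact h)
    have "?h (?w i) = W y $ i" if "i \<le> N" for i
      using that by (simp add: h.hom_add h.hom_mult meval_const[OF comm_ring_hom_id] meval_xvar[OF comm_ring_hom_id]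
          a[rule_format, OF \<sigma>0[rule_format]] b[rule_format, OF \<sigma>0[rule_format]] W_def) (simp add: \<sigma>_def)
    then have "peval g (W y) = meval (\<lambda>c. c) (\<lambda>i. ?h (?w i)) g"
      by (intro peval_cong[OF g(1)]) simp
    also have "\<dots> = ?h (meval const ?w g)"
      unfolding hom_meval[OF h] by (rule meval_ext) (simp_all add: meval_const[OF comm_ring_hom_id])
    finally show ?thesis using g(2) h.hom_zero by simp
  qed
  \<comment> \<open>The vectors e and v become the first two columns of an invertible
    \<open>M\<close>; its other columns span a complement of their plane, on which w turns out to be
    injective.\<close>
  define B0 where "B0 = mat (N + 1) 2 (\<lambda>(i, j). if j = 0 then e i else v i)"
  have B0: "B0 \<in> carrier_mat (N + 1) 2" by (simp add: B0_def)
  have "x = 0\<^sub>v 2" if x: "x \<in> carrier_vec 2" "B0 *\<^sub>v x = 0\<^sub>v (N + 1)" for x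
  proof -
    have "x $ 0 * e i + x $ 1 * v i = 0" if "i \<le> N" for i
    proof -
      have "(B0 *\<^sub>v x) $ i = x $ 0 * e i + x $ 1 * v i"
        using that x(1) by (simp add: B0_def scalar_prod_def atLeast0LessThan numeral_2_eq_2 mult.commute)
      then show ?thesis using x(2) that by simp
    qed
    then have "x $ 0 = 0" "x $ 1 = 0" using indep by blast+
    then show ?thesis using x(1) by (intro eq_vecI) (auto simp: numeral_2_eq_2 less_Suc_eq)
  qed
  from extend_to_invertible[OF B0 this] obtain M where
    M: "M \<in> carrier_mat (N + 1) (N + 1)" "det M \<noteq> 0" "\<forall>i<N + 1. \<forall>j<2. M $$ (i, j) = B0 $$ (i, j)" by blast
  define L where "L = mat (N + 1) (N + 1) (\<lambda>(i, j). (if i = j then 1 else 0) + b j * v i + a j * e i)"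
  have L: "L \<in> carrier_mat (N + 1) (N + 1)" by (simp add: L_def)
  have Ly: "L *\<^sub>v y = W y" if y: "y \<in> carrier_vec (N + 1)" for y
  proof (rule eq_vecI)
    fix i assume "i < dim_vec (W y)"
    then have i: "i < N + 1" by (simp add: W_def)
    have "(L *\<^sub>v y) $ i = (\<Sum>j\<le>N. ((if i = j then 1 else 0) + b j * v i + a j * e i) * y $ j)"
      using i y by (simp add: L_def scalar_prod_def atLeast0LessThan lessThan_Suc_atMost)
    also have "\<dots> = (\<Sum>j\<le>N. if i = j then y $ j else 0) + (\<Sum>j\<le>N. b j * y $ j) * v i + (\<Sum>j\<le>N. a j * y $ j) * e i"
      unfolding sum_distrib_right sum.distrib[symmetric] by (rule sum.cong) (simp_all add: algebra_simps)
    also have "\<dots> = W y $ i" using i by (simp add: W_def)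
    finally show "(L *\<^sub>v y) $ i = W y $ i" .
  qed (simp add: L_def W_def)
  let ?pad = "\<lambda>c. vec (N + 1) (\<lambda>i. if i < 2 then 0 else c $ (i - 2))"
  \<comment> \<open>The columns of \<open>L * M\<close> from index 2 on are the images under w of
    the complement. There are N - 1 of them, as befits a projective space of dimension N -
    2.\<close>
  define B where "B = mat (N + 1) (N - 2 + 1) (\<lambda>(i, k). (L * M) $$ (i, k + 2))"
  have B: "B \<in> carrier_mat (N + 1) (N - 2 + 1)" by (simp add: B_def)
  have LM: "L * M \<in> carrier_mat (N + 1) (N + 1)" using L M(1) by simp
  have NN: "N + 1 = Suc (Suc (N - 2 + 1))" using N by simp
  have Qpad: "(Q *\<^sub>v ?pad c) $ i = (\<Sum>j<N - 2 + 1. Q $$ (i, Suc (Suc j)) * c $ j)"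
    if "Q \<in> carrier_mat (N + 1) (N + 1)" "i < N + 1" for Q :: "'k mat" and c i
  proof -
    have "(Q *\<^sub>v ?pad c) $ i = (\<Sum>j<N + 1. Q $$ (i, j) * (if j < 2 then 0 else c $ (j - 2)))"
      using that by (simp add: scalar_prod_def atLeast0LessThan)
    then show ?thesis unfolding NN sum.lessThan_Suc_shift by simp
  qed
  have Bc: "B *\<^sub>v c = W (M *\<^sub>v ?pad c)" if c: "c \<in> carrier_vec (N - 2 + 1)" for c
  proof -
    have "B *\<^sub>v c = (L * M) *\<^sub>v ?pad c"
    proof (rule eq_vecI)
      fix i assume "i < dim_vec ((L * M) *\<^sub>v ?pad c)"
      then have i: "i < N + 1" using L by simp
      have "((L * M) *\<^sub>v ?pad c) $ i = (\<Sum>j<N - 2 + 1. (L * M) $$ (i, Suc (Suc j)) * c $ j)"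
        by (rule Qpad[OF LM i])
      also have "\<dots> = (B *\<^sub>v c) $ i"
        using i c by (simp add: B_def scalar_prod_def atLeast0LessThan del: index_mult_mat(1))
      finally show "(B *\<^sub>v c) $ i = ((L * M) *\<^sub>v ?pad c) $ i" by simp
    qed (use B LM L in simp)
    also have "\<dots> = L *\<^sub>v (M *\<^sub>v ?pad c)" by (rule assoc_mult_mat_vec[OF L M(1)]) simp
    also have "\<dots> = W (M *\<^sub>v ?pad c)" using M(1) by (intro Ly) simp
    finally show ?thesis .
  qed
  have ker: "c = 0\<^sub>v (N - 2 + 1)" if c: "c \<in> carrier_vec (N - 2 + 1)" and z: "B *\<^sub>v c = 0\<^sub>v (N + 1)" for c
  proof -
    let ?y = "M *\<^sub>v ?pad c"
    \<comment> \<open>These are the coordinates of \<open>W ?y\<close> in the basis formed by the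
      columns of \<open>M\<close>: the terms along e and v occupy the first two places, and
      \<open>c\<close> the others. So W(y) = 0 forces c = 0.\<close>
    let ?x = "vec (N + 1) (\<lambda>i. if i = 0 then (\<Sum>j\<le>N. a j * ?y $ j) else if i = 1 then (\<Sum>j\<le>N. b j * ?y $ j) else c $ (i - 2))"
    have "M *\<^sub>v ?x = 0\<^sub>v (N + 1)"
    proof (rule eq_vecI)
      fix i assume "i < dim_vec (0\<^sub>v (N + 1))"
      then have i: "i < N + 1" by simp
      have yi: "?y $ i = (\<Sum>j<N - 2 + 1. M $$ (i, Suc (Suc j)) * c $ j)"
        by (rule Qpad[OF M(1) i])
      have "(M *\<^sub>v ?x) $ i = (\<Sum>j<N + 1. M $$ (i, j) * (if j = 0 then (\<Sum>j\<le>N. a j * ?y $ j) else if j = 1 then (\<Sum>j\<le>N. b j * ?y $ j) else c $ (j - 2)))"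
        using i M(1) by (simp add: scalar_prod_def atLeast0LessThan)
      also have "\<dots> = M $$ (i, 0) * (\<Sum>j\<le>N. a j * ?y $ j) + (M $$ (i, 1) * (\<Sum>j\<le>N. b j * ?y $ j)
          + (\<Sum>j<N - 2 + 1. M $$ (i, Suc (Suc j)) * c $ j))"
        unfolding NN sum.lessThan_Suc_shift by simp
      also have "\<dots> = W ?y $ i"
        using i M(3) yi by (simp add: W_def B0_def algebra_simps)
      also have "\<dots> = 0" unfolding Bc[OF c, symmetric] z using i by simp
      finally show "(M *\<^sub>v ?x) $ i = 0\<^sub>v (N + 1) $ i" using i by simp
    qed (use M(1) in simp)
    then have x0: "?x = 0\<^sub>v (N + 1)"
      using det_0_iff_vec_prod_zero_field[OF M(1)] M(2) by (meson vec_carrier)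
    show ?thesis
    proof (rule eq_vecI)
      fix k assume "k < dim_vec (0\<^sub>v (N - 2 + 1))"
      then have k: "k < N - 2 + 1" by simp
      have "?x $ (k + 2) = 0" unfolding x0 using k N by simp
      then show "c $ k = 0\<^sub>v (N - 2 + 1) $ k" using k N by simp
    qed (use c in simp)
  qed
  have inj: "inj_on ((*\<^sub>v) B) (carrier_vec (N - 2 + 1))"
  proof (rule inj_onI)
    fix c c' assume c: "c \<in> carrier_vec (N - 2 + 1)" "c' \<in> carrier_vec (N - 2 + 1)" "B *\<^sub>v c = B *\<^sub>v c'"
    have "B *\<^sub>v (c - c') = B *\<^sub>v c - B *\<^sub>v c'" by (rule mult_minus_distrib_mat_vec[OF B c(1,2)])
    also have "\<dots> = 0\<^sub>v (N + 1)" unfolding c(3) using B c(2) by (intro eq_vecI) auto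
    finally have "c - c' = 0\<^sub>v (N - 2 + 1)" by (rule ker[rotated]) (use c in simp)
    then have "(c - c') $ i = 0" if "i < N - 2 + 1" for i using that by simp
    then show "c = c'" using c(1,2) by (intro eq_vecI) auto
  qed
  let ?S = "(*\<^sub>v) B ` proj_space (N - 2)"
  have "linear_space N (N - 2) ?S" unfolding linear_space_def using B inj by blast
  moreover have "?S \<subseteq> sing_locus N f"
  proof
    fix y assume "y \<in> ?S"
    then obtain c where c: "c \<in> carrier_vec (N - 2 + 1)" "c \<noteq> 0\<^sub>v (N - 2 + 1)" "y = B *\<^sub>v c"
      by (auto simp: proj_space_def)
    have y: "y \<in> carrier_vec (N + 1)" "y \<noteq> 0\<^sub>v (N + 1)" using c B ker[OF c(1)] by auto
    have yW: "y = W (M *\<^sub>v ?pad c)" unfolding c(3) by (rule Bc[OF c(1)])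
    have "f \<in> polys {..N}" using f forms_subset_polys by blast
    then have "peval f y = 0" unfolding yW by (rule peW[OF _ fw])
    moreover have "peval (pdiff i f) y = 0" if "i \<le> N" for i
    proof -
      have "pdiff i f \<in> polys {..N}" using forms_pdiff[of f "{..N}" 2 i] f forms_subset_polys by (auto simp: numeral_3_eq_3)
      then show ?thesis unfolding yW by (rule peW[OF _ dw[OF that]])
    qed
    ultimately show "y \<in> sing_locus N f" using y by (simp add: sing_locus_def hypersurface_def proj_space_def)
  qed
  ultimately show ?thesis using that by blast
qed

text \<open>Setting the variables beyond \<open>N\<close> to zero fixes \<open>f\<close>,
  \<open>b\<close> and \<open>u\<close>, so \<open>r\<close> may be taken in x_0, ..., x_N. Since
  \<open>f\<close> is homogeneous, it divides the component of degree m + d, in which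
  \<open>r\<close> enters only through its component of degree m.\<close>

lemma dvd_hscale_component:
  assumes f: "f \<in> forms {..N} k" and b: "b \<in> forms {..N} d" and u: "u \<in> forms {..N} (m + d)"
    and dvd: "f dvd u - b * r"
  obtains r' where "r' \<in> forms {..N} m" "f dvd u - b * (r' :: 'k::comm_ring_1 mpoly)"
proof -
  let ?\<psi> = "meval const (\<lambda>i. if i \<le> N then xvar i else 0 :: 'k mpoly)"
  interpret \<psi>: comm_ring_hom ?\<psi> by (rule comm_ring_hom_meval[OF comm_ring_hom_const])
  have keep: "?\<psi> g = g" if "g \<in> polys {..N}" for g
  proof -
    have "?\<psi> g = meval const xvar g" by (rule meval_cong[OF that]) simp
    then show ?thesis by simp
  qed
  have pol: "f \<in> polys {..N}" "b \<in> polys {..N}" "u \<in> polys {..N}"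
    using f b u forms_subset_polys by blast+
  have range: "?\<psi> g \<in> polys {..N}" for g
  proof -
    have "g \<in> polys UNIV" by simp
    then show ?thesis
    proof (induction g rule: polys_induct)
      case (const c)
      then show ?case by (simp add: meval_const[OF comm_ring_hom_const])
    next
      case (xvar i)
      then show ?case by (simp add: meval_xvar[OF comm_ring_hom_const])
    next
      case (add p q)
      then show ?case by (simp add: \<psi>.hom_add polys_add)
    next
      case (mult p q)
      then show ?case by (simp add: \<psi>.hom_mult polys_mult)
    qed
  qed
  have "?\<psi> f dvd ?\<psi> (u - b * r)" by (rule \<psi>.hom_dvd[OF dvd])
  then have "f dvd u - b * ?\<psi> r" by (simp add: \<psi>.hom_minus \<psi>.hom_mult keep pol)
  then have "hscale f dvd hscale (u - b * ?\<psi> r)" by (rule hscale.hom_dvd)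
  then obtain w where w: "hscale (u - b * ?\<psi> r) = hscale f * w" by (rule dvdE)
  have "poly.coeff (hscale (u - b * ?\<psi> r)) (m + d) = u - b * poly.coeff (hscale (?\<psi> r)) m"
    unfolding hscale.hom_minus hscale.hom_mult hscale_forms[OF u] hscale_forms[OF b]
    by (simp add: coeff_monom_mult)
  moreover have "poly.coeff (hscale f * w) (m + d) = (if m + d < k then 0 else f * poly.coeff w (m + d - k))"
    unfolding hscale_forms[OF f] by (simp add: coeff_monom_mult)
  then have "f dvd poly.coeff (hscale f * w) (m + d)" by (simp split: if_splits)
  ultimately have "f dvd u - b * poly.coeff (hscale (?\<psi> r)) m" unfolding w by simp
  then show ?thesis using that coeff_hscale_forms[OF range] by blast
qed

section \<open>The function field as a residue ring, computed with fractions of forms\<close>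

locale prime_form =
  fixes N :: nat and f :: "'k::field mpoly"
  assumes prime: "\<And>u w. f dvd u * w \<Longrightarrow> f dvd u \<or> f dvd w" and nonunit: "\<not> f dvd 1"
begin

abbreviation "R \<equiv> generic_local_ring N f"
abbreviation "I \<equiv> generic_ideal N f"

lemma not_dvd_mult: "\<not> f dvd u \<Longrightarrow> \<not> f dvd w \<Longrightarrow> \<not> f dvd u * w"
  using prime by blast

lemma ring_simps [simp]: "x \<otimes>\<^bsub>R\<^esub> y = x * y" "\<one>\<^bsub>R\<^esub> = 1" "\<zero>\<^bsub>R\<^esub> = 0" "x \<oplus>\<^bsub>R\<^esub> y = x + y"
  by (simp_all add: generic_local_ring_def)

lemma carrierI:
  "a \<in> forms {..N} d \<Longrightarrow> b \<in> forms {..N} d \<Longrightarrow> \<not> f dvd b \<Longrightarrow> Fract a b \<in> carrier R"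
  by (auto simp: generic_local_ring_def)

lemma carrierE:
  assumes "x \<in> carrier R"
  obtains a b d where "x = Fract a b" "a \<in> forms {..N} d" "b \<in> forms {..N} d" "\<not> f dvd b" "b \<noteq> 0"
proof -
  from assms obtain a b d where *: "x = Fract a b" "a \<in> forms {..N} d" "b \<in> forms {..N} d" "\<not> f dvd b"
    by (auto simp: generic_local_ring_def)
  then have "b \<noteq> 0" by auto
  with * show ?thesis using that by blast
qed

lemma idealI':
  "a \<in> forms {..N} d \<Longrightarrow> b \<in> forms {..N} d \<Longrightarrow> f dvd a \<Longrightarrow> \<not> f dvd b \<Longrightarrow> Fract a b \<in> I"
  unfolding generic_ideal_def by blast

lemma idealE:
  assumes "x \<in> I"
  obtains a b d where "x = Fract a b" "a \<in> forms {..N} d" "b \<in> forms {..N} d" "f dvd a" "\<not> f dvd b" "b \<noteq> 0"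
proof -
  from assms obtain a b d where *: "x = Fract a b" "a \<in> forms {..N} d" "b \<in> forms {..N} d" "f dvd a" "\<not> f dvd b"
    unfolding generic_ideal_def by blast
  then have "b \<noteq> 0" by auto
  with * show ?thesis using that by blast
qed

lemma add_closed:
  assumes "x \<in> carrier R" "y \<in> carrier R"
  shows "x + y \<in> carrier R"
proof -
  obtain a b d where x: "x = Fract a b" "a \<in> forms {..N} d" "b \<in> forms {..N} d" "\<not> f dvd b" "b \<noteq> 0"
    using assms(1) by (rule carrierE)
  obtain a' b' d' where y: "y = Fract a' b'" "a' \<in> forms {..N} d'" "b' \<in> forms {..N} d'" "\<not> f dvd b'" "b' \<noteq> 0"
    using assms(2) by (rule carrierE)
  have "x + y = Fract (a * b' + a' * b) (b * b')" using x y by simp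
  moreover have "a * b' + a' * b \<in> forms {..N} (d + d')"
    using forms_mult[OF x(2) y(3)] forms_mult[OF y(2) x(3)] by (intro forms_add) (simp_all add: add.commute)
  ultimately show ?thesis
    using carrierI[OF _ forms_mult[OF x(3) y(3)] not_dvd_mult[OF x(4) y(4)]] by simp
qed

lemma mult_closed:
  assumes "x \<in> carrier R" "y \<in> carrier R"
  shows "x * y \<in> carrier R"
proof -
  obtain a b d where x: "x = Fract a b" "a \<in> forms {..N} d" "b \<in> forms {..N} d" "\<not> f dvd b" "b \<noteq> 0"
    using assms(1) by (rule carrierE)
  obtain a' b' d' where y: "y = Fract a' b'" "a' \<in> forms {..N} d'" "b' \<in> forms {..N} d'" "\<not> f dvd b'" "b' \<noteq> 0"
    using assms(2) by (rule carrierE)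
  have "x * y = Fract (a * a') (b * b')" using x y by simp
  then show ?thesis
    using carrierI[OF forms_mult[OF x(2) y(2)] forms_mult[OF x(3) y(3)] not_dvd_mult[OF x(4) y(4)]] by simp
qed

lemma uminus_closed:
  assumes "x \<in> carrier R"
  shows "- x \<in> carrier R"
proof -
  obtain a b d where x: "x = Fract a b" "a \<in> forms {..N} d" "b \<in> forms {..N} d" "\<not> f dvd b" "b \<noteq> 0"
    using assms by (rule carrierE)
  have "- x = Fract (- a) b" using x by simp
  then show ?thesis using carrierI[OF forms_uminus[OF x(2)] x(3,4)] by simp
qed

lemma one_closed: "1 \<in> carrier R" and zero_closed: "0 \<in> carrier R"
  using carrierI[of 1 0 1] carrierI[of 0 0 1] nonunit by (simp_all add: One_fract_def Zero_fract_def)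

lemma cring_R: "cring R"
proof (rule cringI)
  show "abelian_group R"
  proof (rule abelian_groupI)
    fix x assume "x \<in> carrier R"
    then show "\<exists>y\<in>carrier R. y \<oplus>\<^bsub>R\<^esub> x = \<zero>\<^bsub>R\<^esub>"
      using uminus_closed by (intro bexI[of _ "- x"]) simp_all
  qed (use add_closed zero_closed in \<open>simp_all add: add_ac\<close>)
  show "comm_monoid R"
    by (rule comm_monoidI) (use mult_closed one_closed in \<open>simp_all add: mult_ac\<close>)
qed (simp add: distrib_right)

sublocale R: cring R by (rule cring_R)

lemma minus_R: "x \<in> carrier R \<Longrightarrow> y \<in> carrier R \<Longrightarrow> x \<ominus>\<^bsub>R\<^esub> y = x - y"
  using R.minus_equality[of "- y" y] uminus_closed[of y] by (simp add: a_minus_def)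

lemma ideal_I: "ideal I R"
proof (rule idealI)
  show "ring R" by (rule R.ring_axioms)
  show "subgroup I (add_monoid R)"
  proof (rule group.subgroupI)
    show "group (add_monoid R)" by (rule R.add.group_axioms)
    show "I \<subseteq> carrier (add_monoid R)"
    proof
      fix x assume "x \<in> I"
      then obtain a b d where "x = Fract a b" "a \<in> forms {..N} d" "b \<in> forms {..N} d" "f dvd a" "\<not> f dvd b" "b \<noteq> 0"
        by (rule idealE)
      then show "x \<in> carrier (add_monoid R)" using carrierI by simp
    qed
    show "I \<noteq> {}" using idealI'[of 0 0 1] nonunit by auto
  next
    fix x assume "x \<in> I"
    then obtain a b d where x: "x = Fract a b" "a \<in> forms {..N} d" "b \<in> forms {..N} d" "f dvd a" "\<not> f dvd b" "b \<noteq> 0"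
      by (rule idealE)
    have "x \<in> carrier R" using x carrierI by simp
    then have "inv\<^bsub>add_monoid R\<^esub> x = - x"
      using R.minus_equality[of "- x" x] uminus_closed[of x] by (simp add: a_inv_def)
    also have "\<dots> = Fract (- a) b" using x by simp
    also have "\<dots> \<in> I" using x by (intro idealI'[OF forms_uminus]) simp_all
    finally show "inv\<^bsub>add_monoid R\<^esub> x \<in> I" .
  next
    fix x y assume "x \<in> I" "y \<in> I"
    obtain a b d where x: "x = Fract a b" "a \<in> forms {..N} d" "b \<in> forms {..N} d" "f dvd a" "\<not> f dvd b" "b \<noteq> 0"
      using \<open>x \<in> I\<close> by (rule idealE)
    obtain a' b' d' where y: "y = Fract a' b'" "a' \<in> forms {..N} d'" "b' \<in> forms {..N} d'" "f dvd a'" "\<not> f dvd b'" "b' \<noteq> 0"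
      using \<open>y \<in> I\<close> by (rule idealE)
    have "x + y = Fract (a * b' + a' * b) (b * b')" using x y by simp
    moreover have "a * b' + a' * b \<in> forms {..N} (d + d')"
      using forms_mult[OF x(2) y(3)] forms_mult[OF y(2) x(3)] by (intro forms_add) (simp_all add: add.commute)
    moreover have "f dvd a * b' + a' * b" using x(4) y(4) by simp
    ultimately have "x + y \<in> I"
      using idealI'[OF _ forms_mult[OF x(3) y(3)] _ not_dvd_mult[OF x(5) y(5)]] by simp
    then show "x \<otimes>\<^bsub>add_monoid R\<^esub> y \<in> I" by simp
  qed
next
  have closed: "z * x \<in> I" if "x \<in> I" "z \<in> carrier R" for x z
  proof -
    obtain a b d where x: "x = Fract a b" "a \<in> forms {..N} d" "b \<in> forms {..N} d" "f dvd a" "\<not> f dvd b" "b \<noteq> 0"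
      using \<open>x \<in> I\<close> by (rule idealE)
    obtain a' b' d' where z: "z = Fract a' b'" "a' \<in> forms {..N} d'" "b' \<in> forms {..N} d'" "\<not> f dvd b'" "b' \<noteq> 0"
      using \<open>z \<in> carrier R\<close> by (rule carrierE)
    have "z * x = Fract (a' * a) (b' * b)" using x z by simp
    then show ?thesis
      using idealI'[OF forms_mult[OF z(2) x(2)] forms_mult[OF z(3) x(3)] _ not_dvd_mult[OF z(4) x(5)]] x(4) by simp
  qed
  fix x z assume "x \<in> I" "z \<in> carrier R"
  from closed[OF this] show "z \<otimes>\<^bsub>R\<^esub> x \<in> I" "x \<otimes>\<^bsub>R\<^esub> z \<in> I" by (simp_all add: mult.commute)
qed

sublocale I: ideal I R by (rule ideal_I)

sublocale \<pi>: ring_hom_cring R "function_field N f" "(+>\<^bsub>R\<^esub>) I"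
  unfolding function_field_def by (rule I.rcos_ring_hom_cring[OF cring_R])

lemma coset_eq_I_iff:
  assumes "x \<in> carrier R" "I +>\<^bsub>R\<^esub> x = I"
  shows "x \<in> I"
  using I.a_rcos_self[OF assms(1)] assms(2) by simp

lemma pow_R: "x \<in> carrier R \<Longrightarrow> x [^]\<^bsub>R\<^esub> (n::nat) = x ^ n"
  by (induction n) (simp_all add: mult.commute)

lemma finsum_R: "finite A \<Longrightarrow> g \<in> A \<rightarrow> carrier R \<Longrightarrow> finsum R g A = sum g A"
  by (induction A rule: finite_induct) (simp_all add: Pi_def)

text \<open>Choosing representatives lifts the equation from the residue field to fractions; being
  zero in the quotient becomes membership in \<open>I\<close>.\<close>

lemma integral_over_unfold:
  assumes y: "y \<in> carrier R" and int: "integral_over (function_field N f) (local_ring_at N f p) (I +>\<^bsub>R\<^esub> y)"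
    and fp: "peval f p = 0"
  shows "\<exists>n \<alpha> \<beta> \<delta>.
    (\<forall>k<n. \<alpha> k \<in> forms {..N} (\<delta> k) \<and> \<beta> k \<in> forms {..N} (\<delta> k) \<and> peval (\<beta> k) p \<noteq> 0 \<and> \<not> f dvd \<beta> k) \<and>
    y ^ n + (\<Sum>k<n. Fract (\<alpha> k) (\<beta> k) * y ^ k) \<in> I"
proof -
  let ?Q = "function_field N f"
  obtain n c where c: "c \<in> {..<n} \<rightarrow> local_ring_at N f p"
    and rel: "(I +>\<^bsub>R\<^esub> y) [^]\<^bsub>?Q\<^esub> (n::nat) \<oplus>\<^bsub>?Q\<^esub> (\<Oplus>\<^bsub>?Q\<^esub>k\<in>{..<n}. c k \<otimes>\<^bsub>?Q\<^esub> (I +>\<^bsub>R\<^esub> y) [^]\<^bsub>?Q\<^esub> k) = \<zero>\<^bsub>?Q\<^esub>"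
    using int unfolding integral_over_def by blast
  interpret peval_hom: comm_ring_hom "\<lambda>g. peval g p" by (rule comm_ring_hom_peval)
  \<comment> \<open>The point lies on X, so a denominator that does not vanish there is not
    divisible by \<open>f\<close>. Hence the chosen representatives lie in \<open>R\<close>.\<close>
  have nd: "\<not> f dvd b" if "peval b p \<noteq> 0" for b
  proof
    assume "f dvd b"
    then obtain w where "b = f * w" ..
    then show False using that fp by (simp add: peval_hom.hom_mult)
  qed
  have "\<forall>k. \<exists>a b d. k < n \<longrightarrow> c k = I +>\<^bsub>R\<^esub> Fract a b \<and> a \<in> forms {..N} d \<and> b \<in> forms {..N} d \<and> peval b p \<noteq> 0"
  proof
    fix k
    show "\<exists>a b d. k < n \<longrightarrow> c k = I +>\<^bsub>R\<^esub> Fract a b \<and> a \<in> forms {..N} d \<and> b \<in> forms {..N} d \<and> peval b p \<noteq> 0"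
    proof (cases "k < n")
      case True
      then have "c k \<in> local_ring_at N f p" using c by auto
      then show ?thesis unfolding local_ring_at_def by blast
    qed simp
  qed
  then obtain \<alpha> \<beta> \<delta> where "\<forall>k. k < n \<longrightarrow> c k = I +>\<^bsub>R\<^esub> Fract (\<alpha> k) (\<beta> k) \<and> \<alpha> k \<in> forms {..N} (\<delta> k)
      \<and> \<beta> k \<in> forms {..N} (\<delta> k) \<and> peval (\<beta> k) p \<noteq> 0"
    by metis
  then have ab: "c k = I +>\<^bsub>R\<^esub> Fract (\<alpha> k) (\<beta> k)" "\<alpha> k \<in> forms {..N} (\<delta> k)" "\<beta> k \<in> forms {..N} (\<delta> k)"
    "peval (\<beta> k) p \<noteq> 0" if "k < n" for k
    using that by blast+
  have cR: "Fract (\<alpha> k) (\<beta> k) \<in> carrier R" if "k < n" for k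
    by (rule carrierI[OF ab(2,3)[OF that] nd[OF ab(4)[OF that]]])
  have yk: "y ^ k \<in> carrier R" for k using R.nat_pow_closed[OF y, of k] pow_R[OF y] by simp
  let ?g = "\<lambda>k. Fract (\<alpha> k) (\<beta> k) \<otimes>\<^bsub>R\<^esub> y [^]\<^bsub>R\<^esub> k"
  have g: "?g \<in> {..<n} \<rightarrow> carrier R"
  proof
    show "?g k \<in> carrier R" if "k \<in> {..<n}" for k
      using R.m_closed[OF cR R.nat_pow_closed[OF y]] that by (simp only: lessThan_iff)
  qed
  have "I +>\<^bsub>R\<^esub> (y [^]\<^bsub>R\<^esub> n \<oplus>\<^bsub>R\<^esub> finsum R ?g {..<n})
      = (I +>\<^bsub>R\<^esub> y) [^]\<^bsub>?Q\<^esub> n \<oplus>\<^bsub>?Q\<^esub> (\<Oplus>\<^bsub>?Q\<^esub>k\<in>{..<n}. c k \<otimes>\<^bsub>?Q\<^esub> (I +>\<^bsub>R\<^esub> y) [^]\<^bsub>?Q\<^esub> k)"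
  proof -
    have pw: "I +>\<^bsub>R\<^esub> (y [^]\<^bsub>R\<^esub> k) = (I +>\<^bsub>R\<^esub> y) [^]\<^bsub>?Q\<^esub> k" for k :: nat
      by (induction k) (simp_all only: Group.nat_pow_0 Group.nat_pow_Suc \<pi>.hom_one \<pi>.hom_mult[OF R.nat_pow_closed[OF y] y])
    have "I +>\<^bsub>R\<^esub> (y [^]\<^bsub>R\<^esub> n \<oplus>\<^bsub>R\<^esub> finsum R ?g {..<n})
        = (I +>\<^bsub>R\<^esub> (y [^]\<^bsub>R\<^esub> n)) \<oplus>\<^bsub>?Q\<^esub> (I +>\<^bsub>R\<^esub> finsum R ?g {..<n})"
      by (rule \<pi>.hom_add[OF R.nat_pow_closed[OF y] R.finsum_closed[OF g]])
    also have "I +>\<^bsub>R\<^esub> finsum R ?g {..<n} = finsum ?Q (((+>\<^bsub>R\<^esub>) I) \<circ> ?g) {..<n}"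
      by (rule \<pi>.hom_finsum[OF g])
    also have "\<dots> = (\<Oplus>\<^bsub>?Q\<^esub>k\<in>{..<n}. c k \<otimes>\<^bsub>?Q\<^esub> (I +>\<^bsub>R\<^esub> y) [^]\<^bsub>?Q\<^esub> k)"
    proof (rule \<pi>.S.finsum_cong')
      show "(\<lambda>k. c k \<otimes>\<^bsub>?Q\<^esub> (I +>\<^bsub>R\<^esub> y) [^]\<^bsub>?Q\<^esub> k) \<in> {..<n} \<rightarrow> carrier ?Q"
      proof
        fix k assume "k \<in> {..<n}"
        then have k: "k < n" by simp
        show "c k \<otimes>\<^bsub>?Q\<^esub> (I +>\<^bsub>R\<^esub> y) [^]\<^bsub>?Q\<^esub> k \<in> carrier ?Q"
          unfolding ab(1)[OF k] by (intro \<pi>.S.m_closed \<pi>.S.nat_pow_closed \<pi>.hom_closed cR[OF k] y)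
      qed
      fix k assume "k \<in> {..<n}"
      then have k: "k < n" by simp
      then have "(((+>\<^bsub>R\<^esub>) I) \<circ> ?g) k = (I +>\<^bsub>R\<^esub> Fract (\<alpha> k) (\<beta> k)) \<otimes>\<^bsub>?Q\<^esub> (I +>\<^bsub>R\<^esub> (y [^]\<^bsub>R\<^esub> k))"
        unfolding comp_apply by (intro \<pi>.hom_mult cR[OF k] R.nat_pow_closed y)
      then show "(((+>\<^bsub>R\<^esub>) I) \<circ> ?g) k = c k \<otimes>\<^bsub>?Q\<^esub> (I +>\<^bsub>R\<^esub> y) [^]\<^bsub>?Q\<^esub> k"
        unfolding pw ab(1)[OF k] .
    qed simp
    finally show ?thesis unfolding pw .
  qed
  also have "\<dots> = I" unfolding rel by (simp add: function_field_def FactRing_def)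
  finally have "y [^]\<^bsub>R\<^esub> n \<oplus>\<^bsub>R\<^esub> finsum R ?g {..<n} \<in> I"
    by (rule coset_eq_I_iff[rotated]) (intro R.add.m_closed R.nat_pow_closed y R.finsum_closed g)
  moreover have "finsum R ?g {..<n} = (\<Sum>k<n. Fract (\<alpha> k) (\<beta> k) * y ^ k)"
    unfolding finsum_R[OF finite_lessThan g] by (simp add: pow_R[OF y])
  ultimately have "y ^ n + (\<Sum>k<n. Fract (\<alpha> k) (\<beta> k) * y ^ k) \<in> I" by (simp add: pow_R[OF y])
  moreover have "\<forall>k<n. \<alpha> k \<in> forms {..N} (\<delta> k) \<and> \<beta> k \<in> forms {..N} (\<delta> k) \<and> peval (\<beta> k) p \<noteq> 0 \<and> \<not> f dvd \<beta> k"
    using ab(2-4) nd by blast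
  ultimately show ?thesis by blast
qed

text \<open>The fractions a / b and r / s agree modulo the ideal, and the second has a denominator
  that is nonzero at \<open>p\<close>.\<close>

lemma local_ring_at_memI:
  assumes b: "b \<in> forms {..N} d" "a \<in> forms {..N} d" "\<not> f dvd b"
    and s: "s \<in> forms {..N} m" "r \<in> forms {..N} m" "peval s p \<noteq> 0" "\<not> f dvd s" and dvd: "f dvd s * a - b * r"
  shows "I +>\<^bsub>R\<^esub> Fract a b \<in> local_ring_at N f p"
proof -
  have x: "Fract a b \<in> carrier R" by (rule carrierI[OF b(2,1,3)])
  have x': "Fract r s \<in> carrier R" by (rule carrierI[OF s(2,1,4)])
  have nz: "b \<noteq> 0" "s \<noteq> 0" using b(3) s(4) by auto
  have "Fract a b - Fract r s = Fract (a * s - r * b) (b * s)" using nz by simp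
  also have "\<dots> \<in> I"
  proof (rule idealI')
    show "a * s - r * b \<in> forms {..N} (d + m)"
      using forms_mult[OF b(2) s(1)] forms_mult[OF s(2) b(1)] by (intro forms_diff) (simp_all add: add.commute)
    show "b * s \<in> forms {..N} (d + m)" by (rule forms_mult[OF b(1) s(1)])
    show "f dvd a * s - r * b" using dvd by (simp add: mult.commute)
    show "\<not> f dvd b * s" by (rule not_dvd_mult[OF b(3) s(4)])
  qed
  finally have "I +>\<^bsub>R\<^esub> Fract a b = I +>\<^bsub>R\<^esub> Fract r s"
    using R.quotient_eq_iff_same_a_r_cos[OF ideal_I x x'] minus_R[OF x x'] by simp
  then show ?thesis unfolding local_ring_at_def using s by blast
qed

end

context irreducible_cubic
begin

text \<open>\<open>ev\<close> maps into a field with kernel (f), which makes \<open>f\<close>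
  prime.\<close>

lemma prime_form: "prime_form f"
proof
  show "f dvd u \<or> f dvd w" if "f dvd u * w" for u w
    using that unfolding ev_eq_0_iff[symmetric] by (simp add: ev.hom_mult)
  show "\<not> f dvd 1" using irr by (simp add: Factorial_Ring.irreducible_def)
qed

text \<open>Integrality over the local ring at \<open>x\<close> is made global: with
  \<open>s\<close> the product of the denominators of the coefficients, s y is integral over the
  coordinate ring. It is not the class of a polynomial r, for otherwise y = r / s would be regular
  at \<open>x\<close>, where \<open>s\<close> is nonzero.\<close>

lemma singular_linear_space:
  assumes nn: "\<not> normal_hypersurface N f" and N: "N \<ge> 2"
  obtains S where "linear_space N (N - 2) S" "S \<subseteq> sing_locus N f"
proof -
  interpret pf: prime_form N f by (rule prime_form)
  obtain x z where x: "x \<in> hypersurface N f" and z: "z \<in> carrier (function_field N f)"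
    and int: "integral_over (function_field N f) (local_ring_at N f x) z" and zn: "z \<notin> local_ring_at N f x"
    using nn unfolding normal_hypersurface_def by blast
  have fx: "peval f x = 0" using x by (simp add: hypersurface_def)
  obtain y where y: "y \<in> carrier (generic_local_ring N f)" and zy: "z = generic_ideal N f +>\<^bsub>generic_local_ring N f\<^esub> y"
    using z unfolding function_field_def FactRing_def A_RCOSETS_def' by auto
  obtain a0 b0 d0 where ab0: "y = Fract a0 b0" "a0 \<in> forms {..N} d0" "b0 \<in> forms {..N} d0" "\<not> f dvd b0" "b0 \<noteq> 0"
    using y by (rule pf.carrierE)
  obtain n \<alpha> \<beta> \<delta> where
    "\<forall>k<n. \<alpha> k \<in> forms {..N} (\<delta> k) \<and> \<beta> k \<in> forms {..N} (\<delta> k) \<and> peval (\<beta> k) x \<noteq> 0 \<and> \<not> f dvd \<beta> k"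
    and rel: "y ^ n + (\<Sum>k<n. Fract (\<alpha> k) (\<beta> k) * y ^ k) \<in> generic_ideal N f"
    using pf.integral_over_unfold[OF y int[unfolded zy] fx] by (elim exE conjE)
  then have ab: "\<alpha> k \<in> forms {..N} (\<delta> k) \<and> \<beta> k \<in> forms {..N} (\<delta> k) \<and> peval (\<beta> k) x \<noteq> 0 \<and> \<not> f dvd \<beta> k"
    if "k < n" for k
    using that by blast
  define s where "s = (\<Prod>k<n. \<beta> k)"
  define D where "D = (\<Sum>k<n. \<delta> k)"
  define \<gamma> where "\<gamma> = (\<lambda>k. \<Prod>j\<in>{..<n} - {k}. \<beta> j)"
  have s\<gamma>: "s = \<beta> k * \<gamma> k" if "k < n" for k unfolding s_def \<gamma>_def using that by (intro prod.remove) auto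
  have sform: "s \<in> forms {..N} D" unfolding s_def D_def using ab by (intro forms_prod) auto
  interpret px: comm_ring_hom "\<lambda>g. peval g x" by (rule comm_ring_hom_peval)
  have sx: "peval s x \<noteq> 0" unfolding s_def px.hom_prod using ab by (simp add: prod_zero_iff)
  have fs: "\<not> f dvd s"
  proof
    assume "f dvd s"
    then obtain w where "s = f * w" ..
    then show False using sx fx by (simp add: px.hom_mult)
  qed
  have s0: "s \<noteq> 0" using fs by auto
  \<comment> \<open>Multiplying the equation for y by s^n turns it into one for s y, in which the
    k-th coefficient is s^(n-k) times the old one. One factor \<open>s\<close> cancels the
    denominator \<open>\<beta> k\<close> and leaves \<open>\<gamma> k\<close>.\<close>
  define g where "g = (\<lambda>k. s ^ (n - k - 1) * \<gamma> k * \<alpha> k)"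
  define T where "T = (s * a0) ^ n + (\<Sum>k<n. g k * (s * a0) ^ k * b0 ^ (n - k))"
  have TY: "to_fract T = to_fract (s * b0) ^ n * (y ^ n + (\<Sum>k<n. Fract (\<alpha> k) (\<beta> k) * y ^ k))"
  proof -
    have by0: "to_fract a0 = to_fract b0 * y" using ab0 by (simp add: Fract_conv_to_fract)
    have "to_fract (g k * (s * a0) ^ k * b0 ^ (n - k)) = to_fract (s * b0) ^ n * (Fract (\<alpha> k) (\<beta> k) * y ^ k)"
      if k: "k < n" for k
    proof -
      have \<beta>0: "\<beta> k \<noteq> 0" using ab[OF k] by auto
      have \<gamma>\<alpha>: "to_fract (\<gamma> k * \<alpha> k) = to_fract s * Fract (\<alpha> k) (\<beta> k)"
        using \<beta>0 unfolding s\<gamma>[OF k] by (simp add: Fract_conv_to_fract)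
      have "n = Suc (n - k - 1) + k" using k by simp
      then have sn: "to_fract s ^ n = to_fract s ^ (n - k - 1) * to_fract s * to_fract s ^ k"
        by (metis power_Suc2 power_add)
      have bn: "to_fract b0 ^ n = to_fract b0 ^ k * to_fract b0 ^ (n - k)" using k by (simp flip: power_add)
      have "to_fract (g k * (s * a0) ^ k * b0 ^ (n - k))
          = to_fract s ^ (n - k - 1) * to_fract (\<gamma> k * \<alpha> k) * (to_fract s * to_fract a0) ^ k * to_fract b0 ^ (n - k)"
        unfolding g_def by (simp only: to_fract_mult to_fract.hom_power mult.assoc)
      also have "\<dots> = (to_fract s ^ (n - k - 1) * to_fract s * to_fract s ^ k) * (to_fract b0 ^ k * to_fract b0 ^ (n - k))
          * (Fract (\<alpha> k) (\<beta> k) * y ^ k)"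
        unfolding \<gamma>\<alpha> by0 power_mult_distrib by (simp only: mult_ac)
      also have "\<dots> = to_fract (s * b0) ^ n * (Fract (\<alpha> k) (\<beta> k) * y ^ k)"
        unfolding sn[symmetric] bn[symmetric] by (simp only: to_fract_mult power_mult_distrib)
      finally show ?thesis .
    qed
    then have "(\<Sum>k<n. to_fract (g k * (s * a0) ^ k * b0 ^ (n - k))) = to_fract (s * b0) ^ n * (\<Sum>k<n. Fract (\<alpha> k) (\<beta> k) * y ^ k)"
      unfolding sum_distrib_left by (intro sum.cong) auto
    moreover have "to_fract ((s * a0) ^ n) = to_fract (s * b0) ^ n * y ^ n"
      by (simp only: to_fract.hom_power to_fract_mult by0 power_mult_distrib mult_ac)
    ultimately show ?thesis unfolding T_def to_fract_add to_fract_sum by (simp only: distrib_left)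
  qed
  obtain u w m where uw: "y ^ n + (\<Sum>k<n. Fract (\<alpha> k) (\<beta> k) * y ^ k) = Fract u w" "u \<in> forms {..N} m"
    "w \<in> forms {..N} m" "f dvd u" "\<not> f dvd w" "w \<noteq> 0"
    using rel by (rule pf.idealE)
  have "to_fract (T * w) = to_fract ((s * b0) ^ n * u)"
    unfolding to_fract_mult TY uw(1) using uw(6) by (simp add: Fract_conv_to_fract to_fract.hom_power)
  then have "T * w = (s * b0) ^ n * u" by (simp only: to_fract_eq_iff)
  then have "f dvd T * w" using uw(4) by simp
  then have "f dvd T" using pf.prime uw(5) by blast
  then have evT: "ev T = 0" by (simp add: ev_eq_0_iff)
  have evb: "ev b0 \<noteq> 0" using ab0(4) by (simp add: ev_eq_0_iff)
  have root: "(ev (s * a0) / ev b0) ^ n + (\<Sum>k<n. ev (g k) * (ev (s * a0) / ev b0) ^ k) = 0"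
  proof -
    let ?Y = "ev (s * a0) / ev b0"
    have eq: "ev (s * a0) = ev b0 * ?Y" using evb by simp
    have "ev T = (ev b0 * ?Y) ^ n + (\<Sum>k<n. ev (g k) * (ev b0 * ?Y) ^ k * ev b0 ^ (n - k))"
      unfolding T_def ev.hom_add ev.hom_sum eq[symmetric] by (simp only: ev.hom_mult ev.hom_power)
    also have "\<dots> = ev b0 ^ n * (?Y ^ n + (\<Sum>k<n. ev (g k) * ?Y ^ k))" by (rule power_sum_scale)
    finally have "ev b0 ^ n * (?Y ^ n + (\<Sum>k<n. ev (g k) * ?Y ^ k)) = 0" using evT by simp
    then show ?thesis using evb by (simp only: mult_eq_0_iff power_eq_0_iff simp_thms)
  qed
  have nonpoly: "ev (s * a0) / ev b0 \<noteq> ev r" for r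
  proof
    assume "ev (s * a0) / ev b0 = ev r"
    then have "ev (s * a0) = ev b0 * ev r" using evb by (simp add: nonzero_divide_eq_eq mult.commute)
    then have "ev (s * a0 - b0 * r) = 0" by (simp add: ev.hom_minus ev.hom_mult)
    then have "f dvd s * a0 - b0 * r" by (simp add: ev_eq_0_iff)
    \<comment> \<open>A representative in the local ring needs numerator and denominator of equal
      degree, so r is replaced by its component of the degree of \<open>s\<close>.\<close>
    then obtain r' where r': "r' \<in> forms {..N} D" "f dvd s * a0 - b0 * r'"
      by (rule dvd_hscale_component[OF f ab0(3) forms_mult[OF sform ab0(2)]])
    have "z \<in> local_ring_at N f x"
      unfolding zy ab0(1) by (rule pf.local_ring_at_memI[OF ab0(3,2,4) sform r'(1) sx fs r'(2)])
    with zn show False ..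
  qed
  show ?thesis
  proof (rule singular_points[OF evb root nonpoly])
    fix v \<alpha>' \<beta>'
    assume *: "\<alpha>' \<in> forms UNIV 1" "\<beta>' \<in> forms UNIV 1"
      and indep: "\<And>s t. (\<And>i. i \<le> N \<Longrightarrow> s * e i + t * v i = 0) \<Longrightarrow> s = 0 \<and> t = 0"
      and fw: "meval const (\<lambda>i. xvar i + \<beta>' * const (v i) + \<alpha>' * const (e i)) f = 0"
      and dw: "\<And>j. j \<le> N \<Longrightarrow> meval const (\<lambda>i. xvar i + \<beta>' * const (v i) + \<alpha>' * const (e i)) (pdiff j f) = 0"
    show ?thesis
    proof (rule linear_space_of_singular_points[OF f N * indep fw dw])
      show "linear_space N (N - 2) S \<Longrightarrow> S \<subseteq> sing_locus N f \<Longrightarrow> thesis" for S by (rule that)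
    qed assumption+
  qed
qed

end

text \<open>Scaling a point by t multiplies the value by t^d, and d-th roots exist.\<close>

lemma unit_value_exists:
  fixes f :: "'k::{alg_closed_field, field_char_0} mpoly"
  assumes "f \<in> forms V d" "f \<noteq> 0" "d > 0"
  obtains e where "meval (\<lambda>c. c) e f = 1"
proof -
  obtain \<tau> where \<tau>: "meval (\<lambda>c. c) \<tau> f \<noteq> 0" using mpoly_nonroot_exists[OF assms(2)] by blast
  obtain t where t: "t ^ d = inverse (meval (\<lambda>c. c) \<tau> f)" using nth_root_exists[OF assms(3)] by blast
  have "meval (\<lambda>c. c) (\<lambda>i. t * \<tau> i) f = t ^ d * meval (\<lambda>c. c) \<tau> f" by (rule meval_scale_forms[OF assms(1)])
  also have "\<dots> = 1" using t \<tau> by simp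
  finally show ?thesis by (rule that)
qed

text \<open>By the chain rule the partial derivatives of the transformed cubic at a point of the
  coordinate space are combinations of those of \<open>f\<close> at its image in \<open>S\<close>,
  where they vanish.\<close>

lemma singular_space_normal_form:
  fixes f :: "'k::field_char_0 mpoly"
  assumes f: "f \<in> forms {..N} 3" and S: "S \<subseteq> sing_locus N f" and t: "t \<le> N"
    and A: "A \<in> carrier_mat (N + 1) (N + 1)" and AS: "(*\<^sub>v) A ` coord_space N t = S"
  obtains C D where "\<And>i. i \<le> t \<Longrightarrow> C i \<in> forms {t + 1..N} 2" "D \<in> forms {t + 1..N} 3"
    "lin_subst A f = (\<Sum>i\<le>t. xvar i * C i) + D"
proof -
  let ?g = "lin_subst A f"
  have g: "?g \<in> forms {..N} 3" by (rule lin_subst_forms[OF A f])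
  have f0: "f \<in> polys {..N}" using f forms_subset_polys by blast
  have f1: "pdiff i f \<in> polys {..N}" for i
    using forms_pdiff[of f "{..N}" 2 i] f forms_subset_polys by (auto simp: numeral_3_eq_3)
  have sing: "peval (pdiff j ?g) x = 0" if j: "j \<le> N" and x: "x \<in> coord_space N t" for j x
  proof -
    have xc: "x \<in> carrier_vec (N + 1)" using x by (simp add: coord_space_def proj_space_def)
    have "A *\<^sub>v x \<in> sing_locus N f" using x AS S by blast
    then have s: "peval (pdiff i f) (A *\<^sub>v x) = 0" if "i \<le> N" for i using that by (simp add: sing_locus_def)
    interpret p: comm_ring_hom "\<lambda>g. peval g x" by (rule comm_ring_hom_peval)
    have "peval (pdiff j ?g) x = (\<Sum>i\<le>N. peval (const (A $$ (i, j))) x * peval (pdiff i f) (A *\<^sub>v x))"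
      unfolding pdiff_lin_subst[OF A f0 j] p.hom_sum p.hom_mult peval_lin_subst[OF A xc f1] ..
    then show ?thesis using s by simp
  qed
  have low: "(\<Sum>i\<le>t. Poly_Mapping.lookup m i) \<le> 1" if "m \<in> Poly_Mapping.keys ?g" for m
    by (rule singular_cubic_low_degree[OF g t sing that])
  show ?thesis
  proof (rule low_degree_decomposition[OF g])
    fix C D
    assume "\<And>i. i \<le> t \<Longrightarrow> C i \<in> forms {t + 1..N} 2" "D \<in> forms {t + 1..N} 3" "?g = (\<Sum>i\<le>t. xvar i * C i) + D"
    then show ?thesis by (rule that)
  qed (rule low)
qed

lemma second_partials_vanish:
  assumes C: "\<And>i. i \<le> t \<Longrightarrow> C i \<in> forms {t + 1..N} 2" and D: "D \<in> forms {t + 1..N} 3"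
    and i: "i \<le> t" and j: "j \<le> t"
  shows "pdiff i (pdiff j ((\<Sum>i\<le>t. xvar i * C i) + D)) = 0"
proof -
  have C0: "pdiff k (C l) = 0" if "k \<le> t" "l \<le> t" for k l
    by (rule pdiff_eq_0[OF forms_subset_polys[THEN subsetD, OF C[OF that(2)]]]) (use that in simp)
  have D0: "pdiff k D = 0" if "k \<le> t" for k
    by (rule pdiff_eq_0[OF forms_subset_polys[THEN subsetD, OF D]]) (use that in simp)
  have "pdiff j ((\<Sum>i\<le>t. xvar i * C i) + D) = (\<Sum>l\<le>t. if j = l then C l else 0)"
    unfolding pdiff_add pdiff_sum pdiff_mult D0[OF j] pdiff_xvar
    by (simp add: C0[OF j] if_distrib[of "\<lambda>x. x * _"] cong: if_cong)
  also have "\<dots> = C j" using j by simp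
  finally show ?thesis using C0[OF i j] by simp
qed

text \<open>The phrase "up to projective transformations" is rendered in two clauses: some
  transformation carries the coordinate space onto S, and each one that does so brings f into the
  normal form.\<close>

theorem proposition3p1:
  fixes N :: nat and f :: "'k::{alg_closed_field, field_char_0} mpoly"
  assumes "N \<ge> 4"
    and "f \<in> forms {..N} 3"
    and "irreducible f"
  shows "(\<forall>\<tau> S. linear_space N \<tau> S \<and> S \<subseteq> sing_locus N f \<longrightarrow>
            (\<exists>A. proj_transformation N A \<and> (*\<^sub>v) A ` coord_space N \<tau> = S) \<and>
            (\<forall>A. proj_transformation N A \<and> (*\<^sub>v) A ` coord_space N \<tau> = S \<longrightarrow>
               (\<exists>C D. (\<forall>i \<le> \<tau>. C i \<in> forms {\<tau> + 1..N} 2) \<and> D \<in> forms {\<tau> + 1..N} 3 \<and>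
                  lin_subst A f = (\<Sum>i\<le>\<tau>. xvar i * C i) + D)) \<and>
            (real \<tau> > (real N - 1) / 2 \<longrightarrow> hessian N f = 0) \<and>
            (real \<tau> > (real N - real \<tau>) * (real N - real \<tau> + 1) / 2 - 1 \<longrightarrow>
               is_cone (hypersurface N f))) \<and>
         (N > 4 \<and> \<not> normal_hypersurface N f \<longrightarrow> is_cone (hypersurface N f))"
proof -
  have main: "(\<exists>A. proj_transformation N A \<and> (*\<^sub>v) A ` coord_space N \<tau> = S) \<and>
            (\<forall>A. proj_transformation N A \<and> (*\<^sub>v) A ` coord_space N \<tau> = S \<longrightarrow>
               (\<exists>C D. (\<forall>i \<le> \<tau>. C i \<in> forms {\<tau> + 1..N} 2) \<and> D \<in> forms {\<tau> + 1..N} 3 \<and>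
                  lin_subst A f = (\<Sum>i\<le>\<tau>. xvar i * C i) + D)) \<and>
            (real \<tau> > (real N - 1) / 2 \<longrightarrow> hessian N f = 0) \<and>
            (real \<tau> > (real N - real \<tau>) * (real N - real \<tau> + 1) / 2 - 1 \<longrightarrow>
               is_cone (hypersurface N f))"
    if S: "linear_space N \<tau> S" "S \<subseteq> sing_locus N f" for \<tau> S
  proof -
    have \<tau>: "\<tau> \<le> N" and ex: "\<exists>A. proj_transformation N A \<and> (*\<^sub>v) A ` coord_space N \<tau> = S"
      using linear_space_eq_image_coord_space[OF S(1)] by blast+
    have nf: "\<exists>C D. (\<forall>i \<le> \<tau>. C i \<in> forms {\<tau> + 1..N} 2) \<and> D \<in> forms {\<tau> + 1..N} 3 \<and>
                  lin_subst A f = (\<Sum>i\<le>\<tau>. xvar i * C i) + D"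
      if "proj_transformation N A" "(*\<^sub>v) A ` coord_space N \<tau> = S" for A
    proof -
      have A: "A \<in> carrier_mat (N + 1) (N + 1)" using that(1) by (simp add: proj_transformation_def)
      show ?thesis
        by (rule singular_space_normal_form[OF assms(2) S(2) \<tau> A that(2)]) blast
    qed
    obtain A where A: "A \<in> carrier_mat (N + 1) (N + 1)" "det A \<noteq> 0" "proj_transformation N A" "(*\<^sub>v) A ` coord_space N \<tau> = S"
      using ex unfolding proj_transformation_det by blast
    obtain C D where CD: "\<And>i. i \<le> \<tau> \<Longrightarrow> C i \<in> forms {\<tau> + 1..N} 2" "D \<in> forms {\<tau> + 1..N} 3"
      "lin_subst A f = (\<Sum>i\<le>\<tau>. xvar i * C i) + D"
      using nf[OF A(3,4)] by blast
    have hess: "hessian N f = 0" if big: "real \<tau> > (real N - 1) / 2"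
    proof (rule hessian_eq_0[OF assms(2) A(1,2) _ \<tau>])
      show "pdiff i (pdiff j (lin_subst A f)) = 0" if "i \<le> \<tau>" "j \<le> \<tau>" for i j
        unfolding CD(3) by (rule second_partials_vanish[OF CD(1,2) that])
      have "real (N + 1) < real (2 * (\<tau> + 1))" using big by simp
      then show "N + 1 < 2 * (\<tau> + 1)" by (simp only: of_nat_less_iff)
    qed
    have cone: "is_cone (hypersurface N f)" if big: "real \<tau> > (real N - real \<tau>) * (real N - real \<tau> + 1) / 2 - 1"
    proof (rule is_cone_of_dependent[OF assms(2) A(1,2) CD \<tau>])
      have "real ((N - \<tau>) * (N - \<tau> + 1)) < real ((\<tau> + 1) * 2)"
        using big \<tau> by (simp add: of_nat_diff field_simps)
      then have "(N - \<tau>) * (N - \<tau> + 1) < (\<tau> + 1) * 2" by (simp only: of_nat_less_iff)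
      then show "(N - \<tau>) * (N - \<tau> + 1) div 2 < \<tau> + 1" by (rule less_mult_imp_div_less)
    qed
    show ?thesis using ex nf hess cone by blast
  qed
  moreover have "is_cone (hypersurface N f)" if N: "N > 4" and nn: "\<not> normal_hypersurface N f"
  proof -
    have "f \<noteq> 0" using assms(3) by auto
    then obtain e where e: "meval (\<lambda>c. c) e f = 1" using unit_value_exists[OF assms(2)] by auto
    interpret irreducible_cubic N f e by unfold_locales (fact assms e)+
    obtain S where S: "linear_space N (N - 2) S" "S \<subseteq> sing_locus N f"
      by (rule singular_linear_space[OF nn]) (use N in simp)
    \<comment> \<open>For \<tau> = N - 2 the bound is 2 * 3 / 2 - 1 = 2, so the condition reads N -
      2 > 2.\<close>
    have "real (N - 2) > (real N - real (N - 2)) * (real N - real (N - 2) + 1) / 2 - 1"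
      using N by (simp add: of_nat_diff)
    then show ?thesis using main[OF S] by blast
  qed
  ultimately show ?thesis by blast
qed

end
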